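(* Let $n \ge 2$ and let $D$ be an open, convex, bounded and symmetric (that is, $D = -D$) subset of $\mathbb{R}^n$, with boundary $\partial D$. If there exists a distribution $f \neq 0$ on $\mathbb{R}^n$ with support in $\overline{D}$ such that the Radon transform $Rf$ of $f$ is supported on the set of supporting planes for $D$, then $\partial D$ must be an ellipsoid.
   Context: A supporting plane for $D$ is a hyperplane $L \subset \mathbb{R}^n$ such that $L \cap \overline{D}$ is non-empty and one of the components of $\mathbb{R}^n \setminus L$ is disjoint from $D$. No smoothness of $\partial D$ is assumed. The manifold of hyperplanes in $\mathbb{R}^n$ is identified with $(S^{n-1}\times\mathbb{R})/(\pm 1)$: the pair $(\omega,p)$, identified with $(-\omega,-p)$, corresponds to the hyperplane $\{x : x\cdot\omega = p\}$. A distribution on this manifold is a continuous linear form on $C_e^\infty(S^{n-1}\times\mathbb{R})$, the space of smooth even functions $\varphi(\omega,p)=\varphi(-\omega,-p)$ on $S^{n-1}\times\mathbb{R}$; a locally integrable even function $h(\omega,p)$ is identified with $\varphi \mapsto \int_{\mathbb{R}}\int_{S^{n-1}} h\varphi\, d\omega\, dp$, where $d\omega$ is area measure on $S^{n-1}$. With $R^*\varphi(x) = \int_{S^{n-1}} \varphi(\omega, x\cdot\omega)\, d\omega$, the Radon transform of a compactly supported distribution $f$ on $\mathbb{R}^n$ is the distribution $Rf$ given by $\langle Rf, \varphi\rangle = \langle f, R^*\varphi\rangle$. *)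

theory Defs
  imports "HOL-Analysis.Analysis"
begin

section \<open>Smooth functions\<close>

primrec iter_pderiv ::
  "'a list \<Rightarrow> ('a::euclidean_space \<Rightarrow> 'b::real_normed_vector) \<Rightarrow> 'a \<Rightarrow> 'b" where
  "iter_pderiv [] f = f"
| "iter_pderiv (b # bs) f = (\<lambda>x. frechet_derivative (iter_pderiv bs f) (at x) b)"

definition smooth_on_open ::
  "'a set \<Rightarrow> ('a::euclidean_space \<Rightarrow> 'b::real_normed_vector) \<Rightarrow> bool" where
  "smooth_on_open U f \<longleftrightarrow> open U \<and>
     (\<forall>bs. set bs \<subseteq> Basis \<longrightarrow> (\<forall>x\<in>U. iter_pderiv bs f differentiable (at x)))"

text \<open>
  Smoothness on an arbitrary subset of a Euclidean space, by local smooth extension. On an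
  embedded submanifold, such as the product of a sphere and a line, this is the intrinsic notion.
  On an open set it agrees with \<^const>\<open>smooth_on_open\<close>.
\<close>

definition smooth_on ::
  "'a set \<Rightarrow> ('a::euclidean_space \<Rightarrow> 'b::real_normed_vector) \<Rightarrow> bool" where
  "smooth_on M f \<longleftrightarrow>
     (\<forall>x\<in>M. \<exists>U g. x \<in> U \<and> smooth_on_open U g \<and> (\<forall>y\<in>U \<inter> M. g y = f y))"


section \<open>Distributions on Euclidean space\<close>

definition fun_support :: "('a::topological_space \<Rightarrow> complex) \<Rightarrow> 'a set" where
  "fun_support \<phi> = closure {x. \<phi> x \<noteq> 0}"

definition test_function :: "('a::euclidean_space \<Rightarrow> complex) \<Rightarrow> bool" where
  "test_function \<phi> \<longleftrightarrow> smooth_on_open UNIV \<phi> \<and> compact (fun_support \<phi>)"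

text \<open>
  A distribution is represented by a function on all complex-valued functions, of which only the
  values on test functions matter. Continuity is expressed by the usual estimate on each compact
  set, the sum running over all iterated partial derivatives of order at most \<open>N\<close>.
\<close>

definition distribution :: "(('a::euclidean_space \<Rightarrow> complex) \<Rightarrow> complex) \<Rightarrow> bool" where
  "distribution f \<longleftrightarrow>
     (\<forall>\<phi> \<psi>. test_function \<phi> \<longrightarrow> test_function \<psi> \<longrightarrow> f (\<lambda>x. \<phi> x + \<psi> x) = f \<phi> + f \<psi>) \<and>
     (\<forall>c \<phi>. test_function \<phi> \<longrightarrow> f (\<lambda>x. c * \<phi> x) = c * f \<phi>) \<and>
     (\<forall>K. compact K \<longrightarrow>
        (\<exists>C N. \<forall>\<phi>. test_function \<phi> \<longrightarrow> fun_support \<phi> \<subseteq> K \<longrightarrow>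
           norm (f \<phi>) \<le>
             C * (\<Sum>bs | set bs \<subseteq> Basis \<and> length bs \<le> N. SUP x. norm (iter_pderiv bs \<phi> x))))"

definition dist_nonzero :: "(('a::euclidean_space \<Rightarrow> complex) \<Rightarrow> complex) \<Rightarrow> bool" where
  "dist_nonzero f \<longleftrightarrow> (\<exists>\<phi>. test_function \<phi> \<and> f \<phi> \<noteq> 0)"

definition dist_support :: "(('a::euclidean_space \<Rightarrow> complex) \<Rightarrow> complex) \<Rightarrow> 'a set" where
  "dist_support f =
     - \<Union>{U. open U \<and> (\<forall>\<phi>. test_function \<phi> \<longrightarrow> fun_support \<phi> \<subseteq> U \<longrightarrow> f \<phi> = 0)}"

text \<open>
  The extension of a compactly supported distribution to smooth functions \<open>\<psi>\<close> without restriction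
  on the support: multiply \<open>\<psi>\<close> by a cutoff which is \<open>1\<close> near the support of the distribution. The
  value does not depend on the cutoff.
\<close>

definition cutoff :: "'a::euclidean_space set \<Rightarrow> ('a \<Rightarrow> complex) \<Rightarrow> bool" where
  "cutoff K \<eta> \<longleftrightarrow> test_function \<eta> \<and> (\<exists>V. open V \<and> K \<subseteq> V \<and> (\<forall>x\<in>V. \<eta> x = 1))"

definition dist_pairing ::
  "(('a::euclidean_space \<Rightarrow> complex) \<Rightarrow> complex) \<Rightarrow> ('a \<Rightarrow> complex) \<Rightarrow> complex" where
  "dist_pairing f \<psi> = f (\<lambda>x. (SOME \<eta>. cutoff (dist_support f) \<eta>) x * \<psi> x)"


section \<open>The manifold of hyperplanes\<close>

text \<open>
  A pair \<open>(\<omega>, p)\<close> with \<open>\<omega>\<close> in the unit sphere represents the hyperplane of all \<open>x\<close> with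
  \<open>x \<bullet> \<omega> = p\<close>. The pairs \<open>z\<close> and \<open>- z\<close> represent the same hyperplane. So functions and open sets
  on the manifold of hyperplanes are the even functions and the symmetric open sets on the
  product of the sphere and the line.
\<close>

definition hyperplane :: "'a::euclidean_space \<times> real \<Rightarrow> 'a set" where
  "hyperplane z = {x. x \<bullet> fst z = snd z}"

abbreviation sphere_line :: "('a::euclidean_space \<times> real) set" where
  "sphere_line \<equiv> sphere 0 1 \<times> UNIV"

definition even_smooth :: "('a::euclidean_space \<times> real \<Rightarrow> complex) \<Rightarrow> bool" where
  "even_smooth \<phi> \<longleftrightarrow> smooth_on sphere_line \<phi> \<and> (\<forall>z\<in>sphere_line. \<phi> (- z) = \<phi> z)"

definition sphere_line_support ::
  "('a::euclidean_space \<times> real \<Rightarrow> complex) \<Rightarrow> ('a \<times> real) set" where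
  "sphere_line_support \<phi> = closure {z \<in> sphere_line. \<phi> z \<noteq> 0}"

definition hyperplane_open :: "('a::euclidean_space \<times> real) set \<Rightarrow> bool" where
  "hyperplane_open W \<longleftrightarrow> openin (top_of_set sphere_line) W \<and> (\<forall>z\<in>W. - z \<in> W)"

text \<open>
  The support, as a set of hyperplanes, of a distribution on the manifold of hyperplanes.
\<close>

definition hyperplane_dist_support ::
  "(('a::euclidean_space \<times> real \<Rightarrow> complex) \<Rightarrow> complex) \<Rightarrow> 'a set set" where
  "hyperplane_dist_support u = hyperplane `
     (sphere_line - \<Union>{W. hyperplane_open W \<and>
        (\<forall>\<phi>. even_smooth \<phi> \<longrightarrow> compact (sphere_line_support \<phi>) \<longrightarrow>
             sphere_line_support \<phi> \<subseteq> W \<longrightarrow> u \<phi> = 0)})"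


section \<open>The Radon transform\<close>

text \<open>
  Area measure on the unit sphere: the area of a Borel set \<open>A\<close> is the dimension times the volume
  of the cone \<open>{t *\<^sub>R \<omega> | t \<omega>. 0 < t \<and> t \<le> 1 \<and> \<omega> \<in> A}\<close>.
\<close>

definition sphere_area :: "'a::euclidean_space measure" where
  "sphere_area = scale_measure (of_nat DIM('a))
     (distr (restrict_space lborel (cball 0 1 - {0})) (restrict_space borel (sphere 0 1)) sgn)"

definition dual_radon ::
  "('a::euclidean_space \<times> real \<Rightarrow> complex) \<Rightarrow> 'a \<Rightarrow> complex" where
  "dual_radon \<phi> x = (LINT \<omega>|sphere_area. \<phi> (\<omega>, x \<bullet> \<omega>))"

definition radon ::
  "(('a::euclidean_space \<Rightarrow> complex) \<Rightarrow> complex) \<Rightarrow> ('a \<times> real \<Rightarrow> complex) \<Rightarrow> complex" where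
  "radon f \<phi> = dist_pairing f (dual_radon \<phi>)"


section \<open>Supporting planes and ellipsoids\<close>

definition supporting_planes :: "'a::euclidean_space set \<Rightarrow> 'a set set" where
  "supporting_planes D = {L. L \<in> hyperplane ` sphere_line \<and> L \<inter> closure D \<noteq> {} \<and>
     (\<exists>C \<in> components (- L). C \<inter> D = {})}"

text \<open>An ellipsoid is understood as a nondegenerate quadric hypersurface, not as a solid.\<close>

definition ellipsoid :: "'a::euclidean_space set \<Rightarrow> bool" where
  "ellipsoid E \<longleftrightarrow> (\<exists>c T. linear T \<and> inj T \<and> E = (\<lambda>x. c + T x) ` sphere (0::'a) 1)"

end

theory Submission
  imports Defs "HOL-Computational_Algebra.Field_as_Ring" "HOL-Computational_Algebra.Fundamental_Theorem_Algebra"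
    "Jordan_Normal_Form.Determinant"
begin

text \<open>
  For each direction \<open>\<omega>\<close> the push-forward of \<open>f\<close> under \<open>x \<mapsto> x \<bullet> \<omega>\<close> is a distribution on the line
  whose order is bounded independently of \<open>\<omega>\<close>, and the hypothesis confines its support to the two
  points \<open>\<rho>(\<omega>)\<close> and \<open>-\<rho>(\<omega>)\<close>, where \<open>\<rho>\<close> is the support function of \<open>D\<close>. So the moments of \<open>f\<close> against
  \<open>(x \<bullet> \<xi>)\<^sup>k\<close>, which are polynomials in \<open>\<xi>\<close>, satisfy for each parity of \<open>k\<close> a linear recurrence of
  bounded order whose only characteristic root is \<open>\<rho>(\<xi>)\<^sup>2\<close>. Since \<open>f\<close> is not zero, some moment is
  not zero. On a line where some moment does not vanish identically, a Hankel determinant shows that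
  the root is a rational function of the parameter, Fatou's divisibility argument that it is a
  polynomial, and its growth that the degree is at most two. Hence \<open>\<rho>\<^sup>2\<close> is a quadratic form, and a
  convex body whose support function is a Euclidean norm is bounded by an ellipsoid.
\<close>

text \<open>Each slice is a sum of derivatives of point masses at the two points, with coefficients
  whose dependence on the direction is unknown. No regularity of these coefficients is used: all
  that enters is that the power \<open>N + 1\<close> of \<open>p^2 - \<rho>^2\<close> annihilates
  the slice, where \<open>N\<close> is the order of \<open>f\<close> on the support of one fixed
  cutoff. Fixing the parity makes multiplication by \<open>p^2\<close> the shift of the moment
  sequence, so the two points merge into one root. For a single root of multiplicity
  \<open>d + 1\<close> the next-to-leading coefficient of the recurrence is \<open>-(d + 1)\<close>
  times the root, so solving a linear system for that coefficient yields the root itself and not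
  just a symmetric function of several roots. Lines are used in order to have polynomials in one
  variable, where fractions can be reduced by a gcd. The recurrence is known only at real
  parameters, which suffices because polynomial identities are determined on any infinite set. The
  finitely many exceptional parameters on a line, and then the exceptional lines, are removed by the
  continuity of \<open>\<rho>\<close>.\<close>

no_notation scalar_prod (infix "\<bullet>" 70)

section \<open>Recurrences with polynomial coefficients\<close>

text \<open>The polynomial \<open>c\<close> evaluated at the shift operator and applied to
  \<open>s\<close>. This makes the sequences a module over the polynomials
  (\<open>act_mult\<close>), and a linear recurrence for \<open>s\<close> becomes a polynomial that
  annihilates it.\<close>

definition act :: "complex poly \<Rightarrow> (nat \<Rightarrow> complex) \<Rightarrow> nat \<Rightarrow> complex" where
  "act c s k = (\<Sum>j\<le>degree c. coeff c j * s (k + j))"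

lemma act_upto:
  assumes "degree c \<le> n"
  shows "act c s k = (\<Sum>j\<le>n. coeff c j * s (k + j))"
  unfolding act_def using assms
  by (intro sum.mono_neutral_left) (auto simp: coeff_eq_0)

lemma act_pCons: "act (pCons a c) s k = a * s k + act c s (Suc k)"
proof -
  have "act (pCons a c) s k = (\<Sum>j\<le>Suc (degree c). coeff (pCons a c) j * s (k + j))"
    by (rule act_upto) (simp add: degree_pCons_le)
  then show ?thesis
    by (subst (asm) sum.atMost_Suc_shift) (simp add: act_def)
qed

lemma act_0 [simp]: "act 0 s = (\<lambda>k. 0)"
  by (simp add: act_def fun_eq_iff)

lemma act_1 [simp]: "act 1 s = s"
  by (simp add: act_def fun_eq_iff)

lemma act_add: "act (c + d) s k = act c s k + act d s k"
  using act_upto[of c "max (degree c) (degree d)" s k]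
    act_upto[of d "max (degree c) (degree d)" s k]
    act_upto[of "c + d" "max (degree c) (degree d)" s k]
  by (simp add: degree_add_le sum.distrib algebra_simps)

lemma act_smult: "act (Polynomial.smult a c) s k = a * act c s k"
  using act_upto[of "Polynomial.smult a c" "degree c" s k]
  by (simp add: act_def sum_distrib_left mult.assoc)

lemma act_mult: "act (c * d) s k = act c (act d s) k"
proof (induction c arbitrary: k)
  case (pCons a c)
  then show ?case
    by (simp add: act_add act_smult act_pCons)
qed simp

lemma act_linear: "act [:a, b:] s k = a * s k + b * s (Suc k)"
  by (simp add: act_pCons)

lemma act_geometric:
  assumes "\<And>k. s (Suc k) = r * s k"
  shows "act c s k = poly c r * s k"
proof (induction c arbitrary: k)
  case (pCons a c)
  then show ?case
    by (simp add: act_pCons assms algebra_simps)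
qed simp

text \<open>Because \<open>c\<close> is monic of degree \<open>d\<close>, the recurrence expresses
  each term from index \<open>d\<close> on by the \<open>d\<close> terms before it.\<close>

lemma act_zero_extend:
  assumes "lead_coeff c = 1" "degree c = d" "act c v = (\<lambda>k. 0)" "\<And>k. k < d \<Longrightarrow> v k = 0"
  shows "v k = 0"
proof (induction k rule: less_induct)
  case (less k)
  show ?case
  proof (cases "k < d")
    case False
    then obtain i where i: "k = i + d"
      by (metis add.commute le_add_diff_inverse not_less)
    have "0 = act c v i" using assms(3) by simp
    also have "\<dots> = v (i + d) + (\<Sum>j<d. coeff c j * v (i + j))"
      using assms(1,2) by (auto simp: act_def lessThan_Suc_atMost[symmetric])
    also have "(\<Sum>j<d. coeff c j * v (i + j)) = 0"
      using less i by (intro sum.neutral) auto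
    finally show ?thesis using i by simp
  qed (use assms(4) in auto)
qed

text \<open>A recurrence of lower order would, after removing the factors \<open>z - r\<close>, annihilate the
  geometric sequence obtained by applying all but one of the factors.\<close>

lemma act_minimal:
  fixes r :: complex
  defines "X \<equiv> [:- r, 1:]"
  assumes ann: "act (X ^ Suc d) s = (\<lambda>k. 0)" and min: "act (X ^ d) s \<noteq> (\<lambda>k. 0)"
    and c: "degree c \<le> d" "\<And>k. k \<le> d \<Longrightarrow> act c s k = 0"
  shows "c = 0"
proof (rule ccontr)
  assume "c \<noteq> 0"
  have degX: "degree (X ^ n) = n" for n
    unfolding X_def by (rule degree_linear_power)
  have monicX: "lead_coeff (X ^ n) = 1" for n
    by (simp add: X_def lead_coeff_power)
  \<comment> \<open>\<open>act c s\<close> obeys the same monic recurrence of order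
    \<open>d + 1\<close> as \<open>s\<close>, and its first \<open>d + 1\<close> terms vanish by
    assumption.\<close>
  have cs: "act c s = (\<lambda>k. 0)"
  proof
    fix k
    have "act (X ^ Suc d) (act c s) = act c (act (X ^ Suc d) s)"
      by (simp add: fun_eq_iff act_mult[symmetric] mult.commute)
    also have "\<dots> = (\<lambda>k. 0)"
      unfolding ann by (simp add: act_def fun_eq_iff)
    finally show "act c s k = 0"
      using act_zero_extend[of "X ^ Suc d" "Suc d" "act c s" k] degX monicX c(2)
      by (metis less_Suc_eq_le)
  qed
  \<comment> \<open>The last nonzero stage: \<open>X\<close> still annihilates it, so it is
    geometric with ratio \<open>r\<close>.\<close>
  define w where "w = act (X ^ d) s"
  have w: "w (Suc k) = r * w k" for k
  proof -
    have "act X w k = act (X ^ Suc d) s k"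
      by (simp only: w_def act_mult[symmetric] power_Suc)
    then show ?thesis
      using ann by (simp add: X_def act_linear)
  qed
  \<comment> \<open>\<open>e\<close> is the multiplicity of \<open>r\<close> in \<open>c\<close>.
    Since \<open>e \<le> d\<close>, the missing factors \<open>X ^ (d - e)\<close> can be supplied,
    and \<open>c'\<close> then acts on \<open>w\<close> as the nonzero scalar
    \<open>poly c' r\<close>.\<close>
  obtain e c' where e: "c = X ^ e * c'" "poly c' r \<noteq> 0"
    using order_decomp[OF \<open>c \<noteq> 0\<close>, of r] unfolding X_def
    by (metis dvdE mult_zero_right power_0 mult_1 poly_eq_0_iff_dvd)
  then have "c' \<noteq> 0" by auto
  then have "e \<le> d"
    using c(1) e(1) degX[of e] by (simp add: degree_mult_eq X_def)
  then have "c' * X ^ d = X ^ (d - e) * c"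
    by (simp add: e(1) power_add[symmetric] mult.assoc[symmetric] mult.commute)
  then have "act c' w k = act (X ^ (d - e)) (act c s) k" for k
    by (simp add: w_def act_mult[symmetric])
  then have "poly c' r * w k = 0" for k
    using act_geometric[of w r c' k] w by (simp add: cs) (simp add: act_def)
  then show False
    using min e(2) unfolding w_def by auto
qed

text \<open>Cramer's rule without division: row \<open>m\<close> of the adjugate times the matrix is
  the determinant times a unit vector, an identity between polynomials. Nonsingularity is assumed at
  the single point \<open>z\<close>, where it makes the determinant nonzero.\<close>

lemma nonsingular_at_imp_adjugate_row:
  fixes h :: "nat \<Rightarrow> nat \<Rightarrow> complex poly"
  assumes nonsing: "\<forall>x. (\<forall>i<d. (\<Sum>l<d. poly (h i l) z * x l) = 0) \<longrightarrow> (\<forall>l<d. x l = (0::complex))"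
    and m: "m < d"
  obtains b \<Delta> where "poly \<Delta> z \<noteq> 0"
    "\<And>l. l < d \<Longrightarrow> (\<Sum>i<d. b i * h i l) = (if l = m then \<Delta> else 0)"
proof -
  define H where "H = mat d d (\<lambda>(i, l). h i l)"
  have H: "H \<in> carrier_mat d d" by (simp add: H_def)
  interpret comm_ring_hom "\<lambda>p. poly p z" by unfold_locales auto
  let ?H0 = "map_mat (\<lambda>p. poly p z) H"
  have "Determinant.det ?H0 \<noteq> 0"
  proof
    assume "Determinant.det ?H0 = 0"
    then obtain v where v: "v \<in> carrier_vec d" "v \<noteq> 0\<^sub>v d" "?H0 *\<^sub>v v = 0\<^sub>v d"
      using det_0_iff_vec_prod_zero[of ?H0 d] H by auto
    have "(\<Sum>l<d. poly (h i l) z * vec_index v l) = 0" if i: "i < d" for i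
    proof -
      have "vec_index (?H0 *\<^sub>v v) i = 0" using v i by simp
      then show ?thesis
        using i v(1) H by (simp add: H_def scalar_prod_def lessThan_atLeast0)
    qed
    then have "vec_index v l = 0" if "l < d" for l
      using nonsing[rule_format, of "vec_index v"] that by blast
    then have "v = 0\<^sub>v d" using v(1) by (intro eq_vecI) auto
    then show False using v by simp
  qed
  then have "poly (Determinant.det H) z \<noteq> 0" by simp
  moreover have "(\<Sum>i<d. (adj_mat H $$ (m, i)) * h i l) = (if l = m then Determinant.det H else 0)"
    if l: "l < d" for l
  proof -
    have "(adj_mat H * H) $$ (m, l) = (Determinant.det H \<cdot>\<^sub>m 1\<^sub>m d) $$ (m, l)"
      using adj_mat(3)[OF H] by simp
    moreover have "(adj_mat H * H) $$ (m, l) = (\<Sum>i<d. (adj_mat H $$ (m, i)) * H $$ (i, l))"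
      using l m H adj_mat(1)[OF H]
      by (simp add: times_mat_def scalar_prod_def lessThan_atLeast0)
    moreover have "(Determinant.det H \<cdot>\<^sub>m 1\<^sub>m d) $$ (m, l) =
        (if l = m then Determinant.det H else 0)"
      using l m by auto
    moreover have "(\<Sum>i<d. (adj_mat H $$ (m, i)) * H $$ (i, l)) =
        (\<Sum>i<d. (adj_mat H $$ (m, i)) * h i l)"
      by (intro sum.cong refl) (use l in \<open>simp add: H_def\<close>)
    ultimately show ?thesis by simp
  qed
  ultimately show ?thesis by (rule that)
qed

lemma poly_eqI_infinite:
  fixes p q :: "complex poly"
  assumes "infinite T" "\<And>t. t \<in> T \<Longrightarrow> poly p t = poly q t"
  shows "p = q"
proof (rule ccontr)
  assume "p \<noteq> q"
  then have "finite {t. poly (p - q) t = 0}" by (intro poly_roots_finite) simp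
  moreover have "T \<subseteq> {t. poly (p - q) t = 0}" using assms(2) by auto
  ultimately show False using assms(1) finite_subset by blast
qed

text \<open>With \<open>d + 1\<close> the least multiplicity that serves all of \<open>T\<close>,
  \<open>act_minimal\<close> makes the Hankel matrix \<open>s (i + l)\<close> of size
  \<open>d + 1\<close> nonsingular at some \<open>t0\<close>. The coefficients of
  \<open>(z - r t) ^ (d + 1)\<close> solve a linear system with this matrix, and Cramer's rule gives
  the one of index \<open>d\<close>, which is \<open>-(d + 1) r t\<close>, as a quotient of
  polynomials in \<open>t\<close>.\<close>

lemma characteristic_root_rational:
  fixes s :: "nat \<Rightarrow> complex poly" and r :: "complex \<Rightarrow> complex"
  assumes rec: "\<And>t. t \<in> T \<Longrightarrow> act ([:- r t, 1:] ^ M) (\<lambda>k. poly (s k) t) = (\<lambda>k. 0)"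
    and nz: "t1 \<in> T" "poly (s k1) t1 \<noteq> 0"
  obtains d \<Delta> b t0 where "t0 \<in> T" "poly \<Delta> t0 \<noteq> 0" "\<And>t. t \<in> T \<Longrightarrow> poly \<Delta> t * r t = poly b t"
    "\<And>t. t \<in> T \<Longrightarrow> act ([:- r t, 1:] ^ Suc d) (\<lambda>k. poly (s k) t) = (\<lambda>k. 0)"
    "act ([:- r t0, 1:] ^ d) (\<lambda>k. poly (s k) t0) \<noteq> (\<lambda>k. 0)"
proof -
  let ?S = "\<lambda>t k. poly (s k) t"
  define P where "P n \<longleftrightarrow> (\<forall>t\<in>T. act ([:- r t, 1:] ^ n) (?S t) = (\<lambda>k. 0))" for n
  have "P M" using rec by (simp add: P_def)
  moreover have "\<not> P 0" using nz by (auto simp: P_def fun_eq_iff)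
  ultimately obtain d where d: "\<not> P d" "P (Suc d)"
    using ex_least_nat_less[of P M] by blast
  then obtain t0 where t0: "t0 \<in> T" "act ([:- r t0, 1:] ^ d) (?S t0) \<noteq> (\<lambda>k. 0)"
    by (auto simp: P_def)
  have ann: "act ([:- r t, 1:] ^ Suc d) (?S t) = (\<lambda>k. 0)" if "t \<in> T" for t
    using d that by (auto simp: P_def)
  \<comment> \<open>A kernel vector of the Hankel matrix is the coefficient list of a polynomial of
    degree at most \<open>d\<close> whose action on \<open>s\<close> vanishes at the first
    \<open>d + 1\<close> indices.\<close>
  have nonsing: "x l = 0"
    if x: "\<And>i. i < Suc d \<Longrightarrow> (\<Sum>l<Suc d. poly (s (i + l)) t0 * x l) = 0" and l: "l < Suc d" for x l
  proof -
    define c where "c = Poly (map x [0..<Suc d])"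
    have coeff: "coeff c j = (if j \<le> d then x j else 0)" for j
      by (simp add: c_def nth_default_def del: upt_Suc)
    have deg: "degree c \<le> d"
      by (rule degree_le) (simp add: coeff)
    have "act c (?S t0) k = 0" if "k \<le> d" for k
      using act_upto[OF deg, of "?S t0" k] x[of k] that
      by (simp add: coeff lessThan_Suc_atMost mult.commute)
    then have "c = 0"
      using act_minimal[OF ann[OF t0(1)] t0(2) deg] by blast
    then show ?thesis using coeff[of l] l by simp
  qed
  then have "\<forall>x. (\<forall>i<Suc d. (\<Sum>l<Suc d. poly (s (i + l)) t0 * x l) = 0) \<longrightarrow> (\<forall>l<Suc d. x l = 0)"
    by blast
  \<comment> \<open>Row \<open>d\<close> of the adjugate, since it isolates the coefficient of index
    \<open>d\<close>, the one that is linear in the root.\<close>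
  then obtain b \<Delta> where b: "poly \<Delta> t0 \<noteq> 0"
    "\<And>l. l < Suc d \<Longrightarrow> (\<Sum>i<Suc d. b i * s (i + l)) = (if l = d then \<Delta> else 0)"
    by (rule nonsingular_at_imp_adjugate_row[where h = "\<lambda>i l. s (i + l)" and d = "Suc d"
        and z = t0, OF _ lessI[of d]]) (rule that)
  define B where "B = (\<Sum>i<Suc d. b i * s (i + Suc d))"
  have eq: "poly (Polynomial.smult (of_nat (Suc d)) \<Delta>) t * r t = poly B t" if t: "t \<in> T" for t
  proof -
    define a where "a l = coeff ([:- r t, 1:] ^ Suc d) l" for l
    have a1: "a (Suc d) = 1" and ad: "a d = - of_nat (Suc d) * r t"
      unfolding a_def by (simp_all add: coeff_linear_poly_power algebra_simps del: power_Suc)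
    have rc: "(\<Sum>l<Suc d. a l * poly (s (i + l)) t) = - poly (s (i + Suc d)) t" for i
    proof -
      have "0 = act ([:- r t, 1:] ^ Suc d) (?S t) i"
        by (rule fun_cong[OF ann[OF t], symmetric])
      also have "\<dots> = (\<Sum>l\<le>Suc d. a l * poly (s (i + l)) t)"
        unfolding a_def by (rule act_upto) (simp only: degree_linear_power order_refl)
      also have "\<dots> = (\<Sum>l<Suc d. a l * poly (s (i + l)) t) + poly (s (i + Suc d)) t"
        by (simp only: sum.atMost_Suc a1 lessThan_Suc_atMost mult_1)
      finally show ?thesis unfolding eq_neg_iff_add_eq_0 by (rule sym)
    qed
    have "poly \<Delta> t * a d = (\<Sum>l<Suc d. a l * poly (if l = d then \<Delta> else 0) t)"
      by (simp add: if_distrib if_distribR cong: if_cong)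
    also have "\<dots> = (\<Sum>l<Suc d. a l * poly (\<Sum>i<Suc d. b i * s (i + l)) t)"
      by (intro sum.cong refl) (simp add: b del: sum.lessThan_Suc)
    also have "\<dots> = (\<Sum>l<Suc d. \<Sum>i<Suc d. poly (b i) t * (a l * poly (s (i + l)) t))"
      by (simp add: poly_sum sum_distrib_left mult.assoc mult.left_commute del: sum.lessThan_Suc)
    also have "\<dots> = (\<Sum>i<Suc d. \<Sum>l<Suc d. poly (b i) t * (a l * poly (s (i + l)) t))"
      by (rule sum.swap)
    also have "\<dots> = (\<Sum>i<Suc d. poly (b i) t * (- poly (s (i + Suc d)) t))"
      by (simp only: sum_distrib_left[symmetric] rc)
    also have "\<dots> = - poly B t"
      by (simp add: B_def poly_sum sum_negf del: sum.lessThan_Suc add_Suc_right)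
    finally have "poly B t = - (poly \<Delta> t * a d)" by simp
    also have "\<dots> = poly (Polynomial.smult (of_nat (Suc d)) \<Delta>) t * r t" by (simp add: ad algebra_simps)
    finally show ?thesis by simp
  qed
  have "poly (Polynomial.smult (of_nat (Suc d)) \<Delta>) t0 \<noteq> 0"
    using b(1) by (simp del: of_nat_Suc)
  from that[OF t0(1) this eq ann t0(2)] show ?thesis .
qed

text \<open>The argument of Fatou's lemma: a pole of \<open>r\<close> would divide the polynomial \<open>v 0\<close> to every
  order.\<close>

theorem characteristic_root_polynomial:
  fixes s :: "nat \<Rightarrow> complex poly" and r :: "complex \<Rightarrow> complex"
  assumes inf: "infinite T"
    and rec: "\<And>t. t \<in> T \<Longrightarrow> act ([:- r t, 1:] ^ M) (\<lambda>k. poly (s k) t) = (\<lambda>k. 0)"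
    and nz: "s k1 \<noteq> 0"
  obtains a where "finite {t \<in> T. r t \<noteq> poly a t}"
proof -
  let ?S = "\<lambda>t k. poly (s k) t"
  obtain t1 where t1: "t1 \<in> T" "poly (s k1) t1 \<noteq> 0"
    using poly_eqI_infinite[OF inf, of "s k1" 0] nz by auto
  obtain d \<Delta> b t0 where t0: "t0 \<in> T" and \<Delta>0: "poly \<Delta> t0 \<noteq> 0"
    and r: "\<And>t. t \<in> T \<Longrightarrow> poly \<Delta> t * r t = poly b t"
    and ann: "\<And>t. t \<in> T \<Longrightarrow> act ([:- r t, 1:] ^ Suc d) (?S t) = (\<lambda>k. 0)"
    and min: "act ([:- r t0, 1:] ^ d) (?S t0) \<noteq> (\<lambda>k. 0)"
    by (rule characteristic_root_rational[OF rec t1]) (assumption, rule that)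
  \<comment> \<open>\<open>a / q\<close> is \<open>b / \<Delta>\<close> in lowest terms; on
    \<open>T\<close>, away from the zeros of the common factor \<open>g\<close>, it represents
    \<open>r\<close>.\<close>
  define g where "g = gcd \<Delta> b"
  obtain q a where q: "\<Delta> = g * q" and a: "b = g * a"
    unfolding g_def by (meson dvdE gcd_dvd1 gcd_dvd2)
  have "\<Delta> \<noteq> 0" using \<Delta>0 by auto
  then have "q \<noteq> 0" using q by auto
  from \<open>\<Delta> \<noteq> 0\<close> have cop: "coprime q a"
    using q a unfolding g_def by (intro gcd_coprime[of \<Delta> b]) (auto simp: mult.commute)
  define T' where "T' = {t \<in> T. poly g t \<noteq> 0}"
  have g: "g \<noteq> 0" "poly g t0 \<noteq> 0" and q0: "poly q t0 \<noteq> 0" using \<Delta>0 q by auto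
  have fin: "finite {t \<in> T. poly g t = 0}"
    by (rule finite_subset[OF _ poly_roots_finite[OF g(1)]]) auto
  have inf': "infinite T'"
  proof
    assume "finite T'"
    then have "finite ({t \<in> T. poly g t = 0} \<union> T')" using fin by simp
    moreover have "{t \<in> T. poly g t = 0} \<union> T' = T" by (auto simp: T'_def)
    ultimately show False using inf by simp
  qed
  have qr: "poly q t * r t = poly a t" if "t \<in> T'" for t
    using r[of t] that q a by (auto simp: T'_def)
  define w where "w t = act ([:- r t, 1:] ^ d) (?S t)" for t
  have w: "w t (Suc k) = r t * w t k" if "t \<in> T" for t k
  proof -
    have "act [:- r t, 1:] (w t) k = act ([:- r t, 1:] ^ Suc d) (?S t) k"
      by (simp only: w_def act_mult[symmetric] power_Suc)
    then show ?thesis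
      using ann[OF that] by (simp add: act_linear)
  qed
  \<comment> \<open>The value of \<open>(z - r) ^ d\<close> on \<open>s\<close> with denominators
    cleared: off the zeros of \<open>g\<close>, \<open>v k\<close> is \<open>q ^ d\<close> times
    \<open>w k\<close>, with \<open>q r\<close> rewritten as the polynomial
    \<open>a\<close>.\<close>
  define v where
    "v k = (\<Sum>j\<le>d. of_nat (d choose j) * ((- a) ^ (d - j) * (q ^ j * s (k + j))))" for k
  have v: "poly (v k) t = poly q t ^ d * w t k" if t: "t \<in> T'" for t k
  proof -
    have "w t k = (\<Sum>j\<le>d. of_nat (d choose j) * (- r t) ^ (d - j) * poly (s (k + j)) t)"
      unfolding w_def act_def degree_linear_power
      by (intro sum.cong refl) (simp add: coeff_linear_poly_power)
    then have "poly q t ^ d * w t k =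
        (\<Sum>j\<le>d. poly q t ^ d * (of_nat (d choose j) * (- r t) ^ (d - j) * poly (s (k + j)) t))"
      by (simp add: sum_distrib_left)
    also have "\<dots> = (\<Sum>j\<le>d. of_nat (d choose j) *
        ((- poly a t) ^ (d - j) * (poly q t ^ j * poly (s (k + j)) t)))"
    proof (intro sum.cong refl)
      fix j assume "j \<in> {..d}"
      then have "poly q t ^ d = poly q t ^ (d - j) * poly q t ^ j"
        by (simp add: power_add[symmetric])
      moreover have "(- poly a t) ^ (d - j) = poly q t ^ (d - j) * (- r t) ^ (d - j)"
        by (simp add: qr[OF t, symmetric] power_mult_distrib[symmetric])
      ultimately show "poly q t ^ d * (of_nat (d choose j) * (- r t) ^ (d - j) * poly (s (k + j)) t)
        = of_nat (d choose j) * ((- poly a t) ^ (d - j) * (poly q t ^ j * poly (s (k + j)) t))"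
        by simp
    qed
    finally show ?thesis
      by (simp add: v_def poly_sum)
  qed
  have step: "q * v (Suc k) = a * v k" for k
  proof (rule poly_eqI_infinite[OF inf'])
    fix t assume t: "t \<in> T'"
    then show "poly (q * v (Suc k)) t = poly (a * v k) t"
      using w[of t k] by (simp add: v qr[OF t, symmetric] T'_def)
  qed
  have qv: "q ^ k * v k = a ^ k * v 0" for k
  proof (induction k)
    case (Suc k)
    have "q ^ Suc k * v (Suc k) = q ^ k * (q * v (Suc k))" by (simp add: mult.assoc mult.left_commute)
    also have "\<dots> = a * (q ^ k * v k)" by (simp only: step mult.left_commute)
    finally show ?case by (simp only: Suc.IH power_Suc mult.assoc)
  qed simp
  \<comment> \<open>At \<open>t0\<close> the sequence \<open>w\<close> is not identically zero, and
    a geometric sequence that starts with zero is zero.\<close>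
  have v0: "v 0 \<noteq> 0"
  proof
    assume "v 0 = 0"
    then have "w t0 0 = 0" using v[of t0 0] t0 g(2) q0 by (simp add: T'_def)
    then have "w t0 k = 0" for k by (induction k) (simp_all add: w t0)
    then show False using min by (auto simp: w_def)
  qed
  \<comment> \<open>From \<open>q ^ k * v k = a ^ k * v 0\<close> and coprimality. The fixed degree
    of \<open>v 0\<close> then leaves only a constant \<open>q\<close>.\<close>
  have "q ^ k dvd v 0" for k
  proof -
    have "q ^ k dvd a ^ k * v 0" using qv[of k] by (metis dvd_triv_left)
    moreover have "coprime (q ^ k) (a ^ k)" using cop by simp
    ultimately show ?thesis by (simp add: coprime_dvd_mult_right_iff)
  qed
  then have "degree (q ^ k) \<le> degree (v 0)" for k
    using v0 dvd_imp_degree_le by blast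
  then have "k * degree q \<le> degree (v 0)" for k
    using \<open>q \<noteq> 0\<close> by (simp add: degree_power_eq)
  from this[of "Suc (degree (v 0))"] have "degree q = 0"
    by (cases "degree q") auto
  then obtain c where c: "q = [:c:]" by (rule degree_eq_zeroE)
  then have "c \<noteq> 0" using q \<open>\<Delta> \<noteq> 0\<close> by auto
  have "{t \<in> T. r t \<noteq> poly (Polynomial.smult (1 / c) a) t} \<subseteq> {t \<in> T. poly g t = 0}"
  proof safe
    fix t assume "t \<in> T" "r t \<noteq> poly (Polynomial.smult (1 / c) a) t"
    then show "poly g t = 0"
      using qr[of t] c \<open>c \<noteq> 0\<close> by (cases "poly g t = 0") (auto simp: T'_def field_simps)
  qed
  then have "finite {t \<in> T. r t \<noteq> poly (Polynomial.smult (1 / c) a) t}"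
    using fin by (rule finite_subset)
  then show ?thesis by (rule that)
qed

section \<open>Support functions and ellipsoids\<close>

definition support_function :: "'a::euclidean_space set \<Rightarrow> 'a \<Rightarrow> real" where
  "support_function D \<xi> = (SUP x\<in>D. x \<bullet> \<xi>)"

lemma bdd_above_inner: "bounded D \<Longrightarrow> bdd_above ((\<lambda>x. x \<bullet> \<xi>) ` (D :: 'a::euclidean_space set))"
  by (intro bounded_imp_bdd_above bounded_linear_image bounded_linear_inner_left)

context
  fixes D :: "'a::euclidean_space set"
  assumes ne: "D \<noteq> {}" and bdd: "bounded D"
begin

lemma inner_le_support_function:
  assumes "x \<in> closure D"
  shows "x \<bullet> \<xi> \<le> support_function D \<xi>"
proof -
  have "D \<subseteq> {x. x \<bullet> \<xi> \<le> support_function D \<xi>}"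
    unfolding support_function_def by (auto intro!: cSUP_upper bdd_above_inner bdd)
  moreover have "closed {x. x \<bullet> \<xi> \<le> support_function D \<xi>}"
    by (intro closed_Collect_le continuous_intros)
  ultimately show ?thesis using assms closure_minimal by blast
qed

lemma support_function_le:
  assumes "\<And>x. x \<in> D \<Longrightarrow> x \<bullet> \<xi> \<le> c"
  shows "support_function D \<xi> \<le> c"
  unfolding support_function_def using ne assms by (rule cSUP_least)

lemma support_function_scaleR:
  assumes "0 < c"
  shows "support_function D (c *\<^sub>R \<xi>) = c * support_function D \<xi>"
proof (rule antisym)
  show "support_function D (c *\<^sub>R \<xi>) \<le> c * support_function D \<xi>"
    using assms closure_subset inner_le_support_function
    by (intro support_function_le) (auto intro!: mult_left_mono)
  have "support_function D \<xi> \<le> support_function D (c *\<^sub>R \<xi>) / c"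
  proof (rule support_function_le)
    fix x assume "x \<in> D"
    then have "x \<bullet> (c *\<^sub>R \<xi>) \<le> support_function D (c *\<^sub>R \<xi>)"
      using closure_subset by (intro inner_le_support_function) auto
    then show "x \<bullet> \<xi> \<le> support_function D (c *\<^sub>R \<xi>) / c"
      using assms by (simp add: field_simps)
  qed
  then show "c * support_function D \<xi> \<le> support_function D (c *\<^sub>R \<xi>)"
    using assms by (simp add: field_simps)
qed

lemma support_function_lipschitz:
  obtains R where "0 \<le> R"
    "\<And>\<xi> \<zeta>. \<bar>support_function D \<xi> - support_function D \<zeta>\<bar> \<le> R * norm (\<xi> - \<zeta>)"
proof -
  obtain R where R: "\<And>x. x \<in> D \<Longrightarrow> norm x \<le> R"
    using bdd unfolding bounded_iff by blast
  then have R0: "0 \<le> R" using ne by (metis ex_in_conv norm_ge_zero order_trans)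
  have le: "support_function D \<xi> \<le> support_function D \<zeta> + R * norm (\<xi> - \<zeta>)" for \<xi> \<zeta>
  proof (rule support_function_le)
    fix x assume x: "x \<in> D"
    have "x \<bullet> \<xi> = x \<bullet> \<zeta> + x \<bullet> (\<xi> - \<zeta>)" by (simp add: inner_diff_right)
    moreover have "x \<bullet> (\<xi> - \<zeta>) \<le> R * norm (\<xi> - \<zeta>)"
      using norm_cauchy_schwarz[of x "\<xi> - \<zeta>"] mult_right_mono[OF R[OF x], of "norm (\<xi> - \<zeta>)"]
      by simp
    moreover have "x \<bullet> \<zeta> \<le> support_function D \<zeta>"
      using x closure_subset by (intro inner_le_support_function) auto
    ultimately show "x \<bullet> \<xi> \<le> support_function D \<zeta> + R * norm (\<xi> - \<zeta>)" by simp
  qed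
  have "\<bar>support_function D \<xi> - support_function D \<zeta>\<bar> \<le> R * norm (\<xi> - \<zeta>)" for \<xi> \<zeta>
    using le[of \<xi> \<zeta>] le[of \<zeta> \<xi>] by (simp add: norm_minus_commute abs_le_iff)
  with R0 show ?thesis by (rule that)
qed

lemma support_function_0: "support_function D 0 = 0"
  unfolding support_function_def using ne by simp

lemma continuous_on_support_function: "continuous_on S (support_function D)"
proof -
  obtain R where R: "0 \<le> R"
    "\<And>\<xi> \<zeta>. \<bar>support_function D \<xi> - support_function D \<zeta>\<bar> \<le> R * norm (\<xi> - \<zeta>)"
    using support_function_lipschitz by blast
  then have "R-lipschitz_on S (support_function D)"
    by (intro lipschitz_onI) (auto simp: dist_norm)
  then show ?thesis by (rule lipschitz_on_continuous_on)
qed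

text \<open>A point outside the closed convex set is strictly separated from it by a hyperplane, and
  the normal of that hyperplane violates one of the inequalities.\<close>

lemma in_closure_iff_support_function:
  assumes "convex D"
  shows "x \<in> closure D \<longleftrightarrow> (\<forall>\<xi>. x \<bullet> \<xi> \<le> support_function D \<xi>)"
proof
  assume x: "\<forall>\<xi>. x \<bullet> \<xi> \<le> support_function D \<xi>"
  show "x \<in> closure D"
  proof (rule ccontr)
    assume "x \<notin> closure D"
    then obtain a b where ab: "a \<bullet> x < b" "\<And>y. y \<in> closure D \<Longrightarrow> b < a \<bullet> y"
      using separating_hyperplane_closed_point[of "closure D" x] assms by (auto simp: convex_closure)
    have "support_function D (- a) \<le> - b"
      using ab(2) closure_subset[of D]
      by (intro support_function_le) (auto simp: inner_commute intro!: less_imp_le)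
    with x ab(1) show False
      by (metis inner_commute inner_minus_right neg_le_iff_le not_less order_trans)
  qed
qed (use inner_le_support_function in auto)

lemma support_function_minus:
  assumes "uminus ` D = D"
  shows "support_function D (- \<xi>) = support_function D \<xi>"
proof -
  have "support_function D (- \<xi>) = (SUP x\<in>uminus ` D. x \<bullet> \<xi>)"
    unfolding support_function_def image_image by simp
  then show ?thesis unfolding assms support_function_def .
qed

lemma support_function_pos:
  assumes "open D" "0 \<in> D" "\<xi> \<noteq> 0"
  shows "0 < support_function D \<xi>"
proof -
  obtain e where e: "0 < e" "cball 0 e \<subseteq> D"
    using assms(1,2) open_contains_cball by blast
  then have "(e / norm \<xi>) *\<^sub>R \<xi> \<in> D"
    using assms(3) by (intro subsetD[OF e(2)]) (simp add: less_imp_le)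
  then have "((e / norm \<xi>) *\<^sub>R \<xi>) \<bullet> \<xi> \<le> support_function D \<xi>"
    using closure_subset by (intro inner_le_support_function) auto
  moreover have "((e / norm \<xi>) *\<^sub>R \<xi>) \<bullet> \<xi> = e * norm \<xi>"
    using assms(3) by (simp add: dot_square_norm power2_eq_square)
  ultimately show ?thesis using e(1) assms(3) by (smt (verit) mult_pos_pos zero_less_norm_iff)
qed

text \<open>The component that misses \<open>D\<close> contains an entire open half-space, because
  half-spaces are connected. So \<open>D\<close> lies in the opposite closed half-space, and the
  point of contact with the closure forces equality. Symmetry of \<open>D\<close> turns the lower
  half-space into the value \<open>-\<rho>\<close>.\<close>

lemma supporting_plane_imp:
  assumes sym: "uminus ` D = D" and sp: "hyperplane (\<omega>, p) \<in> supporting_planes D"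
  shows "p = support_function D \<omega> \<or> p = - support_function D \<omega>"
proof -
  obtain C x where C: "C \<in> components (- hyperplane (\<omega>, p))" "C \<inter> D = {}"
    and x: "x \<in> hyperplane (\<omega>, p)" "x \<in> closure D"
    using sp unfolding supporting_planes_def by blast
  have xp: "x \<bullet> \<omega> = p" using x(1) by (simp add: hyperplane_def)
  obtain y where y: "y \<in> C" using in_components_nonempty[OF C(1)] by blast
  then have yp: "y \<bullet> \<omega> \<noteq> p"
    using in_components_subset[OF C(1)] by (auto simp: hyperplane_def)
  have sub: "H \<subseteq> C" if "convex H" "y \<in> H" "H \<subseteq> - hyperplane (\<omega>, p)" for H
    using that y by (intro components_maximal[OF C(1)]) (auto simp: convex_connected)
  have cg: "convex {z. z \<bullet> \<omega> > p}"
    using convex_halfspace_gt[of p \<omega>] by (simp only: inner_commute[of \<omega>])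
  have cl: "convex {z. z \<bullet> \<omega> < p}"
    using convex_halfspace_lt[of \<omega> p] by (simp only: inner_commute[of \<omega>])
  consider "y \<bullet> \<omega> > p" | "y \<bullet> \<omega> < p" using yp by linarith
  then show ?thesis
  proof cases
    case 1
    then have "{z. z \<bullet> \<omega> > p} \<subseteq> C"
      by (intro sub cg) (auto simp: hyperplane_def)
    then have "support_function D \<omega> \<le> p"
      using C(2) by (intro support_function_le) force
    then show ?thesis using inner_le_support_function[OF x(2), of \<omega>] xp by simp
  next
    case 2
    then have "{z. z \<bullet> \<omega> < p} \<subseteq> C"
      by (intro sub cl) (auto simp: hyperplane_def)
    then have "support_function D (- \<omega>) \<le> - p"
      using C(2) by (intro support_function_le) force
    then show ?thesis
      using inner_le_support_function[OF x(2), of "- \<omega>"] xp by (simp add: support_function_minus sym)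
  qed
qed

end

text \<open>Split off the part of degree three and more,
  \<open>a = a0 + a1 z + a2 z^2 + z^3 b\<close>. The growth bound forces \<open>b\<close> to be of
  size \<open>1 / t\<close> for real \<open>t \<ge> 1\<close>, and a nonzero polynomial does not
  decay.\<close>

lemma polynomial_quadratic_growth:
  fixes a :: "complex poly" and f :: "real \<Rightarrow> real"
  assumes f: "\<And>t. complex_of_real (f t) = poly a (of_real t)"
    and growth: "\<And>t. 1 \<le> t \<Longrightarrow> \<bar>f t\<bar> \<le> C * t\<^sup>2"
  obtains a0 a1 a2 where "\<And>t. complex_of_real (f t) = a0 + a1 * of_real t + a2 * of_real t ^ 2"
proof -
  obtain a0 a1 a2 b where a: "a = pCons a0 (pCons a1 (pCons a2 b))"
    by (metis pCons_cases)
  define K where "K = C + norm a0 + norm a1 + norm a2"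
  have bd: "norm (poly b (of_real t)) \<le> K / t" if t: "1 \<le> t" for t
  proof -
    have t0: "0 < t" "t \<le> t\<^sup>2" "1 \<le> t\<^sup>2"
      using t self_le_power[of t 2] one_le_power[of t 2] by auto
    have eq: "of_real t ^ 3 * poly b (of_real t) =
      of_real (f t) - a0 - a1 * of_real t - a2 * of_real t ^ 2"
      unfolding f a by (simp add: algebra_simps power2_eq_square power3_eq_cube)
    have "t ^ 3 * norm (poly b (of_real t)) = norm (of_real t ^ 3 * poly b (of_real t))"
      using t0 by (simp add: norm_mult norm_power)
    also have "\<dots> \<le> norm (complex_of_real (f t)) + norm a0 + norm (a1 * of_real t)
        + norm (a2 * of_real t ^ 2)"
      unfolding eq by (intro order_trans[OF norm_triangle_ineq4] add_mono order_refl)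
    also have "\<dots> \<le> C * t\<^sup>2 + norm a0 * t\<^sup>2 + norm a1 * t\<^sup>2 + norm a2 * t\<^sup>2"
      using growth[OF t] t0
      mult_left_mono[OF t0(3) norm_ge_zero[of a0]] mult_left_mono[OF t0(2) norm_ge_zero[of a1]]
      by (intro add_mono) (simp_all add: norm_mult norm_power)
    also have "\<dots> = t\<^sup>2 * K" by (simp add: K_def algebra_simps)
    finally have "t\<^sup>2 * (t * norm (poly b (of_real t))) \<le> t\<^sup>2 * K"
      by (simp add: power2_eq_square power3_eq_cube mult.assoc)
    then have "t * norm (poly b (of_real t)) \<le> K"
      using t0 by (simp add: mult_le_cancel_left)
    then show ?thesis using t0 by (simp add: field_simps)
  qed
  have K0: "0 \<le> K" using order_trans[OF norm_ge_zero bd[of 1]] by simp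
  obtain c b' where b: "b = pCons c b'" by (metis pCons_cases)
  have "b' = 0"
  proof (rule ccontr)
    assume "b' \<noteq> 0"
    then obtain r where r: "\<And>z. r \<le> norm z \<Longrightarrow> K + 1 \<le> norm (poly b z)"
      unfolding b using poly_infinity[of b' "K + 1" c] by blast
    define t where "t = max 1 r"
    have t: "1 \<le> t" "r \<le> norm (complex_of_real t)" by (auto simp: t_def)
    then have "K + 1 \<le> K / t" using r[OF t(2)] bd[OF t(1)] by simp
    also have "\<dots> \<le> K" using K0 t(1) mult_left_mono[of 1 t K] by (simp add: field_simps)
    finally show False by simp
  qed
  have "c = 0"
  proof (rule ccontr)
    assume "c \<noteq> 0"
    \<comment> \<open>Large enough for \<open>norm c * t\<close> to exceed \<open>K\<close>, against
      the decay bound \<open>K / t\<close>.\<close>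
    define t where "t = max 1 ((K + 1) / norm c)"
    have "norm c * t \<le> K" using bd[of t] \<open>b' = 0\<close> b by (simp add: t_def field_simps)
    moreover have "K + 1 \<le> norm c * t" using \<open>c \<noteq> 0\<close> by (simp add: t_def field_simps max_def)
    ultimately show False by simp
  qed
  then have "complex_of_real (f t) = a0 + a1 * of_real t + a2 * of_real t ^ 2" for t
    using \<open>b' = 0\<close> b unfolding f a by (simp add: algebra_simps power2_eq_square)
  then show ?thesis by (rule that)
qed

text \<open>Continuity empties the finite exceptional set, and growth bounds the degree by two. The
  coefficients are read off at \<open>0\<close>, at \<open>1\<close> and \<open>-1\<close>, and at
  infinity, where homogeneity turns \<open>q (x + t y) / t^2\<close> into
  \<open>q (y + x / t)\<close>. The resulting identity mentions only values of \<open>q\<close>, so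
  it passes to limits in \<open>x\<close>.\<close>

lemma quadratic_on_line:
  fixes q :: "'a::euclidean_space \<Rightarrow> real"
  assumes cont: "continuous_on UNIV q"
    and hom: "\<And>c x. 0 < c \<Longrightarrow> q (c *\<^sub>R x) = c\<^sup>2 * q x"
    and growth: "\<And>x. \<bar>q x\<bar> \<le> C * (norm x)\<^sup>2"
    and poly: "finite {t. complex_of_real (q (x + t *\<^sub>R y)) \<noteq> poly a (of_real t)}"
  shows "q (x + t *\<^sub>R y) = q x + t * ((q (x + y) - q (x - y)) / 2) + t\<^sup>2 * q y"
proof -
  let ?f = "\<lambda>t. q (x + t *\<^sub>R y)"
  have contf: "continuous_on UNIV ?f"
    by (intro continuous_on_compose2[OF cont] continuous_intros) auto
  have f: "complex_of_real (?f t) = poly a (of_real t)" for t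
  proof (rule ccontr)
    assume neq: "complex_of_real (?f t) \<noteq> poly a (of_real t)"
    have "open {t. complex_of_real (?f t) \<noteq> poly a (of_real t)}"
      by (intro open_Collect_neq continuous_intros contf)
    then show False using finite_imp_not_open[OF poly] neq by blast
  qed
  have C0: "0 \<le> C" using growth[of "SOME b. b \<in> Basis"] by (simp add: SOME_Basis)
  have gr: "\<bar>?f t\<bar> \<le> (C * (norm x + norm y)\<^sup>2) * t\<^sup>2" if t: "1 \<le> t" for t
  proof -
    have "norm (x + t *\<^sub>R y) \<le> norm x + t * norm y"
      using t by (intro norm_triangle_le) simp
    also have "\<dots> \<le> t * (norm x + norm y)"
      using t mult_right_mono[of 1 t "norm x"] by (simp add: algebra_simps)
    finally have "(norm (x + t *\<^sub>R y))\<^sup>2 \<le> (t * (norm x + norm y))\<^sup>2"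
      by (intro power_mono) auto
    then have "C * (norm (x + t *\<^sub>R y))\<^sup>2 \<le> C * (t * (norm x + norm y))\<^sup>2"
      using C0 by (rule mult_left_mono)
    then show ?thesis
      using growth[of "x + t *\<^sub>R y"] by (simp add: power_mult_distrib mult_ac)
  qed
  obtain a0 a1 a2 where a: "\<And>t. complex_of_real (?f t) = a0 + a1 * of_real t + a2 * of_real t ^ 2"
    using polynomial_quadratic_growth[of ?f a, OF f gr] by blast
  have lim: "(\<lambda>n. complex_of_real (?f (real (Suc n)) / (real (Suc n))\<^sup>2)) \<longlonglongrightarrow> a2"
  proof -
    have "(\<lambda>n. a0 * of_real (1 / real (Suc n)) ^ 2 + a1 * of_real (1 / real (Suc n)) + a2)
        \<longlonglongrightarrow> a0 * of_real 0 ^ 2 + a1 * of_real 0 + a2"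
      by (intro tendsto_intros LIMSEQ_Suc[OF lim_1_over_n])
    moreover have "complex_of_real (?f (real (Suc n)) / (real (Suc n))\<^sup>2) =
        a0 * of_real (1 / real (Suc n)) ^ 2 + a1 * of_real (1 / real (Suc n)) + a2" for n
      unfolding of_real_divide a
      by (simp add: field_simps power2_eq_square del: of_nat_Suc)
    ultimately show ?thesis by simp
  qed
  have "(\<lambda>n. q (y + (1 / real (Suc n)) *\<^sub>R x)) \<longlonglongrightarrow> q (y + 0 *\<^sub>R x)"
    by (intro continuous_on_tendsto_compose[OF cont] tendsto_intros LIMSEQ_Suc[OF lim_1_over_n]) auto
  moreover have "q (y + (1 / real (Suc n)) *\<^sub>R x) = ?f (real (Suc n)) / (real (Suc n))\<^sup>2" for n
    using hom[of "1 / real (Suc n)" "x + real (Suc n) *\<^sub>R y"]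
    by (simp add: scaleR_add_right power_divide add.commute del: of_nat_Suc)
  ultimately have "(\<lambda>n. ?f (real (Suc n)) / (real (Suc n))\<^sup>2) \<longlonglongrightarrow> q y" by simp
  then have "(\<lambda>n. complex_of_real (?f (real (Suc n)) / (real (Suc n))\<^sup>2)) \<longlonglongrightarrow> of_real (q y)"
    by (intro tendsto_intros)
  then have a2: "a2 = of_real (q y)"
    using lim LIMSEQ_unique by blast
  have a0: "a0 = of_real (q x)" using a[of 0] by simp
  have a1: "a1 = of_real ((q (x + y) - q (x - y)) / 2)"
    using a[of 1] a[of "-1"] by (simp add: field_simps)
  have "complex_of_real (?f t) =
      of_real (q x + t * ((q (x + y) - q (x - y)) / 2) + t\<^sup>2 * q y)"
    unfolding a a0 a1 a2 by simp
  then show ?thesis by (simp only: of_real_eq_iff)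
qed

section \<open>Quadratic forms recognized by their restrictions to lines\<close>

context
  fixes q :: "'a::euclidean_space \<Rightarrow> real"
  assumes line: "\<And>x y t. q (x + t *\<^sub>R y) = q x + t * ((q (x + y) - q (x - y)) / 2) + t\<^sup>2 * q y"
    and pos: "\<And>x. x \<noteq> 0 \<Longrightarrow> 0 < q x"
begin

definition polar :: "'a \<Rightarrow> 'a \<Rightarrow> real" where
  "polar x y = (q (x + y) - q (x - y)) / 4"

lemma q_0: "q 0 = 0"
  using line[of 0 1 0] by simp

lemma q_minus: "q (- x) = q x"
  using line[of 0 1 x] q_0 by simp

lemma q_scaleR: "q (t *\<^sub>R x) = t\<^sup>2 * q x"
  using line[of 0 t x] by (simp add: q_0 q_minus)

lemma q_parallelogram: "q (x + y) + q (x - y) = 2 * q x + 2 * q y"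
  using line[of x 1 y] line[of x "-1" y] by (simp add: field_simps)

lemma polar_commute: "polar x y = polar y x"
  using q_minus[of "x - y"] by (simp add: polar_def add.commute)

lemma polar_self: "polar x x = q x"
  using q_scaleR[of 2 x] by (simp add: polar_def q_0 scaleR_2)

text \<open>Comparing the expansions at \<open>t\<close> and \<open>-t\<close> isolates the linear
  term, which gives homogeneity for all real \<open>t\<close> at once.\<close>

lemma polar_scaleR_right: "polar x (t *\<^sub>R y) = t * polar x y"
  using line[of x t y] line[of x "- t" y] by (simp add: polar_def field_simps)

lemma polar_scaleR_left: "polar (t *\<^sub>R x) y = t * polar x y"
  using polar_scaleR_right[of y t x] by (simp add: polar_commute)

text \<open>The difference of the parallelogram identities for the pairs \<open>x + z\<close>,
  \<open>y\<close> and \<open>x - z\<close>, \<open>y\<close>.\<close>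

lemma polar_midpoint: "polar (x + y) z + polar (x - y) z = 2 * polar x z"
proof -
  have "q (x + y + z) + q (x - y + z) = 2 * q (x + z) + 2 * q y"
    using q_parallelogram[of "x + z" y] by (simp add: algebra_simps)
  moreover have "q (x + y - z) + q (x - y - z) = 2 * q (x - z) + 2 * q y"
    using q_parallelogram[of "x - z" y] by (simp add: algebra_simps)
  ultimately show ?thesis unfolding polar_def by argo
qed

text \<open>As in the Jordan-von Neumann theorem: the midpoint identity is applied to the half sum
  and the half difference of \<open>x\<close> and \<open>y\<close>, and homogeneity removes the
  factor one half.\<close>

lemma polar_add_left: "polar (x + y) z = polar x z + polar y z"
proof -
  have "polar ((1/2) *\<^sub>R (x + y) + (1/2) *\<^sub>R (x - y)) z
      + polar ((1/2) *\<^sub>R (x + y) - (1/2) *\<^sub>R (x - y)) z = 2 * polar ((1/2) *\<^sub>R (x + y)) z"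
    by (rule polar_midpoint)
  moreover have "(1/2) *\<^sub>R (x + y) + (1/2) *\<^sub>R (x - y) = x"
    "(1/2) *\<^sub>R (x + y) - (1/2) *\<^sub>R (x - y) = y"
    by (simp_all add: algebra_simps flip: scaleR_add_left)
  ultimately show ?thesis by (simp only: polar_scaleR_left)
qed

lemma linear_polar_left: "linear (\<lambda>x. polar x z)"
  by (rule linearI) (simp_all add: polar_add_left polar_scaleR_left)

lemma linear_polar_right: "linear (polar z)"
  using linear_polar_left[of z] by (simp add: polar_commute[of _ z])

text \<open>Gram-Schmidt for \<open>polar\<close>: while \<open>E\<close> has fewer than
  \<open>DIM('a)\<close> elements, some vector lies outside its span, and subtracting its components
  along \<open>E\<close> leaves a nonzero vector, on which \<open>q\<close> is positive.\<close>

lemma exists_polar_orthonormal: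
  assumes "k \<le> DIM('a)"
  shows "\<exists>E::'a set. finite E \<and> card E = k \<and> (\<forall>e\<in>E. \<forall>e'\<in>E. polar e e' = (if e = e' then 1 else 0))"
  using assms
proof (induction k)
  case 0
  show ?case by (intro exI[of _ "{}"]) simp
next
  case (Suc k)
  then obtain E :: "'a set" where E: "finite E" "card E = k"
    "\<And>e e'. e \<in> E \<Longrightarrow> e' \<in> E \<Longrightarrow> polar e e' = (if e = e' then 1 else 0)"
    by auto
  have "dim (span E) < DIM('a)"
    using dim_le_card[OF _ E(1), of "span E"] Suc.prems E(2) by simp
  then obtain x where x: "x \<notin> span E"
    by (metis UNIV_I dim_UNIV less_irrefl subsetI subset_antisym)
  define y where "y = x - (\<Sum>e\<in>E. polar x e *\<^sub>R e)"
  have "(\<Sum>e\<in>E. polar x e *\<^sub>R e) \<in> span E"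
    by (intro span_sum span_scale span_base)
  then have ys: "y \<notin> span E"
    unfolding y_def using x span_add[of "x - (\<Sum>e\<in>E. polar x e *\<^sub>R e)" E] by fastforce
  then have "y \<noteq> 0" using span_zero by auto
  then have qy: "0 < q y" by (rule pos)
  have ye: "polar y e = 0" if "e \<in> E" for e
  proof -
    have "polar y e = polar x e - (\<Sum>e'\<in>E. polar x e' * polar e' e)"
      unfolding y_def
      by (simp add: linear_diff[OF linear_polar_left] linear_sum[OF linear_polar_left]
          polar_scaleR_left)
    also have "(\<Sum>e'\<in>E. polar x e' * polar e' e) = (\<Sum>e'\<in>E. if e' = e then polar x e' else 0)"
      using E(3) that by (intro sum.cong) auto
    finally show ?thesis using that E(1) by simp
  qed
  define w where "w = (1 / sqrt (q y)) *\<^sub>R y"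
  have wE: "w \<notin> E"
  proof
    assume "w \<in> E"
    then have "sqrt (q y) *\<^sub>R w \<in> span E" by (intro span_scale span_base)
    then show False using ys qy by (simp add: w_def)
  qed
  have ww: "polar w w = 1"
    using qy by (simp add: w_def polar_self q_scaleR power_divide)
  have we: "polar w e = 0" "polar e w = 0" if "e \<in> E" for e
    using ye[OF that] by (simp_all add: w_def polar_scaleR_left polar_scaleR_right polar_commute[of e])
  show ?case
    using E wE ww we by (intro exI[of _ "insert w E"]) auto
qed

text \<open>\<open>L\<close> sends the standard basis to a \<open>polar\<close>-orthonormal family.
  Its adjoint later straightens the convex body into a ball.\<close>

lemma exists_linear_isometry:
  obtains L :: "'a \<Rightarrow> 'a" where "linear L" "\<And>u. q (L u) = (norm u)\<^sup>2"
proof -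
  obtain E :: "'a set" where E: "finite E" "card E = DIM('a)"
    "\<And>e e'. e \<in> E \<Longrightarrow> e' \<in> E \<Longrightarrow> polar e e' = (if e = e' then 1 else 0)"
    using exists_polar_orthonormal[OF order_refl] by auto
  then obtain h where h: "bij_betw h (Basis :: 'a set) E"
    using finite_same_card_bij[OF finite_Basis E(1)] by auto
  define L where "L u = (\<Sum>b\<in>Basis. (u \<bullet> b) *\<^sub>R h b)" for u :: 'a
  have lin: "linear L"
    by (rule linearI)
      (simp_all add: L_def inner_add_left scaleR_add_left sum.distrib scaleR_sum_right)
  have "q (L u) = (norm u)\<^sup>2" for u
  proof -
    have orth: "polar (h b) (h b') = (if b = b' then 1 else 0)" if "b \<in> Basis" "b' \<in> Basis" for b b'
      using E(3)[of "h b" "h b'"] that h by (auto simp: bij_betw_def inj_on_eq_iff)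
    have "q (L u) = polar (L u) (L u)" by (simp add: polar_self)
    also have "\<dots> = (\<Sum>b\<in>Basis. (u \<bullet> b) * polar (h b) (L u))"
      unfolding L_def[of u]
      using linear_polar_left by (simp add: linear_sum[OF linear_polar_left] polar_scaleR_left)
    also have "\<dots> = (\<Sum>b\<in>Basis. (u \<bullet> b) * (u \<bullet> b))"
    proof (intro sum.cong refl arg_cong2[where f = "(*)"])
      fix b :: 'a assume b: "b \<in> Basis"
      have "polar (h b) (L u) = (\<Sum>b'\<in>Basis. (u \<bullet> b') * polar (h b) (h b'))"
        unfolding L_def by (simp add: linear_sum[OF linear_polar_right] polar_scaleR_right)
      also have "\<dots> = (\<Sum>b'\<in>Basis. if b' = b then u \<bullet> b' else 0)"
        using b by (intro sum.cong) (auto simp: orth)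
      finally show "polar (h b) (L u) = u \<bullet> b" using b by simp
    qed
    also have "\<dots> = u \<bullet> u" by (rule euclidean_inner[symmetric])
    finally show ?thesis by (simp add: power2_norm_eq_inner)
  qed
  with lin show ?thesis by (rule that)
qed

end

text \<open>In the coordinates given by \<open>L\<close> the support function is the Euclidean norm.
  A point lies in the closed body iff it satisfies the inequalities against all \<open>L u\<close>,
  that is, iff the adjoint \<open>A\<close> maps it into the unit ball; the inverse \<open>T\<close>
  of \<open>A\<close> carries the unit sphere onto the boundary.\<close>

theorem ellipsoid_frontier:
  fixes D :: "'a::euclidean_space set"
  assumes D: "open D" "convex D" "bounded D" "uminus ` D = D" "0 \<in> D"
    and line: "\<And>x y t. (support_function D (x + t *\<^sub>R y))\<^sup>2 = (support_function D x)\<^sup>2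
      + t * (((support_function D (x + y))\<^sup>2 - (support_function D (x - y))\<^sup>2) / 2)
      + t\<^sup>2 * (support_function D y)\<^sup>2"
  shows "ellipsoid (frontier D)"
proof -
  have ne: "D \<noteq> {}" using D(5) by auto
  let ?\<rho> = "support_function D"
  have pos: "0 < (?\<rho> x)\<^sup>2" if "x \<noteq> 0" for x
    using support_function_pos[OF ne D(3,1,5) that] by simp
  obtain L :: "'a \<Rightarrow> 'a" where L: "linear L" "\<And>u. (?\<rho> (L u))\<^sup>2 = (norm u)\<^sup>2"
    using exists_linear_isometry[of "\<lambda>x. (?\<rho> x)\<^sup>2", OF line pos] by blast
  have rho0: "0 \<le> ?\<rho> x" for x
    using support_function_pos[OF ne D(3,1,5)] support_function_0[OF ne D(3)] by (cases "x = 0") (auto intro: less_imp_le)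
  have L': "?\<rho> (L u) = norm u" for u
    using L(2)[of u] rho0[of "L u"] by simp
  have injL: "inj L"
    using L' support_function_0[OF ne D(3)] by (metis L(1) linear_injective_0 norm_eq_zero)
  have surjL: "surj L" using L(1) injL by (intro linear_injective_imp_surjective) auto
  define A where "A = adjoint L"
  have A: "linear A" "\<And>x u. A x \<bullet> u = x \<bullet> L u"
    unfolding A_def using adjoint_linear[OF L(1)] adjoint_works[OF L(1)] by (auto simp: inner_commute)
  have injA: "inj A"
  proof (subst linear_injective_0[OF A(1)], intro allI impI)
    fix x assume "A x = 0"
    then have "x \<bullet> L u = 0" for u using A(2)[of x u] by simp
    then have "x \<bullet> x = 0" using surjL by (metis surjD)
    then show "x = 0" by simp
  qed
  obtain T where T: "linear T" "\<And>x. T (A x) = x" "\<And>x. A (T x) = x"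
    using linear_injective_isomorphism[OF A(1) injA] by blast
  have injT: "inj T" by (metis T(3) injI)
  have "x \<in> closure D \<longleftrightarrow> norm (A x) \<le> 1" for x
  proof -
    have "x \<in> closure D \<longleftrightarrow> (\<forall>u. x \<bullet> L u \<le> ?\<rho> (L u))"
      unfolding in_closure_iff_support_function[OF ne D(3,2)] using surjL by (metis surjD)
    also have "\<dots> \<longleftrightarrow> (\<forall>u. A x \<bullet> u \<le> norm u)" by (simp add: L' A(2))
    also have "\<dots> \<longleftrightarrow> norm (A x) \<le> 1"
    proof
      assume "\<forall>u. A x \<bullet> u \<le> norm u"
      then have "norm (A x) * norm (A x) \<le> 1 * norm (A x)"
        by (metis dot_square_norm mult_1 power2_eq_square)
      then show "norm (A x) \<le> 1"
        by (cases "A x = 0") (auto simp: mult_le_cancel_right)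
    next
      assume "norm (A x) \<le> 1"
      then show "\<forall>u. A x \<bullet> u \<le> norm u"
        using norm_cauchy_schwarz mult_right_mono[of "norm (A x)" 1] by (metis mult_1 norm_ge_zero order_trans)
    qed
    finally show ?thesis .
  qed
  then have "closure D = {x. A x \<in> cball 0 1}" by auto
  also have "\<dots> = T ` cball 0 1"
  proof safe
    fix x assume "A x \<in> cball 0 1"
    then show "x \<in> T ` cball 0 1" by (metis T(2) imageI)
  qed (simp add: T(3))
  finally have cl: "closure D = T ` cball 0 1" .
  \<comment> \<open>An open convex set is the interior of its closure, so the boundary can be
    computed from the closed body alone.\<close>
  have "interior (closure D) = D"
    using D(1,2) by (simp add: convex_interior_closure interior_open)
  then have "frontier D = closure D - interior (closure D)"
    using D(1) by (simp add: frontier_def interior_open)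
  also have "\<dots> = T ` cball 0 1 - T ` ball 0 1"
    unfolding cl using interior_injective_linear_image[OF T(1) injT, of "cball 0 1"] by simp
  also have "\<dots> = T ` sphere 0 1"
    using injT by (auto simp: image_set_diff[symmetric] sphere_def cball_def ball_def)
  finally have "frontier D = (\<lambda>x. 0 + T x) ` sphere 0 1" by simp
  then show ?thesis unfolding ellipsoid_def using T(1) injT by blast
qed

section \<open>Smooth functions\<close>

abbreviation pd :: "'a::euclidean_space \<Rightarrow> ('a \<Rightarrow> 'b::real_normed_vector) \<Rightarrow> 'a \<Rightarrow> 'b" where
  "pd b f \<equiv> \<lambda>x. frechet_derivative f (at x) b"

abbreviation smooth :: "('a::euclidean_space \<Rightarrow> 'b::real_normed_vector) \<Rightarrow> bool" where
  "smooth \<equiv> smooth_on_open UNIV"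

text \<open>\<open>iter_pderiv\<close> adds each new derivative on the outside; \<open>kdiff\<close>
  peels off the innermost one instead, so that product and chain rules go by induction on
  \<open>n\<close> with the functions arbitrary.\<close>

primrec kdiff :: "nat \<Rightarrow> ('a::euclidean_space \<Rightarrow> 'b::real_normed_vector) \<Rightarrow> bool" where
  "kdiff 0 f = True"
| "kdiff (Suc n) f = ((\<forall>x. f differentiable (at x)) \<and> (\<forall>b\<in>Basis. kdiff n (pd b f)))"

lemma pd_eqI: "(\<And>x. (f has_derivative f' x) (at x)) \<Longrightarrow> pd b f = (\<lambda>x. f' x b)"
  using frechet_derivative_at by metis

lemma iter_pderiv_snoc: "iter_pderiv (bs @ [b]) f = iter_pderiv bs (pd b f)"
  by (induction bs) simp_all

lemma kdiff_iff:
  fixes f :: "'a::euclidean_space \<Rightarrow> 'b::real_normed_vector"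
  shows "kdiff n f \<longleftrightarrow> (\<forall>bs. set bs \<subseteq> Basis \<and> length bs < n \<longrightarrow> (\<forall>x. iter_pderiv bs f differentiable (at x)))"
proof (induction n arbitrary: f)
  case (Suc n)
  show ?case
  proof (intro iffI allI impI)
    fix bs :: "'a list" and x assume "kdiff (Suc n) f" "set bs \<subseteq> Basis \<and> length bs < Suc n"
    then show "iter_pderiv bs f differentiable (at x)"
      by (cases bs rule: rev_cases) (auto simp: iter_pderiv_snoc Suc.IH)
  next
    assume *: "\<forall>bs. set bs \<subseteq> Basis \<and> length bs < Suc n \<longrightarrow>
        (\<forall>x. iter_pderiv bs f differentiable (at x))"
    have "kdiff n (pd b f)" if b: "b \<in> Basis" for b
      unfolding Suc.IH
    proof (intro allI impI)
      fix bs :: "'a list" and x assume "set bs \<subseteq> Basis \<and> length bs < n"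
      then show "iter_pderiv bs (pd b f) differentiable (at x)"
        using *[rule_format, of "bs @ [b]" x] b by (simp add: iter_pderiv_snoc)
    qed
    moreover have "f differentiable (at x)" for x using *[rule_format, of "[]" x] by simp
    ultimately show "kdiff (Suc n) f" by simp
  qed
qed simp

lemma smooth_iff_kdiff: "smooth f \<longleftrightarrow> (\<forall>n. kdiff n f)"
  unfolding smooth_on_open_def kdiff_iff by auto

lemma smooth_iff:
  "smooth f \<longleftrightarrow> (\<forall>x. f differentiable (at x)) \<and> (\<forall>b\<in>Basis. smooth (pd b f))"
  unfolding smooth_iff_kdiff
proof safe
  fix n assume "\<forall>x. f differentiable (at x)" "\<forall>b\<in>Basis. \<forall>n. kdiff n (pd b f)"
  then show "kdiff n f" by (cases n) auto
next
  fix x assume "\<forall>n. kdiff n f"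
  then have "kdiff (Suc 0) f" by blast
  then show "f differentiable (at x)" by simp
next
  fix b :: 'a and n assume "\<forall>n. kdiff n f" "b \<in> Basis"
  then have "kdiff (Suc n) f" "b \<in> Basis" by blast+
  then show "kdiff n (pd b f)" by simp
qed

lemma smooth_differentiable: "smooth f \<Longrightarrow> f differentiable (at x)"
  and smooth_pd: "smooth f \<Longrightarrow> b \<in> Basis \<Longrightarrow> smooth (pd b f)"
  using smooth_iff by blast+

lemma smooth_has_derivative: "smooth f \<Longrightarrow> (f has_derivative frechet_derivative f (at x)) (at x)"
  using smooth_differentiable frechet_derivative_works by blast

lemma smooth_continuous_on: "smooth f \<Longrightarrow> continuous_on S f"
  by (meson continuous_at_imp_continuous_on differentiable_imp_continuous_within smooth_differentiable)

lemma smooth_iter_pderiv: "smooth f \<Longrightarrow> set bs \<subseteq> Basis \<Longrightarrow> smooth (iter_pderiv bs f)"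
  by (induction bs) (auto intro: smooth_pd)

lemma kdiff_mono: "kdiff (Suc n) f \<Longrightarrow> kdiff n f"
  by (auto simp: kdiff_iff)

lemma kdiff_has_derivative:
  "kdiff (Suc n) f \<Longrightarrow> (f has_derivative frechet_derivative f (at x)) (at x)"
  using frechet_derivative_works by auto

lemma kdiff_linear_comp:
  assumes L: "bounded_linear L"
  shows "kdiff n f \<Longrightarrow> kdiff n (\<lambda>x. L (f x))"
proof (induction n arbitrary: f)
  case (Suc n)
  have D: "((\<lambda>x. L (f x)) has_derivative (\<lambda>h. L (frechet_derivative f (at x) h))) (at x)" for x
    using bounded_linear.has_derivative[OF L kdiff_has_derivative[OF Suc.prems]] .
  have "kdiff n (pd b (\<lambda>x. L (f x)))" if "b \<in> Basis" for b
    unfolding pd_eqI[OF D] using Suc.prems that by (intro Suc.IH) simp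
  then show ?case using differentiableI[OF D] by simp
qed simp

lemma kdiff_const: "kdiff n (\<lambda>x. c)"
proof (induction n arbitrary: c)
  case (Suc n)
  have "pd b (\<lambda>x. c) = (\<lambda>x. 0)" for b :: 'a by (rule pd_eqI) (rule has_derivative_const)
  then show ?case using Suc by simp
qed simp

lemma kdiff_add: "kdiff n f \<Longrightarrow> kdiff n g \<Longrightarrow> kdiff n (\<lambda>x. f x + g x)"
proof (induction n arbitrary: f g)
  case (Suc n)
  have D: "((\<lambda>x. f x + g x) has_derivative
      (\<lambda>h. frechet_derivative f (at x) h + frechet_derivative g (at x) h)) (at x)" for x
    using Suc.prems[THEN kdiff_has_derivative] by (rule has_derivative_add)
  have "kdiff n (pd b (\<lambda>x. f x + g x))" if "b \<in> Basis" for b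
    unfolding pd_eqI[OF D] using Suc.prems that by (intro Suc.IH) simp_all
  then show ?case using differentiableI[OF D] by simp
qed simp

lemma kdiff_sum: "(\<And>i. i \<in> I \<Longrightarrow> kdiff n (f i)) \<Longrightarrow> kdiff n (\<lambda>x. \<Sum>i\<in>I. f i x)"
  by (induction I rule: infinite_finite_induct) (auto intro: kdiff_const kdiff_add)

lemma kdiff_bilinear:
  assumes bil: "bounded_bilinear B"
  shows "kdiff n f \<Longrightarrow> kdiff n g \<Longrightarrow> kdiff n (\<lambda>x. B (f x) (g x))"
proof (induction n arbitrary: f g)
  case (Suc n)
  have D: "((\<lambda>x. B (f x) (g x)) has_derivative
      (\<lambda>h. B (f x) (frechet_derivative g (at x) h) + B (frechet_derivative f (at x) h) (g x))) (at x)" for x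
    using bounded_bilinear.FDERIV[OF bil] Suc.prems[THEN kdiff_has_derivative] by blast
  have "kdiff n (pd b (\<lambda>x. B (f x) (g x)))" if "b \<in> Basis" for b
    unfolding pd_eqI[OF D]
  proof (intro kdiff_add Suc.IH)
    show "kdiff n f" "kdiff n g" using Suc.prems kdiff_mono by blast+
    show "kdiff n (pd b g)" "kdiff n (pd b f)" using Suc.prems that by simp_all
  qed
  then show ?case using differentiableI[OF D] by simp
qed simp

lemma pd_compose:
  assumes "\<And>x. g differentiable (at x)" "\<And>x. f differentiable (at x)"
  shows "pd b (\<lambda>x. g (f x)) = (\<lambda>x. \<Sum>c\<in>Basis. (pd b f x \<bullet> c) *\<^sub>R pd c g (f x))"
proof -
  have "((\<lambda>x. g (f x)) has_derivative
      (\<lambda>h. frechet_derivative g (at (f x)) (frechet_derivative f (at x) h))) (at x)" for x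
    by (rule has_derivative_compose) (use assms frechet_derivative_works in blast)+
  then have chain: "pd b (\<lambda>x. g (f x)) = (\<lambda>x. frechet_derivative g (at (f x)) (pd b f x))"
    by (rule pd_eqI)
  have repr: "frechet_derivative g (at y) v = (\<Sum>c\<in>Basis. (v \<bullet> c) *\<^sub>R pd c g y)" for y v
  proof -
    have lin: "linear (frechet_derivative g (at y))"
      using assms(1) linear_frechet_derivative by blast
    show ?thesis
      by (subst euclidean_representation[of v, symmetric])
        (simp only: linear_sum[OF lin] linear_scale[OF lin])
  qed
  show ?thesis unfolding chain by (rule ext) (rule repr)
qed

text \<open>In coordinates a partial derivative of \<open>g (f x)\<close> is a sum of products of a
  derivative of \<open>f\<close> with a derivative of \<open>g\<close> composed with
  \<open>f\<close>, so the induction hypothesis and \<open>kdiff_bilinear\<close> apply.\<close>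

lemma kdiff_compose: "kdiff n g \<Longrightarrow> kdiff n f \<Longrightarrow> kdiff n (\<lambda>x. g (f x))"
  for f :: "'a::euclidean_space \<Rightarrow> 'b::euclidean_space"
proof (induction n arbitrary: g)
  case (Suc n)
  have d: "g differentiable (at x)" "f differentiable (at y)" for x y using Suc.prems by auto
  have "kdiff n (pd b (\<lambda>x. g (f x)))" if "b \<in> Basis" for b
    unfolding pd_compose[OF d]
  proof (intro kdiff_sum kdiff_bilinear[OF bounded_bilinear_scaleR])
    fix c :: 'b assume "c \<in> Basis"
    show "kdiff n (\<lambda>x. pd b f x \<bullet> c)"
      using Suc.prems(2) that by (intro kdiff_linear_comp[OF bounded_linear_inner_left]) simp
    show "kdiff n (\<lambda>x. pd c g (f x))"
      using Suc.prems \<open>c \<in> Basis\<close> by (intro Suc.IH kdiff_mono[OF Suc.prems(2)]) simp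
  qed
  moreover have "(\<lambda>x. g (f x)) differentiable (at x)" for x
    using differentiable_chain_at[OF d(2) d(1), of x] by (simp add: o_def)
  ultimately show ?case by simp
qed simp

lemma kdiff_id: "kdiff n (\<lambda>x. x)"
proof (cases n)
  case (Suc m)
  have "pd b (\<lambda>x. x) = (\<lambda>x. b)" for b :: 'a
    by (rule pd_eqI) (rule has_derivative_ident)
  then show ?thesis using Suc by (simp add: kdiff_const)
qed simp

lemma smooth_const: "smooth (\<lambda>x. c)"
  by (simp add: smooth_iff_kdiff kdiff_const)

lemma smooth_id: "smooth (\<lambda>x. x)"
  by (simp add: smooth_iff_kdiff kdiff_id)

lemma smooth_linear_comp: "bounded_linear L \<Longrightarrow> smooth f \<Longrightarrow> smooth (\<lambda>x. L (f x))"
  by (simp add: smooth_iff_kdiff kdiff_linear_comp)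

lemma smooth_linear: "bounded_linear L \<Longrightarrow> smooth L"
  using smooth_linear_comp[OF _ smooth_id] .

lemma smooth_add: "smooth f \<Longrightarrow> smooth g \<Longrightarrow> smooth (\<lambda>x. f x + g x)"
  by (simp add: smooth_iff_kdiff kdiff_add)

lemma smooth_minus: "smooth f \<Longrightarrow> smooth (\<lambda>x. - f x)"
  by (rule smooth_linear_comp[OF bounded_linear_minus[OF bounded_linear_ident]])

lemma smooth_diff: "smooth f \<Longrightarrow> smooth g \<Longrightarrow> smooth (\<lambda>x. f x - g x)"
  using smooth_add[of f "\<lambda>x. - g x"] smooth_minus[of g] by simp

lemma smooth_mult: "smooth f \<Longrightarrow> smooth g \<Longrightarrow> smooth (\<lambda>x. f x * g x)"
  for f g :: "'a::euclidean_space \<Rightarrow> 'b::real_normed_algebra"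
  by (simp add: smooth_iff_kdiff kdiff_bilinear[OF bounded_bilinear_mult])

lemma smooth_power: "smooth f \<Longrightarrow> smooth (\<lambda>x. f x ^ n)"
  for f :: "'a::euclidean_space \<Rightarrow> 'b::real_normed_algebra_1"
  by (induction n) (auto intro: smooth_const smooth_mult)

lemma smooth_inner: "smooth f \<Longrightarrow> smooth g \<Longrightarrow> smooth (\<lambda>x. f x \<bullet> g x)"
  for f g :: "'a::euclidean_space \<Rightarrow> 'b::real_inner"
  by (simp add: smooth_iff_kdiff kdiff_bilinear[OF bounded_bilinear_inner])

lemma smooth_compose: "smooth g \<Longrightarrow> smooth f \<Longrightarrow> smooth (\<lambda>x. g (f x))"
  for f :: "'a::euclidean_space \<Rightarrow> 'b::euclidean_space"
  by (simp add: smooth_iff_kdiff kdiff_compose)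

lemma smooth_of_real: "smooth f \<Longrightarrow> smooth (\<lambda>x. complex_of_real (f x))"
  by (rule smooth_linear_comp[OF bounded_linear_of_real])

lemma smooth_tower:
  fixes G :: "nat \<Rightarrow> real \<Rightarrow> 'b::real_normed_vector"
  assumes G: "\<And>n x. (G n has_vector_derivative G (Suc n) x) (at x)"
  shows "smooth (G 0)"
proof -
  have "kdiff m (G n)" for m n
  proof (induction m arbitrary: n)
    case (Suc m)
    have D: "(G n has_derivative (\<lambda>h. h *\<^sub>R G (Suc n) x)) (at x)" for x
      using G by (simp add: has_vector_derivative_def)
    show ?case using Suc.IH differentiableI[OF D] by (simp add: pd_eqI[OF D])
  qed simp
  then show ?thesis by (simp add: smooth_iff_kdiff)
qed

lemma pd_add:
  "smooth f \<Longrightarrow> smooth g \<Longrightarrow> pd b (\<lambda>x. f x + g x) = (\<lambda>x. pd b f x + pd b g x)"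
  by (rule pd_eqI) (intro has_derivative_add smooth_has_derivative)

lemma pd_linear_comp:
  "bounded_linear L \<Longrightarrow> smooth f \<Longrightarrow> pd b (\<lambda>x. L (f x)) = (\<lambda>x. L (pd b f x))"
  by (rule pd_eqI) (intro bounded_linear.has_derivative[of L] smooth_has_derivative)

lemma pd_mult:
  fixes f g :: "'a::euclidean_space \<Rightarrow> complex"
  shows "smooth f \<Longrightarrow> smooth g \<Longrightarrow> pd b (\<lambda>x. f x * g x) = (\<lambda>x. f x * pd b g x + pd b f x * g x)"
  by (rule pd_eqI) (intro has_derivative_mult smooth_has_derivative)

lemma iter_pderiv_add:
  assumes "smooth f" "smooth g" "set bs \<subseteq> Basis"
  shows "iter_pderiv bs (\<lambda>x. f x + g x) = (\<lambda>x. iter_pderiv bs f x + iter_pderiv bs g x)"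
  using assms(3)
  by (induction bs) (simp_all add: pd_add smooth_iter_pderiv assms)

lemma iter_pderiv_linear_comp:
  assumes "bounded_linear L" "smooth f" "set bs \<subseteq> Basis"
  shows "iter_pderiv bs (\<lambda>x. L (f x)) = (\<lambda>x. L (iter_pderiv bs f x))"
  using assms(3)
  by (induction bs) (simp_all add: pd_linear_comp smooth_iter_pderiv assms)

lemma iter_pderiv_diff:
  assumes "smooth f" "smooth g" "set bs \<subseteq> Basis"
  shows "iter_pderiv bs (\<lambda>x. f x - g x) = (\<lambda>x. iter_pderiv bs f x - iter_pderiv bs g x)"
  using iter_pderiv_add[OF assms(1) smooth_minus[OF assms(2)] assms(3)]
    iter_pderiv_linear_comp[OF bounded_linear_minus[OF bounded_linear_ident] assms(2,3)]
  by simp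

lemma iter_pderiv_cong_open:
  assumes "open U" "\<And>x. x \<in> U \<Longrightarrow> f x = g x" "x \<in> U"
  shows "iter_pderiv bs f x = iter_pderiv bs g x"
  using assms(3)
proof (induction bs arbitrary: x)
  case (Cons b bs)
  \<comment> \<open>Differentiability is not at hand here. \<open>frechet_derivative\<close> is a
    choice among all derivatives, so it is enough that both functions have the same ones.\<close>
  have "(iter_pderiv bs f has_derivative f') (at x) \<longleftrightarrow> (iter_pderiv bs g has_derivative f') (at x)" for f'
  proof
    assume "(iter_pderiv bs f has_derivative f') (at x)"
    from this assms(1) Cons.prems Cons.IH show "(iter_pderiv bs g has_derivative f') (at x)"
      by (rule has_derivative_transform_within_open)
  next
    assume "(iter_pderiv bs g has_derivative f') (at x)"
    from this assms(1) Cons.prems Cons.IH[symmetric] show "(iter_pderiv bs f has_derivative f') (at x)"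
      by (rule has_derivative_transform_within_open)
  qed
  then show ?case by (simp add: frechet_derivative_def)
qed (use assms in simp)

lemma iter_pderiv_0: "iter_pderiv bs (\<lambda>x. 0) = (\<lambda>x. 0)"
proof (induction bs)
  case (Cons b bs)
  have "pd b (\<lambda>x. 0 :: 'b) = (\<lambda>x. 0)" by (rule pd_eqI) (rule has_derivative_const)
  then show ?case using Cons by simp
qed simp

lemma fun_support_subsetI:
  "closed K \<Longrightarrow> (\<And>x. x \<notin> K \<Longrightarrow> f x = 0) \<Longrightarrow> fun_support f \<subseteq> K"
  unfolding fun_support_def by (intro closure_minimal) auto

lemma not_in_fun_support: "x \<notin> fun_support f \<Longrightarrow> f x = 0"
  unfolding fun_support_def using closure_subset[of "{x. f x \<noteq> 0}"] by auto

lemma closed_fun_support: "closed (fun_support f)"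
  by (simp add: fun_support_def)

lemma iter_pderiv_outside_support:
  assumes "x \<notin> fun_support f"
  shows "iter_pderiv bs f x = 0"
proof -
  have "iter_pderiv bs f x = iter_pderiv bs (\<lambda>x. 0) x"
    using assms open_Compl[OF closed_fun_support[of f]]
    by (intro iter_pderiv_cong_open[of "- fun_support f"]) (auto simp: not_in_fun_support)
  then show ?thesis by (simp add: iter_pderiv_0)
qed

lemma test_functionI:
  assumes "smooth f" "compact K" "\<And>x. x \<notin> K \<Longrightarrow> f x = 0"
  shows "test_function f"
proof -
  have "fun_support f \<subseteq> K" using assms by (intro fun_support_subsetI compact_imp_closed)
  then have "compact (fun_support f)"
    using assms(2) closed_fun_support by (metis compact_Int_closed inf.absorb2)
  then show ?thesis using assms(1) by (simp add: test_function_def)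
qed

lemma test_function_mult:
  assumes "test_function f" "smooth g"
  shows "test_function (\<lambda>x. f x * g x)" and "test_function (\<lambda>x. g x * f x)"
proof -
  have f: "smooth f" "compact (fun_support f)" using assms(1) by (auto simp: test_function_def)
  show "test_function (\<lambda>x. f x * g x)"
    using smooth_mult[OF f(1) assms(2)] f(2) by (rule test_functionI) (simp add: not_in_fun_support)
  show "test_function (\<lambda>x. g x * f x)"
    using smooth_mult[OF assms(2) f(1)] f(2) by (rule test_functionI) (simp add: not_in_fun_support)
qed

lemma test_function_add:
  assumes "test_function f" "test_function g"
  shows "test_function (\<lambda>x. f x + g x)"
proof (rule test_functionI[of _ "fun_support f \<union> fun_support g"])
  show "smooth (\<lambda>x. f x + g x)" "compact (fun_support f \<union> fun_support g)"
    using assms by (auto simp: test_function_def intro: smooth_add)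
qed (simp add: not_in_fun_support)

section \<open>Convergence to zero together with derivatives up to a given order\<close>

primrec cnull :: "nat \<Rightarrow> 'a::euclidean_space set \<Rightarrow> (nat \<Rightarrow> 'a \<Rightarrow> complex) \<Rightarrow> bool" where
  "cnull 0 K F = uniform_limit K F (\<lambda>x. 0) sequentially"
| "cnull (Suc n) K F = (uniform_limit K F (\<lambda>x. 0) sequentially \<and>
     (\<forall>b\<in>Basis. cnull n K (\<lambda>i. pd b (F i))))"

lemma cnull_uniform_limit: "cnull n K F \<Longrightarrow> uniform_limit K F (\<lambda>x. 0) sequentially"
  by (cases n) auto

lemma cnull_iff:
  fixes F :: "nat \<Rightarrow> 'a::euclidean_space \<Rightarrow> complex"
  shows "cnull n K F \<longleftrightarrow> (\<forall>bs. set bs \<subseteq> Basis \<and> length bs \<le> n \<longrightarrow>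
     uniform_limit K (\<lambda>i. iter_pderiv bs (F i)) (\<lambda>x. 0) sequentially)"
proof (induction n arbitrary: F)
  case (Suc n)
  show ?case
  proof (intro iffI allI impI)
    fix bs :: "'a list" assume "cnull (Suc n) K F" "set bs \<subseteq> Basis \<and> length bs \<le> Suc n"
    then show "uniform_limit K (\<lambda>i. iter_pderiv bs (F i)) (\<lambda>x. 0) sequentially"
      by (cases bs rule: rev_cases) (auto simp: iter_pderiv_snoc Suc.IH)
  next
    assume *: "\<forall>bs. set bs \<subseteq> Basis \<and> length bs \<le> Suc n \<longrightarrow>
        uniform_limit K (\<lambda>i. iter_pderiv bs (F i)) (\<lambda>x. 0) sequentially"
    have "cnull n K (\<lambda>i. pd b (F i))" if b: "b \<in> Basis" for b
      unfolding Suc.IH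
    proof (intro allI impI)
      fix bs :: "'a list" assume "set bs \<subseteq> Basis \<and> length bs \<le> n"
      then show "uniform_limit K (\<lambda>i. iter_pderiv bs (pd b (F i))) (\<lambda>x. 0) sequentially"
        using *[rule_format, of "bs @ [b]"] b by (simp add: iter_pderiv_snoc)
    qed
    then show "cnull (Suc n) K F" using *[rule_format, of "[]"] by simp
  qed
qed simp

lemma cnull_Suc_imp: "cnull (Suc n) K F \<Longrightarrow> cnull n K F"
  by (auto simp: cnull_iff)

lemma uniform_limit_bounded_mult:
  fixes g :: "'a::euclidean_space \<Rightarrow> complex"
  assumes "uniform_limit K F (\<lambda>x. 0) sequentially" "continuous_on K g" "compact K"
  shows "uniform_limit K (\<lambda>i x. g x * F i x) (\<lambda>x. 0) sequentially"
proof -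
  have "uniform_limit K (\<lambda>i x. g x * F i x) (\<lambda>x. g x * 0) sequentially"
    using assms
    by (intro bounded_bilinear.bounded_uniform_limit[OF bounded_bilinear_mult] uniform_limit_const)
      (auto intro: compact_imp_bounded compact_continuous_image simp: image_constant_conv)
  then show ?thesis by simp
qed

lemma cnull_add:
  fixes F G :: "nat \<Rightarrow> 'a::euclidean_space \<Rightarrow> complex"
  assumes "\<And>i. smooth (F i)" "\<And>i. smooth (G i)" "cnull n K F" "cnull n K G"
  shows "cnull n K (\<lambda>i x. F i x + G i x)"
  unfolding cnull_iff
proof (intro allI impI)
  fix bs :: "'a list" assume bs: "set bs \<subseteq> Basis \<and> length bs \<le> n"
  have "uniform_limit K (\<lambda>i x. iter_pderiv bs (F i) x + iter_pderiv bs (G i) x) (\<lambda>x. 0 + 0) sequentially"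
    using assms(3,4) bs unfolding cnull_iff by (intro uniform_limit_add) blast+
  then show "uniform_limit K (\<lambda>i. iter_pderiv bs (\<lambda>x. F i x + G i x)) (\<lambda>x. 0) sequentially"
    using bs by (simp add: iter_pderiv_add assms(1,2))
qed

lemma cnull_mult:
  assumes "compact K"
  shows "smooth g \<Longrightarrow> (\<And>i. smooth (F i)) \<Longrightarrow> cnull n K F \<Longrightarrow> cnull n K (\<lambda>i x. g x * F i x)"
proof (induction n arbitrary: g F)
  case 0
  then show ?case
    by (simp add: uniform_limit_bounded_mult smooth_continuous_on assms)
next
  case (Suc n)
  have "cnull n K (\<lambda>i. pd b (\<lambda>x. g x * F i x))" if b: "b \<in> Basis" for b
    unfolding pd_mult[OF Suc.prems(1,2)]
  proof (intro cnull_add)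
    show "cnull n K (\<lambda>i x. g x * pd b (F i) x)"
      using Suc.prems b by (intro Suc.IH) (simp_all add: smooth_pd)
    show "cnull n K (\<lambda>i x. pd b g x * F i x)"
      using Suc.prems(1,2) cnull_Suc_imp[OF Suc.prems(3)] b
      by (intro Suc.IH) (simp_all add: smooth_pd)
  qed (use Suc.prems(1,2) b in \<open>simp_all add: smooth_mult smooth_pd\<close>)
  moreover have "uniform_limit K (\<lambda>i x. g x * F i x) (\<lambda>x. 0) sequentially"
    using uniform_limit_bounded_mult[OF cnull_uniform_limit[OF Suc.prems(3)]
        smooth_continuous_on[OF Suc.prems(1)] assms] .
  ultimately show ?case by simp
qed

lemma uniform_limit_reindex:
  assumes "uniform_limit S A l F" "\<And>x. x \<in> K \<Longrightarrow> h x \<in> S"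
  shows "uniform_limit K (\<lambda>i x. A i (h x)) (\<lambda>x. l (h x)) F"
proof (rule uniform_limitI)
  fix e :: real assume "0 < e"
  with assms(1) have "\<forall>\<^sub>F i in F. \<forall>x\<in>S. dist (A i x) (l x) < e" by (rule uniform_limitD)
  then show "\<forall>\<^sub>F i in F. \<forall>x\<in>K. dist (A i (h x)) (l (h x)) < e"
    by (rule eventually_mono) (simp add: assms(2))
qed

text \<open>The outer functions tend to zero on the whole line, whatever the range of
  \<open>h\<close>. Each differentiation yields the fixed smooth factor \<open>pd b h\<close>, which
  \<open>cnull_mult\<close> absorbs.\<close>

lemma cnull_compose:
  fixes h :: "'a::euclidean_space \<Rightarrow> real"
  assumes "compact K" "smooth h"
  shows "(\<And>i. smooth (A i)) \<Longrightarrow> cnull n UNIV A \<Longrightarrow> cnull n K (\<lambda>i x. A i (h x))"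
proof (induction n arbitrary: A)
  case 0
  then show ?case using uniform_limit_reindex[where S = UNIV and A = A and l = "\<lambda>x. 0"
        and K = K and h = h] by simp
next
  case (Suc n)
  have d: "A i differentiable (at x)" "h differentiable (at y)" for i x y
    using Suc.prems assms smooth_differentiable by auto
  have "cnull n K (\<lambda>i. pd b (\<lambda>x. A i (h x)))" if b: "b \<in> Basis" for b
  proof -
    have eq: "pd b (\<lambda>x. A i (h x)) = (\<lambda>x. of_real (pd b h x) * pd 1 (A i) (h x))" for i
      by (rule trans[OF pd_compose[OF d]])
        (simp only: scaleR_conv_of_real real_inner_1_right sum.insert sum.empty Basis_real_def
          finite.intros add_0_right empty_iff not_False_eq_True)
    show ?thesis
      unfolding eq
    proof (rule cnull_mult[OF assms(1)])
      show "smooth (\<lambda>x. complex_of_real (pd b h x))"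
        using assms(2) b by (intro smooth_of_real smooth_pd)
      show "smooth (\<lambda>x. pd 1 (A i) (h x))" for i
        by (rule smooth_compose[OF smooth_pd[OF Suc.prems(1)] assms(2)]) simp
      show "cnull n K (\<lambda>i x. pd 1 (A i) (h x))"
        using Suc.prems(2) smooth_pd[OF Suc.prems(1)] by (intro Suc.IH) auto
    qed
  qed
  moreover have "uniform_limit K (\<lambda>i x. A i (h x)) (\<lambda>x. 0) sequentially"
    using uniform_limit_reindex[OF cnull_uniform_limit[OF Suc.prems(2)],
        where K = K and h = h] by simp
  ultimately show ?case by simp
qed

text \<open>All derivatives of \<open>F i\<close> vanish off \<open>K\<close>, so uniform
  convergence on \<open>K\<close> controls the suprema over the whole space in the continuity
  estimate.\<close>

lemma distribution_tendsto_0: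
  fixes F :: "nat \<Rightarrow> 'a::euclidean_space \<Rightarrow> complex"
  assumes bound: "\<And>\<phi>. test_function \<phi> \<Longrightarrow> fun_support \<phi> \<subseteq> K \<Longrightarrow> norm (f \<phi>) \<le>
      C * (\<Sum>bs | set bs \<subseteq> Basis \<and> length bs \<le> N. SUP x. norm (iter_pderiv bs \<phi> x))"
    and F: "\<And>i. test_function (F i)" "\<And>i. fun_support (F i) \<subseteq> K" "cnull N K F"
  shows "(\<lambda>i. f (F i)) \<longlonglongrightarrow> 0"
proof -
  let ?I = "{bs::'a list. set bs \<subseteq> Basis \<and> length bs \<le> N}"
  have "(\<lambda>i. SUP x. norm (iter_pderiv bs (F i) x)) \<longlonglongrightarrow> 0" if bs: "bs \<in> ?I" for bs
  proof (rule LIMSEQ_I)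
    fix e :: real assume e: "0 < e"
    have "uniform_limit K (\<lambda>i. iter_pderiv bs (F i)) (\<lambda>x. 0) sequentially"
      using F(3) bs unfolding cnull_iff by blast
    then have "\<forall>\<^sub>F i in sequentially. \<forall>x\<in>K. dist (iter_pderiv bs (F i) x) 0 < e / 2"
      using e by (intro uniform_limitD) auto
    then obtain i0 where i0: "\<And>i x. i0 \<le> i \<Longrightarrow> x \<in> K \<Longrightarrow> norm (iter_pderiv bs (F i) x) < e / 2"
      by (auto simp: eventually_sequentially)
    have "norm ((SUP x. norm (iter_pderiv bs (F i) x)) - 0) < e" if i: "i0 \<le> i" for i
    proof -
      have le: "norm (iter_pderiv bs (F i) x) \<le> e / 2" for x
      proof (cases "x \<in> K")
        case False
        then have "x \<notin> fun_support (F i)" using F(2) by blast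
        then show ?thesis using e by (simp add: iter_pderiv_outside_support)
      qed (use i0[OF i, of x] in simp)
      then have "(SUP x. norm (iter_pderiv bs (F i) x)) \<le> e / 2"
        by (intro cSUP_least) auto
      \<comment> \<open>A real \<open>SUP\<close> is informative only for a bounded set. The bound
        \<open>e / 2\<close> supplies this, and the value at \<open>0\<close> then shows that the
        supremum is not negative.\<close>
      moreover have "norm (iter_pderiv bs (F i) 0) \<le> (SUP x. norm (iter_pderiv bs (F i) x))"
        using le by (intro cSUP_upper bdd_aboveI2[where M = "e / 2"]) auto
      then have "0 \<le> (SUP x. norm (iter_pderiv bs (F i) x))"
        using norm_ge_zero order_trans by blast
      ultimately show ?thesis using e by simp
    qed
    then show "\<exists>i0. \<forall>i\<ge>i0. norm ((SUP x. norm (iter_pderiv bs (F i) x)) - 0) < e" by blast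
  qed
  then have "(\<lambda>i. C * (\<Sum>bs\<in>?I. SUP x. norm (iter_pderiv bs (F i) x))) \<longlonglongrightarrow> C * (\<Sum>bs\<in>?I. 0)"
    by (intro tendsto_intros)
  then have "(\<lambda>i. C * (\<Sum>bs\<in>?I. SUP x. norm (iter_pderiv bs (F i) x))) \<longlonglongrightarrow> 0"
    by simp
  moreover have "\<forall>\<^sub>F i in sequentially. norm (f (F i)) \<le>
      C * (\<Sum>bs\<in>?I. SUP x. norm (iter_pderiv bs (F i) x))"
    using bound F by simp
  ultimately show ?thesis by (rule Lim_null_comparison[rotated])
qed

section \<open>Cutoff functions and localization\<close>

text \<open>The classical \<open>exp (-1/x)\<close>, extended by zero, with a polynomial in
  \<open>1/x\<close> as a factor: this makes the family closed under differentiation, from which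
  smoothness at \<open>0\<close> follows.\<close>

definition flat :: "real poly \<Rightarrow> real \<Rightarrow> real" where
  "flat p x = (if 0 < x then poly p (1 / x) * exp (- (1 / x)) else 0)"

lemma poly_times_exp_minus_tendsto_0: "((\<lambda>y. poly p y * exp (- y)) \<longlongrightarrow> 0) at_top" for p :: "real poly"
proof -
  have "((\<lambda>y. \<Sum>i\<le>degree p. coeff p i * (y ^ i / exp y)) \<longlongrightarrow> (\<Sum>i\<le>degree p. coeff p i * 0)) at_top"
    by (intro tendsto_sum tendsto_mult tendsto_const tendsto_power_div_exp_0)
  moreover have "(\<Sum>i\<le>degree p. coeff p i * (y ^ i / exp y)) = poly p y * exp (- y)" for y
    by (simp add: poly_altdef exp_minus field_simps sum_divide_distrib sum_distrib_left)
  ultimately show ?thesis by simp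
qed

lemma has_real_derivative_flat:
  "(flat p has_real_derivative flat ([:0, 0, 1:] * (p - pderiv p)) x) (at x)"
proof -
  consider "0 < x" | "x < 0" | "x = 0" by linarith
  then show ?thesis
  proof cases
    case 1
    have "((\<lambda>x. poly p (1 / x) * exp (- (1 / x))) has_real_derivative
        flat ([:0, 0, 1:] * (p - pderiv p)) x) (at x)"
      using 1 by (auto simp: flat_def field_simps power2_eq_square
          intro!: derivative_eq_intros DERIV_chain2[OF poly_DERIV])
    then show ?thesis
      by (rule has_field_derivative_transform_within_open[where S = "{0<..}"])
        (use 1 in \<open>auto simp: flat_def\<close>)
  next
    case 2
    have "((\<lambda>x. 0) has_real_derivative flat ([:0, 0, 1:] * (p - pderiv p)) x) (at x)"
      using 2 by (simp add: flat_def)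
    then show ?thesis
      by (rule has_field_derivative_transform_within_open[where S = "{..<0}"])
        (use 2 in \<open>auto simp: flat_def\<close>)
  next
    case 3
    \<comment> \<open>At \<open>0\<close> the difference quotient is again a function of this
      family: division by \<open>h\<close> turns \<open>p\<close> into
      \<open>pCons 0 p\<close>.\<close>
    have "((\<lambda>h. flat p h / h) \<longlongrightarrow> 0) (at_right 0)"
    proof -
      have "((\<lambda>h. poly (pCons 0 p) (inverse h) * exp (- inverse h)) \<longlongrightarrow> 0) (at_right 0)"
        by (rule filterlim_compose[OF poly_times_exp_minus_tendsto_0 filterlim_inverse_at_top_right])
      then show ?thesis
        by (rule Lim_transform_eventually)
          (auto simp: eventually_at_filter flat_def field_simps)
    qed
    moreover have "((\<lambda>h. flat p h / h) \<longlongrightarrow> 0) (at_left 0)"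
      by (rule Lim_transform_eventually[OF tendsto_const])
        (auto simp: eventually_at_filter flat_def)
    ultimately have "((\<lambda>h. flat p h / h) \<longlongrightarrow> 0) (at 0)"
      by (simp add: filterlim_at_split)
    moreover have "flat r 0 = 0" for r by (simp add: flat_def)
    ultimately show ?thesis
      using 3 by (simp add: DERIV_def)
  qed
qed

primrec flat_poly :: "nat \<Rightarrow> real poly" where
  "flat_poly 0 = 1"
| "flat_poly (Suc n) = [:0, 0, 1:] * (flat_poly n - pderiv (flat_poly n))"

lemma smooth_flat: "smooth (flat 1)"
proof -
  have "smooth (flat (flat_poly 0))"
    using has_real_derivative_flat
    by (intro smooth_tower) (simp add: has_real_derivative_iff_has_vector_derivative[symmetric])
  then show ?thesis by simp
qed

lemma flat_nonneg: "0 \<le> flat 1 x"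
  and flat_pos: "0 < x \<Longrightarrow> 0 < flat 1 x"
  and flat_zero: "x \<le> 0 \<Longrightarrow> flat 1 x = 0"
  by (simp_all add: flat_def)

lemma smooth_realI:
  fixes f :: "real \<Rightarrow> real"
  assumes "\<And>x. (f has_real_derivative g x) (at x)" "smooth g"
  shows "smooth f"
proof -
  have D: "(f has_derivative (\<lambda>h. g x * h)) (at x)" for x
    using assms(1) by (simp add: has_field_derivative_def)
  then have "\<forall>x. f differentiable (at x)" using differentiableI by blast
  moreover have "pd 1 f = g" using pd_eqI[OF D, of 1] by simp
  ultimately show ?thesis using assms(2) by (subst smooth_iff) simp
qed

text \<open>The step is the normalized primitive of a bump \<open>\<beta>\<close> that lives on the
  unit interval.\<close>

lemma smooth_step_exists:
  obtains s :: "real \<Rightarrow> real" where "smooth s" "\<And>x. 0 \<le> s x" "\<And>x. s x \<le> 1"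
    "\<And>x. x \<le> 0 \<Longrightarrow> s x = 0" "\<And>x. 1 \<le> x \<Longrightarrow> s x = 1"
proof -
  define \<beta> where "\<beta> x = flat 1 x * flat 1 (1 - x)" for x
  have sm: "smooth \<beta>"
    unfolding \<beta>_def
    by (intro smooth_mult smooth_flat smooth_compose[OF smooth_flat smooth_diff[OF smooth_const smooth_id]])
  have nonneg: "0 \<le> \<beta> x" for x by (simp add: \<beta>_def flat_nonneg)
  \<comment> \<open>Starting at \<open>-1\<close> puts every \<open>x \<ge> 0\<close> in the
    interior of an interval of integration, so the derivative is two-sided at \<open>0\<close> as
    well.\<close>
  define B where "B x = integral {-1..x} \<beta>" for x
  have B0: "B x = 0" if "x \<le> 0" for x
  proof -
    have "integral {-1..x} \<beta> = integral {-1..x} (\<lambda>x. 0)"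
      using that by (intro integral_cong) (simp add: \<beta>_def flat_zero)
    then show ?thesis by (simp add: B_def)
  qed
  have D: "(B has_real_derivative \<beta> x) (at x)" for x
  proof (cases "x < 0")
    case True
    have "((\<lambda>x. 0) has_real_derivative \<beta> x) (at x)" using True by (simp add: \<beta>_def flat_zero)
    then show ?thesis
      by (rule has_field_derivative_transform_within_open[where S = "{..<0}"])
        (use True in \<open>auto simp: B0\<close>)
  next
    case False
    have "(B has_real_derivative \<beta> x) (at x within {-1..x + 1})"
      unfolding B_def using False
      by (intro integral_has_real_derivative smooth_continuous_on sm) auto
    moreover have "at x within {-1..x + 1} = at x"
      using False by (intro at_within_interior) auto
    ultimately show ?thesis by simp
  qed
  have mono: "B x \<le> B y" if "x \<le> y" for x y
    using that D nonneg by (intro DERIV_nonneg_imp_nondecreasing[of x y B]) blast+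
  \<comment> \<open>\<open>\<beta>\<close> is strictly positive on the middle half of the interval;
    this makes the normalizing constant \<open>B 1\<close> positive.\<close>
  have lt: "B (1/4) < B (3/4)"
  proof (rule DERIV_pos_imp_increasing[of "1/4" "3/4" B])
    fix x :: real assume "1/4 \<le> x" "x \<le> 3/4"
    then have "0 < \<beta> x" unfolding \<beta>_def by (intro mult_pos_pos flat_pos) auto
    then show "\<exists>y. DERIV B x :> y \<and> 0 < y" using D by blast
  qed simp
  have pos: "0 < B 1" using lt mono[of "3/4" 1] mono[of 0 "1/4"] B0[of 0] by simp
  have B1: "B x = B 1" if "1 \<le> x" for x
  proof (rule antisym)
    have "\<beta> y = 0" if "1 \<le> y" for y using that by (simp add: \<beta>_def flat_zero)
    then show "B x \<le> B 1"
      using that D by (intro DERIV_nonpos_imp_nonincreasing[of 1 x B]) (auto intro!: exI)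
  qed (use that mono in simp)
  show ?thesis
  proof (rule that)
    have "((\<lambda>x. B x / B 1) has_real_derivative \<beta> x / B 1) (at x)" for x
      using D by (rule DERIV_cdivide)
    moreover have "smooth (\<lambda>x. \<beta> x / B 1)"
      using smooth_mult[OF sm smooth_const[of "inverse (B 1)"]] by (simp add: divide_inverse)
    ultimately show "smooth (\<lambda>x. B x / B 1)" by (rule smooth_realI)
    show "0 \<le> B x / B 1" for x
      using pos mono[of 0 x] mono[of x 0] B0[of 0] B0[of x] by (cases "x \<le> 0") simp_all
    show "B x / B 1 \<le> 1" for x
      using pos mono[of x 1] B1[of x] by (cases "x \<le> 1") simp_all
    show "B x / B 1 = 1" if "1 \<le> x" for x
      using B1[OF that] pos by simp
  qed (simp add: B0)
qed

text \<open>The squared distance is smooth everywhere, unlike the distance. \<open>k\<close>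
  rescales it to run from \<open>0\<close> at radius \<open>r\<close> to \<open>1\<close> at radius
  \<open>R\<close>, and the smooth step does the rest.\<close>

lemma bump_exists:
  fixes c :: "'a::euclidean_space"
  assumes "0 \<le> r" "r < R"
  obtains \<kappa> :: "'a \<Rightarrow> real" where "smooth \<kappa>" "\<And>x. 0 \<le> \<kappa> x" "\<And>x. \<kappa> x \<le> 1"
    "\<And>x. dist c x \<le> r \<Longrightarrow> \<kappa> x = 1" "\<And>x. R \<le> dist c x \<Longrightarrow> \<kappa> x = 0"
proof -
  obtain s :: "real \<Rightarrow> real" where s: "smooth s" "\<And>x. 0 \<le> s x" "\<And>x. s x \<le> 1"
    "\<And>x. x \<le> 0 \<Longrightarrow> s x = 0" "\<And>x. 1 \<le> x \<Longrightarrow> s x = 1"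
    by (rule smooth_step_exists) (rule that)
  have gap: "0 < R\<^sup>2 - r\<^sup>2" using assms by (simp add: power_strict_mono)
  define k where "k x = ((x - c) \<bullet> (x - c) - r\<^sup>2) * (1 / (R\<^sup>2 - r\<^sup>2))" for x
  have k: "k x = ((dist c x)\<^sup>2 - r\<^sup>2) / (R\<^sup>2 - r\<^sup>2)" for x
    by (simp add: k_def dist_norm norm_minus_commute[of c x] power2_norm_eq_inner)
  have smk: "smooth k"
    unfolding k_def by (intro smooth_mult smooth_diff smooth_inner smooth_id smooth_const)
  show ?thesis
  proof (rule that)
    show "smooth (\<lambda>x. 1 - s (k x))"
      by (intro smooth_diff[OF smooth_const] smooth_compose[OF s(1) smk])
    show "1 - s (k x) = 1" if "dist c x \<le> r" for x
      using that gap assms by (simp add: k s(4) divide_nonpos_pos power_mono)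
    show "1 - s (k x) = 0" if "R \<le> dist c x" for x
      using that gap assms by (simp add: k s(5) power_mono)
  qed (use s in simp_all)
qed

lemma cutoff_exists:
  fixes K :: "'a::euclidean_space set"
  assumes "bounded K"
  shows "\<exists>\<eta>. cutoff K \<eta>"
proof -
  obtain r where r: "0 < r" "K \<subseteq> ball 0 r" using bounded_subset_ballD[OF assms] by blast
  obtain \<kappa> :: "'a \<Rightarrow> real" where \<kappa>: "smooth \<kappa>" "\<And>x. 0 \<le> \<kappa> x" "\<And>x. \<kappa> x \<le> 1"
    "\<And>x. dist 0 x \<le> r \<Longrightarrow> \<kappa> x = 1" "\<And>x. r + 1 \<le> dist 0 x \<Longrightarrow> \<kappa> x = 0"
    by (rule bump_exists[of r "r + 1" 0]) (use r in auto)
  have "test_function (\<lambda>x. complex_of_real (\<kappa> x))"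
    using smooth_of_real[OF \<kappa>(1)] by (rule test_functionI[of _ "cball 0 (r + 1)"]) (auto simp: \<kappa>(5))
  moreover have "\<forall>x\<in>ball 0 r. complex_of_real (\<kappa> x) = 1" using \<kappa>(4) by simp
  ultimately show ?thesis unfolding cutoff_def using r(2) by blast
qed

text \<open>In place of a partition of unity, one ball of a finite cover is peeled off at a time: a
  bump splits \<open>\<psi>\<close> into a part near that ball, killed by \<open>f\<close>, and a
  part that is nonzero only in the remaining balls. Additivity is all that is asked of
  \<open>f\<close>, because the lemma also serves the slice functional in
  \<open>slice_vanish\<close>, which is not set up as a distribution.\<close>

lemma additive_vanish_of_local:
  fixes f :: "('a::euclidean_space \<Rightarrow> complex) \<Rightarrow> complex"
  assumes add: "\<And>\<phi> \<psi>. test_function \<phi> \<Longrightarrow> test_function \<psi> \<Longrightarrow> f (\<lambda>x. \<phi> x + \<psi> x) = f \<phi> + f \<psi>"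
    and \<phi>: "test_function \<phi>"
    and loc: "\<And>x. x \<in> fun_support \<phi> \<Longrightarrow>
      \<exists>U. open U \<and> x \<in> U \<and> (\<forall>\<psi>. test_function \<psi> \<longrightarrow> fun_support \<psi> \<subseteq> U \<longrightarrow> f \<psi> = 0)"
  shows "f \<phi> = 0"
proof -
  \<comment> \<open>The doubled radius leaves room for a bump that equals \<open>1\<close> on the
    ball of radius \<open>e\<close>.\<close>
  have "\<exists>e>0. \<forall>\<psi>. test_function \<psi> \<longrightarrow> fun_support \<psi> \<subseteq> cball x (2 * e) \<longrightarrow> f \<psi> = 0"
    if x: "x \<in> fun_support \<phi>" for x
  proof -
    obtain U where U: "open U" "x \<in> U" "\<And>\<psi>. test_function \<psi> \<Longrightarrow> fun_support \<psi> \<subseteq> U \<Longrightarrow> f \<psi> = 0"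
      using loc[OF x] by blast
    obtain e where e: "0 < e" "cball x e \<subseteq> U" using U(1,2) open_contains_cball by blast
    then have "\<forall>\<psi>. test_function \<psi> \<longrightarrow> fun_support \<psi> \<subseteq> cball x (2 * (e / 2)) \<longrightarrow> f \<psi> = 0"
      using U(3) by auto
    then show ?thesis using e(1) by (intro exI[of _ "e / 2"]) simp
  qed
  then obtain e where e: "\<And>x. x \<in> fun_support \<phi> \<Longrightarrow> 0 < e x"
    "\<And>x \<psi>. x \<in> fun_support \<phi> \<Longrightarrow> test_function \<psi> \<Longrightarrow> fun_support \<psi> \<subseteq> cball x (2 * e x) \<Longrightarrow> f \<psi> = 0"
    by metis
  have "compact (fun_support \<phi>)" using \<phi> by (simp add: test_function_def)
  then obtain F where F: "F \<subseteq> fun_support \<phi>" "finite F" "fun_support \<phi> \<subseteq> (\<Union>x\<in>F. ball x (e x))"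
    by (rule compactE_image[where C = "fun_support \<phi>" and f = "\<lambda>x. ball x (e x)"])
      (use e(1) in auto)
  have zero: "f (\<lambda>x. 0) = 0"
    using add[of "\<lambda>x. 0" "\<lambda>x. 0"] test_functionI[of "\<lambda>x. 0" "{}"] by (simp add: smooth_const)
  \<comment> \<open>The cover is required only for points where \<open>\<psi>\<close> is nonzero.
    After a ball has been peeled off, these lie in the remaining open balls, while the support may
    touch their boundaries.\<close>
  have "f \<psi> = 0" if "test_function \<psi>" "\<And>x. \<psi> x \<noteq> 0 \<Longrightarrow> x \<in> (\<Union>y\<in>G. ball y (e y))" "G \<subseteq> F" for \<psi> G
  proof -
    have "finite G" using that(3) F(2) finite_subset by blast
    then show ?thesis using that
    proof (induction G arbitrary: \<psi>)
      case empty
      then have "\<psi> = (\<lambda>x. 0)" by auto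
      then show ?case using zero by simp
    next
      case (insert y G)
      have y: "y \<in> fun_support \<phi>" using insert.prems F(1) by auto
      note ey = e(1)[OF y]
      obtain \<kappa> :: "'a \<Rightarrow> real" where \<kappa>: "smooth \<kappa>" "\<And>x. 0 \<le> \<kappa> x" "\<And>x. \<kappa> x \<le> 1"
        "\<And>x. dist y x \<le> e y \<Longrightarrow> \<kappa> x = 1" "\<And>x. 2 * e y \<le> dist y x \<Longrightarrow> \<kappa> x = 0"
        by (rule bump_exists[of "e y" "2 * e y" y]) (use ey in auto)
      have sm: "smooth (\<lambda>x. complex_of_real (\<kappa> x))" using \<kappa>(1) by (rule smooth_of_real)
      have t1: "test_function (\<lambda>x. complex_of_real (\<kappa> x) * \<psi> x)"
        using insert.prems(1) sm by (rule test_function_mult)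
      have t2: "test_function (\<lambda>x. (1 - complex_of_real (\<kappa> x)) * \<psi> x)"
        using insert.prems(1) smooth_diff[OF smooth_const sm] by (rule test_function_mult)
      have "f (\<lambda>x. complex_of_real (\<kappa> x) * \<psi> x) = 0"
        using \<kappa>(5) by (intro e(2)[OF y t1] fun_support_subsetI) auto
      moreover have "f (\<lambda>x. (1 - complex_of_real (\<kappa> x)) * \<psi> x) = 0"
      proof (rule insert.IH[OF t2])
        fix x assume "(1 - complex_of_real (\<kappa> x)) * \<psi> x \<noteq> 0"
        then have "\<psi> x \<noteq> 0" "\<kappa> x \<noteq> 1" by auto
        then show "x \<in> (\<Union>y\<in>G. ball y (e y))"
          using insert.prems(2)[of x] \<kappa>(4)[of x] by auto
      qed (use insert.prems in auto)
      moreover have "f \<psi> = f (\<lambda>x. complex_of_real (\<kappa> x) * \<psi> x + (1 - complex_of_real (\<kappa> x)) * \<psi> x)"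
        by (simp add: algebra_simps)
      ultimately show ?case using add[OF t1 t2] by simp
    qed
  qed
  from this[OF \<phi> _ order_refl] show ?thesis using F(3) not_in_fun_support by blast
qed

lemma distribution_add:
  "distribution f \<Longrightarrow> test_function \<phi> \<Longrightarrow> test_function \<psi> \<Longrightarrow> f (\<lambda>x. \<phi> x + \<psi> x) = f \<phi> + f \<psi>"
  and distribution_scale: "distribution f \<Longrightarrow> test_function \<phi> \<Longrightarrow> f (\<lambda>x. c * \<phi> x) = c * f \<phi>"
  unfolding distribution_def by blast+

lemma vanish_off_dist_support:
  assumes f: "distribution f" and \<phi>: "test_function \<phi>" and disj: "fun_support \<phi> \<inter> dist_support f = {}"
  shows "f \<phi> = 0"
proof (rule additive_vanish_of_local[OF _ \<phi>])
  show "f (\<lambda>x. \<phi> x + \<psi> x) = f \<phi> + f \<psi>" if "test_function \<phi>" "test_function \<psi>" for \<phi> \<psi>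
    using distribution_add[OF f that] .
qed (use disj in \<open>auto simp: dist_support_def\<close>)

lemma cutoff_mult_eq:
  assumes f: "distribution f" and \<phi>: "test_function \<phi>" and \<eta>: "cutoff (dist_support f) \<eta>"
  shows "f (\<lambda>x. \<eta> x * \<phi> x) = f \<phi>"
proof -
  obtain V where V: "open V" "dist_support f \<subseteq> V" "\<And>x. x \<in> V \<Longrightarrow> \<eta> x = 1" and t: "test_function \<eta>"
    using \<eta> unfolding cutoff_def by blast
  have sm: "smooth \<eta>" using t by (simp add: test_function_def)
  have t1: "test_function (\<lambda>x. \<eta> x * \<phi> x)" using \<phi> sm by (rule test_function_mult)
  have t2: "test_function (\<lambda>x. (1 - \<eta> x) * \<phi> x)"
    using \<phi> smooth_diff[OF smooth_const sm] by (rule test_function_mult)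
  have "fun_support (\<lambda>x. (1 - \<eta> x) * \<phi> x) \<subseteq> - V"
    using V(1,3) by (intro fun_support_subsetI) auto
  then have "f (\<lambda>x. (1 - \<eta> x) * \<phi> x) = 0"
    using V(2) by (intro vanish_off_dist_support[OF f t2]) auto
  then show ?thesis using distribution_add[OF f t1 t2] by (simp add: algebra_simps)
qed

section \<open>Differentiation under the integral sign\<close>

lemma frechet_derivative_eq_sum:
  assumes "g differentiable (at x)"
  shows "frechet_derivative g (at x) v = (\<Sum>b\<in>Basis. (v \<bullet> b) *\<^sub>R pd b g x)"
proof -
  have lin: "linear (frechet_derivative g (at x))"
    using assms by (rule linear_frechet_derivative)
  show ?thesis
    by (subst (1) euclidean_representation[of v, symmetric])
      (simp only: linear_sum[OF lin] linear_scale[OF lin])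
qed

lemma norm_sum_pd_le:
  fixes g :: "'a::euclidean_space \<Rightarrow> 'b::real_normed_vector"
  assumes "\<And>b. b \<in> Basis \<Longrightarrow> norm (pd b g x) \<le> B"
  shows "norm (\<Sum>b\<in>Basis. (v \<bullet> b) *\<^sub>R pd b g x) \<le> real DIM('a) * B * norm v"
proof -
  have "norm (\<Sum>b\<in>Basis. (v \<bullet> b) *\<^sub>R pd b g x) \<le> (\<Sum>b\<in>(Basis::'a set). B * norm v)"
  proof (rule sum_norm_le)
    fix b :: 'a assume b: "b \<in> Basis"
    have "\<bar>v \<bullet> b\<bar> * norm (pd b g x) \<le> norm v * B"
      using Basis_le_norm[OF b, of v] assms[OF b] by (intro mult_mono) auto
    then show "norm ((v \<bullet> b) *\<^sub>R pd b g x) \<le> B * norm v" by (simp add: mult.commute)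
  qed
  then show ?thesis by (simp add: mult.assoc)
qed

text \<open>Dominated convergence along sequences tending to \<open>x\<close>. A ball that contains
  the sequence gives, by the mean value inequality, a constant bound on the remainders, which is
  integrable because the measure is finite.\<close>

lemma (in finite_measure) has_derivative_integral:
  fixes g :: "'a \<Rightarrow> 'c::euclidean_space \<Rightarrow> complex"
  assumes diff: "\<And>m x. m \<in> space M \<Longrightarrow> g m differentiable (at x)"
    and meas: "\<And>x. (\<lambda>m. g m x) \<in> borel_measurable M"
      "\<And>x b. b \<in> Basis \<Longrightarrow> (\<lambda>m. pd b (g m) x) \<in> borel_measurable M"
    and bound: "\<And>R. \<exists>B. \<forall>m\<in>space M. \<forall>x\<in>cball 0 R. norm (g m x) \<le> B"
      "\<And>R. \<exists>B. \<forall>b\<in>Basis. \<forall>m\<in>space M. \<forall>x\<in>cball 0 R. norm (pd b (g m) x) \<le> B"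
  shows "((\<lambda>x. LINT m|M. g m x) has_derivative
      (\<lambda>v. \<Sum>b\<in>Basis. (v \<bullet> b) *\<^sub>R (LINT m|M. pd b (g m) x))) (at x)"
proof -
  have int: "integrable M (\<lambda>m. g m x)" for x
  proof -
    obtain B where "\<forall>m\<in>space M. \<forall>y\<in>cball 0 (norm x). norm (g m y) \<le> B"
      using bound(1) by blast
    then show ?thesis
      using meas(1) by (intro integrable_const_bound[where B = B] AE_I2) auto
  qed
  have intd: "integrable M (\<lambda>m. pd b (g m) x)" if b: "b \<in> Basis" for b x
  proof -
    obtain B where "\<forall>b\<in>Basis. \<forall>m\<in>space M. \<forall>y\<in>cball 0 (norm x). norm (pd b (g m) y) \<le> B"
      using bound(2) by blast
    then show ?thesis
      using meas(2)[OF b] b by (intro integrable_const_bound[where B = B] AE_I2) auto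
  qed
  define D where "D m v = (\<Sum>b\<in>Basis. (v \<bullet> b) *\<^sub>R pd b (g m) x)" for m v
  have intD: "integrable M (\<lambda>m. D m v)" for v
    unfolding D_def by (intro Bochner_Integration.integrable_sum integrable_scaleR_right intd)
  have D_int: "(LINT m|M. D m v) = (\<Sum>b\<in>Basis. (v \<bullet> b) *\<^sub>R (LINT m|M. pd b (g m) x))" for v
    unfolding D_def
    by (subst Bochner_Integration.integral_sum) (auto intro: intd)
  have der: "(g m has_derivative (\<lambda>v. \<Sum>b\<in>Basis. (v \<bullet> b) *\<^sub>R pd b (g m) y)) (at y)"
    if "m \<in> space M" for m y
  proof -
    have "frechet_derivative (g m) (at y) = (\<lambda>v. \<Sum>b\<in>Basis. (v \<bullet> b) *\<^sub>R pd b (g m) y)"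
      by (rule ext) (rule frechet_derivative_eq_sum[OF diff[OF that]])
    with frechet_derivative_works[THEN iffD1, OF diff[OF that]] show ?thesis
      by (rule has_derivative_eq_rhs)
  qed
  let ?q = "\<lambda>y. ((LINT m|M. g m y) - (LINT m|M. g m x) - (LINT m|M. D m (y - x))) /\<^sub>R norm (y - x)"
  have "(?q \<longlongrightarrow> 0) (at x)"
    unfolding tendsto_at_iff_sequentially
  proof (intro allI impI)
    fix X assume X: "\<forall>i. X i \<in> UNIV - {x}" "X \<longlonglongrightarrow> x"
    define q where "q i m = (g m (X i) - g m x - D m (X i - x)) /\<^sub>R norm (X i - x)" for i m
    have "bounded (insert x (range X))"
      using X(2) by (simp add: convergent_imp_bounded)
    then obtain R where R: "\<And>y. y \<in> insert x (range X) \<Longrightarrow> norm y \<le> R"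
      unfolding bounded_iff by blast
    obtain B where "\<forall>b\<in>Basis. \<forall>m\<in>space M. \<forall>y\<in>cball 0 R. norm (pd b (g m) y) \<le> B"
      using bound(2) by blast
    then have B: "norm (pd b (g m) y) \<le> B" if "b \<in> Basis" "m \<in> space M" "norm y \<le> R" for b m y
      using that by simp
    define C where "C = real DIM('c) * B"
    have Dle: "norm (D m v) \<le> C * norm v" if "m \<in> space M" for m v
      unfolding D_def C_def using B that R[of x] by (intro norm_sum_pd_le) auto
    have gle: "norm (g m (X i) - g m x) \<le> C * norm (X i - x)" if m: "m \<in> space M" for m i
    proof (rule differentiable_bound[of "cball 0 R"])
      fix y :: 'c assume y: "y \<in> cball 0 R"
      show "(g m has_derivative (\<lambda>v. \<Sum>b\<in>Basis. (v \<bullet> b) *\<^sub>R pd b (g m) y)) (at y within cball 0 R)"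
        using der[OF m] by (rule has_derivative_at_withinI)
      show "onorm (\<lambda>v. \<Sum>b\<in>Basis. (v \<bullet> b) *\<^sub>R pd b (g m) y) \<le> C"
        unfolding C_def using B m y by (intro onorm_le norm_sum_pd_le) auto
    qed (use R[of x] R[of "X i"] in auto)
    have "(\<lambda>i. LINT m|M. q i m) \<longlonglongrightarrow> (LINT m|M. 0)"
    proof (rule integral_dominated_convergence[where w = "\<lambda>m. 2 * C"])
      show "AE m in M. (\<lambda>i. q i m) \<longlonglongrightarrow> 0"
      proof (rule AE_I2)
        fix m assume m: "m \<in> space M"
        have "((\<lambda>y. (g m y - g m x - D m (y - x)) /\<^sub>R norm (y - x)) \<longlongrightarrow> 0) (at x)"
          using der[OF m, of x] unfolding has_derivative_at_within D_def by simp
        then show "(\<lambda>i. q i m) \<longlonglongrightarrow> 0"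
          using X unfolding tendsto_at_iff_sequentially q_def by (auto simp: o_def)
      qed
      show "AE m in M. norm (q i m) \<le> 2 * C" for i
      proof (rule AE_I2)
        fix m assume m: "m \<in> space M"
        have pos: "0 < norm (X i - x)" using X(1) by auto
        have "norm (g m (X i) - g m x - D m (X i - x)) \<le> 2 * C * norm (X i - x)"
          using gle[OF m, of i] Dle[OF m, of "X i - x"]
            norm_triangle_ineq4[of "g m (X i) - g m x" "D m (X i - x)"] by simp
        moreover have "norm (q i m) = norm (g m (X i) - g m x - D m (X i - x)) / norm (X i - x)"
          by (simp add: q_def divide_inverse mult.commute)
        ultimately show "norm (q i m) \<le> 2 * C"
          using pos by (simp add: pos_divide_le_eq)
      qed
      show "(\<lambda>m. q i m) \<in> borel_measurable M" for i
        unfolding q_def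
        by (intro borel_measurable_scaleR borel_measurable_const borel_measurable_diff meas(1)
            borel_measurable_integrable[OF intD])
    qed auto
    moreover have "(LINT m|M. q i m) = (?q \<circ> X) i" for i
      unfolding q_def by (simp add: int intD)
    ultimately show "(?q \<circ> X) \<longlonglongrightarrow> 0" by (simp add: o_def)
  qed
  moreover have "bounded_linear (\<lambda>v. \<Sum>b\<in>Basis. (v \<bullet> b) *\<^sub>R (LINT m|M. pd b (g m) x))"
    by (intro bounded_linear_sum bounded_linear_scaleR_left[THEN bounded_linear_compose]
        bounded_linear_inner_left)
  ultimately show ?thesis
    unfolding has_derivative_at_within D_int by simp
qed

lemma (in finite_measure) smooth_integral:
  fixes g :: "'a \<Rightarrow> 'c::euclidean_space \<Rightarrow> complex"
  assumes smooth: "\<And>m. m \<in> space M \<Longrightarrow> smooth (g m)"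
    and meas: "\<And>bs x. set bs \<subseteq> Basis \<Longrightarrow> (\<lambda>m. iter_pderiv bs (g m) x) \<in> borel_measurable M"
    and bound: "\<And>bs R. set bs \<subseteq> Basis \<Longrightarrow>
      \<exists>B. \<forall>m\<in>space M. \<forall>x\<in>cball 0 R. norm (iter_pderiv bs (g m) x) \<le> B"
  shows "smooth (\<lambda>x. LINT m|M. g m x)"
    and "set bs \<subseteq> Basis \<Longrightarrow>
      iter_pderiv bs (\<lambda>x. LINT m|M. g m x) = (\<lambda>x. LINT m|M. iter_pderiv bs (g m) x)"
proof -
  have D: "((\<lambda>x. LINT m|M. iter_pderiv bs (g m) x) has_derivative
      (\<lambda>v. \<Sum>b\<in>Basis. (v \<bullet> b) *\<^sub>R (LINT m|M. pd b (iter_pderiv bs (g m)) x))) (at x)"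
    if bs: "set bs \<subseteq> Basis" for bs x
  proof (rule has_derivative_integral)
    show "\<exists>B. \<forall>b\<in>Basis. \<forall>m\<in>space M. \<forall>x\<in>cball 0 R. norm (pd b (iter_pderiv bs (g m)) x) \<le> B" for R
    proof -
      have "\<forall>b\<in>Basis. \<exists>B. \<forall>m\<in>space M. \<forall>x\<in>cball 0 R. norm (pd b (iter_pderiv bs (g m)) x) \<le> B"
      proof
        fix b :: 'c assume "b \<in> Basis"
        then show "\<exists>B. \<forall>m\<in>space M. \<forall>x\<in>cball 0 R. norm (pd b (iter_pderiv bs (g m)) x) \<le> B"
          using bound[of "b # bs" R] bs by simp
      qed
      then obtain B where B: "\<forall>b\<in>Basis. \<forall>m\<in>space M. \<forall>x\<in>cball 0 R.
          norm (pd b (iter_pderiv bs (g m)) x) \<le> B b"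
        by metis
      have "norm (pd b (iter_pderiv bs (g m)) x) \<le> (MAX b\<in>Basis. B b)"
        if "b \<in> Basis" "m \<in> space M" "x \<in> cball 0 R" for b m x
        using B that by (intro order_trans[OF _ Max_ge[of "B ` Basis" "B b"]]) auto
      then show ?thesis by blast
    qed
    show "(\<lambda>m. pd b (iter_pderiv bs (g m)) x) \<in> borel_measurable M" if "b \<in> Basis" for b x
      using meas[of "b # bs" x] bs that by simp
    show "iter_pderiv bs (g m) differentiable (at x)" if "m \<in> space M" for m x
      by (rule smooth_differentiable[OF smooth_iter_pderiv[OF smooth[OF that] bs]])
  qed (use meas[OF bs] bound[OF bs] in auto)
  have eq: "iter_pderiv bs (\<lambda>x. LINT m|M. g m x) = (\<lambda>x. LINT m|M. iter_pderiv bs (g m) x)"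
    if "set bs \<subseteq> Basis" for bs
    using that
  proof (induction bs)
    case (Cons b bs)
    then have bs: "set bs \<subseteq> Basis" and b: "b \<in> Basis" by auto
    have "(\<Sum>c\<in>Basis. (b \<bullet> c) *\<^sub>R (LINT m|M. pd c (iter_pderiv bs (g m)) x)) =
        (\<Sum>c\<in>Basis. if c = b then LINT m|M. pd c (iter_pderiv bs (g m)) x else 0)" for x
      using b by (intro sum.cong) (auto simp: inner_Basis)
    then have "(\<Sum>c\<in>Basis. (b \<bullet> c) *\<^sub>R (LINT m|M. pd c (iter_pderiv bs (g m)) x)) =
        (LINT m|M. pd b (iter_pderiv bs (g m)) x)" for x
      using b by simp
    then show ?case
      using pd_eqI[OF D[OF bs], of b] Cons.IH[OF bs] by simp
  qed simp
  show "smooth (\<lambda>x. LINT m|M. g m x)"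
    unfolding smooth_on_open_def using eq differentiableI[OF D] by auto
  show "iter_pderiv bs (\<lambda>x. LINT m|M. g m x) = (\<lambda>x. LINT m|M. iter_pderiv bs (g m) x)"
    if "set bs \<subseteq> Basis"
    using eq[OF that] .
qed

section \<open>The area measure on the unit sphere\<close>

lemma space_sphere_area: "space (sphere_area :: 'a::euclidean_space measure) = sphere 0 1"
  by (simp add: sphere_area_def space_scale_measure space_restrict_space)

lemma sets_sphere_area:
  "sets (sphere_area :: 'a::euclidean_space measure) = sets (restrict_space borel (sphere 0 1))"
  by (simp add: sphere_area_def sets_scale_measure)

lemma sgn_measurable_sphere:
  "sgn \<in> restrict_space lborel (cball 0 1 - {0}) \<rightarrow>\<^sub>M restrict_space borel (sphere (0::'a::euclidean_space) 1)"
proof (rule measurable_restrict_space2)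
  have "sgn \<in> borel_measurable (lborel :: 'a measure)"
    unfolding sgn_div_norm[abs_def] by measurable
  then show "sgn \<in> borel_measurable (restrict_space lborel (cball 0 1 - {0 :: 'a}))"
    by (rule measurable_restrict_space1)
qed (auto simp: space_restrict_space norm_sgn)

lemma emeasure_sphere_area:
  assumes "A \<in> sets (restrict_space borel (sphere (0::'a::euclidean_space) 1))"
  shows "emeasure sphere_area A = of_nat DIM('a) *
    emeasure lborel (sgn -` A \<inter> (cball 0 1 - {0}))"
proof -
  have "sgn -` A \<inter> (cball 0 1 - {0 :: 'a}) \<in> sets (restrict_space lborel (cball 0 1 - {0}))"
    using measurable_sets[OF sgn_measurable_sphere assms] by (simp add: space_restrict_space)
  then have "emeasure (restrict_space lborel (cball 0 1 - {0})) (sgn -` A \<inter> (cball 0 1 - {0 :: 'a})) =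
      emeasure lborel (sgn -` A \<inter> (cball 0 1 - {0}))"
    by (intro emeasure_restrict_space) auto
  then show ?thesis
    unfolding sphere_area_def
    by (simp add: emeasure_distr[OF sgn_measurable_sphere assms] space_restrict_space)
qed

lemma finite_measure_sphere_area: "finite_measure (sphere_area :: 'a::euclidean_space measure)"
proof (rule finite_measureI)
  have "emeasure (sphere_area :: 'a measure) (sphere 0 1) =
      of_nat DIM('a) * emeasure lborel (sgn -` sphere 0 1 \<inter> (cball 0 1 - {0 :: 'a}))"
    using sets.top[of "restrict_space borel (sphere (0 :: 'a) 1)"]
    by (intro emeasure_sphere_area) (simp add: space_restrict_space)
  also have "\<dots> \<le> of_nat DIM('a) * emeasure lborel (cball (0 :: 'a) 1)"
    by (intro mult_left_mono emeasure_mono) auto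
  also have "\<dots> < \<infinity>"
    using emeasure_lborel_cball_finite[of "0 :: 'a" 1] by (simp add: ennreal_mult_less_top of_nat_less_top)
  finally show "emeasure sphere_area (space (sphere_area :: 'a measure)) \<noteq> \<infinity>"
    by (simp add: space_sphere_area)
qed

text \<open>The cone over a cap contains a full ball, centred half way to \<open>\<omega>\<close> so
  as to stay inside the unit ball. This positivity allows weights that concentrate at
  \<open>\<omega>\<close> to be normalized.\<close>

lemma sphere_area_ball_pos:
  assumes \<omega>: "\<omega> \<in> sphere (0::'a::euclidean_space) 1" and "0 < e"
  shows "0 < measure sphere_area (sphere 0 1 \<inter> ball \<omega> e)"
proof -
  have "\<omega> \<noteq> 0" using \<omega> by auto
  let ?U = "{x \<in> - {0}. sgn x \<in> ball \<omega> e} \<inter> ball 0 1"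
  have A: "sphere 0 1 \<inter> ball \<omega> e \<in> sets (restrict_space borel (sphere (0::'a) 1))"
    by (auto simp: sets_restrict_space)
  have "continuous_on (- {0 :: 'a}) sgn"
    by (intro continuous_intros) auto
  then have "open ({x \<in> - {0}. sgn x \<in> ball \<omega> e})"
    using continuous_open_preimage[of "- {0 :: 'a}" sgn "ball \<omega> e"]
    by (simp add: vimage_def Int_def open_Compl)
  then have opn: "open ?U" by blast
  moreover have "(1/2) *\<^sub>R \<omega> \<in> ?U"
    using \<omega> \<open>0 < e\<close> \<open>\<omega> \<noteq> 0\<close> by (simp add: sgn_scaleR sgn_div_norm)
  ultimately obtain r where r: "0 < r" "ball ((1/2) *\<^sub>R \<omega>) r \<subseteq> ?U"
    using open_contains_ball by blast
  have "emeasure lborel (ball ((1/2) *\<^sub>R \<omega>) r) \<noteq> 0"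
    using content_ball_pos[OF r(1), of "(1/2) *\<^sub>R \<omega>"] by (auto simp: measure_def)
  moreover have "emeasure lborel (ball ((1/2) *\<^sub>R \<omega>) r) \<le> emeasure lborel ?U"
    using r(2) opn by (intro emeasure_mono) auto
  ultimately have pos: "emeasure lborel ?U \<noteq> 0" by auto
  have "?U \<subseteq> sgn -` (sphere 0 1 \<inter> ball \<omega> e) \<inter> (cball 0 1 - {0})"
    by (auto simp: norm_sgn)
  then have "emeasure lborel ?U \<le> emeasure lborel (sgn -` (sphere 0 1 \<inter> ball \<omega> e) \<inter> (cball 0 1 - {0 :: 'a}))"
    using measurable_sets[OF sgn_measurable_sphere A]
    by (intro emeasure_mono) (auto simp: space_restrict_space sets_restrict_space)
  then have "emeasure sphere_area (sphere 0 1 \<inter> ball \<omega> e) \<noteq> 0"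
    using pos unfolding emeasure_sphere_area[OF A] by auto
  then show ?thesis
    using finite_measure.emeasure_eq_measure[OF finite_measure_sphere_area]
    by (metis ennreal_0 measure_nonneg order_le_less)
qed

section \<open>Plane waves and the dual Radon transform\<close>

lemma smooth_plane_wave: "smooth g \<Longrightarrow> smooth (\<lambda>x. g (x \<bullet> \<omega>))"
  for g :: "real \<Rightarrow> 'b::real_normed_vector"
  by (rule smooth_compose[OF _ smooth_linear[OF bounded_linear_inner_left]])

lemma pd_plane_wave:
  fixes g :: "real \<Rightarrow> complex" and \<omega> :: "'a::euclidean_space"
  assumes "smooth g"
  shows "pd b (\<lambda>x. g (x \<bullet> \<omega>)) = (\<lambda>x. of_real (b \<bullet> \<omega>) * pd 1 g (x \<bullet> \<omega>))"
proof (rule pd_eqI)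
  fix x
  have "(g has_derivative frechet_derivative g (at (x \<bullet> \<omega>))) (at (x \<bullet> \<omega>))"
    using smooth_has_derivative[OF assms] .
  from has_derivative_compose[OF bounded_linear_imp_has_derivative[OF bounded_linear_inner_left] this]
  have D: "((\<lambda>x. g (x \<bullet> \<omega>)) has_derivative (\<lambda>v. frechet_derivative g (at (x \<bullet> \<omega>)) (v \<bullet> \<omega>))) (at x)" .
  have lin: "frechet_derivative g (at (x \<bullet> \<omega>)) t = of_real t * pd 1 g (x \<bullet> \<omega>)" for t
    using linear_scale[OF linear_frechet_derivative[OF smooth_differentiable[OF assms]], of "x \<bullet> \<omega>" t 1]
    by (simp add: scaleR_conv_of_real)
  show "((\<lambda>x. g (x \<bullet> \<omega>)) has_derivative (\<lambda>v. of_real (v \<bullet> \<omega>) * pd 1 g (x \<bullet> \<omega>))) (at x)"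
    by (rule has_derivative_eq_rhs[OF D]) (rule ext, rule lin)
qed

definition nderiv :: "nat \<Rightarrow> (real \<Rightarrow> complex) \<Rightarrow> real \<Rightarrow> complex" where
  "nderiv j = iter_pderiv (replicate j 1)"

lemma smooth_nderiv: "smooth g \<Longrightarrow> smooth (nderiv j g)"
  unfolding nderiv_def by (rule smooth_iter_pderiv) auto

lemma iter_pderiv_plane_wave:
  fixes \<omega> :: "'a::euclidean_space"
  assumes "smooth g"
  shows "iter_pderiv bs (\<lambda>x. g (x \<bullet> \<omega>)) =
    (\<lambda>x. of_real (\<Prod>b\<leftarrow>bs. b \<bullet> \<omega>) * nderiv (length bs) g (x \<bullet> \<omega>))"
proof (induction bs)
  case Nil
  show ?case by (simp add: nderiv_def)
next
  case (Cons b bs)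
  let ?g = "nderiv (length bs) g"
  have "pd b (\<lambda>x. of_real (\<Prod>b\<leftarrow>bs. b \<bullet> \<omega>) * ?g (x \<bullet> \<omega>)) =
      (\<lambda>x. of_real (\<Prod>b\<leftarrow>bs. b \<bullet> \<omega>) * pd b (\<lambda>x. ?g (x \<bullet> \<omega>)) x)"
    by (rule pd_linear_comp[OF bounded_linear_mult_right])
      (rule smooth_plane_wave[OF smooth_nderiv[OF assms]])
  also have "\<dots> = (\<lambda>x. of_real (\<Prod>b\<leftarrow>b # bs. b \<bullet> \<omega>) * pd 1 ?g (x \<bullet> \<omega>))"
    by (simp add: pd_plane_wave[OF smooth_nderiv[OF assms], THEN fun_cong] mult_ac)
  also have "pd 1 ?g = nderiv (length (b # bs)) g"
    by (simp add: nderiv_def)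
  finally show ?case using Cons.IH by simp
qed

text \<open>Joint continuity in direction and point is what makes the derivatives of plane waves in
  nearby directions uniformly close on compact sets.\<close>

lemma continuous_on_plane_wave_derivative:
  fixes g :: "real \<Rightarrow> complex"
  assumes "smooth g"
  shows "continuous_on S (\<lambda>z :: 'a::euclidean_space \<times> 'a. iter_pderiv bs (\<lambda>x. g (x \<bullet> fst z)) (snd z))"
  unfolding iter_pderiv_plane_wave[OF assms]
proof (intro continuous_intros)
  show "continuous_on S (\<lambda>z. \<Prod>b\<leftarrow>bs. b \<bullet> fst z)"
    by (induction bs) (auto intro!: continuous_intros)
  show "continuous_on S (\<lambda>z. nderiv (length bs) g (snd z \<bullet> fst z))"
    by (rule continuous_on_compose2[OF smooth_continuous_on[OF smooth_nderiv[OF assms], of UNIV]])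
      (auto intro!: continuous_intros)
qed

text \<open>The even symmetrization of \<open>\<zeta> \<omega> * g p\<close>, since only even
  functions live on the manifold of hyperplanes.\<close>

definition sym_product ::
  "('a::euclidean_space \<Rightarrow> real) \<Rightarrow> (real \<Rightarrow> complex) \<Rightarrow> 'a \<times> real \<Rightarrow> complex" where
  "sym_product \<zeta> g z =
     of_real (\<zeta> (fst z)) * g (snd z) + of_real (\<zeta> (- fst z)) * g (- snd z)"

lemma even_smooth_sym_product:
  assumes "smooth \<zeta>" "smooth g"
  shows "even_smooth (sym_product \<zeta> g)"
proof -
  have f: "smooth (fst :: 'a \<times> real \<Rightarrow> 'a)" "smooth (snd :: 'a \<times> real \<Rightarrow> real)"
    by (rule smooth_linear[OF bounded_linear_fst]) (rule smooth_linear[OF bounded_linear_snd])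
  have "smooth (sym_product \<zeta> g)"
    unfolding sym_product_def[abs_def]
    by (intro smooth_add smooth_mult smooth_of_real
        smooth_compose[OF assms(1) f(1)] smooth_compose[OF assms(1) smooth_minus[OF f(1)]]
        smooth_compose[OF assms(2) f(2)] smooth_compose[OF assms(2) smooth_minus[OF f(2)]])
  then have "smooth_on sphere_line (sym_product \<zeta> g)"
    unfolding smooth_on_def by (intro ballI exI[of _ UNIV] exI[of _ "sym_product \<zeta> g"]) simp
  then show ?thesis
    unfolding even_smooth_def by (simp add: sym_product_def add.commute)
qed

lemma dual_radon_sym_product:
  "dual_radon (sym_product \<zeta> g) x = (LINT \<omega>|sphere_area.
     of_real (\<zeta> \<omega>) * g (x \<bullet> \<omega>) + of_real (\<zeta> (- \<omega>)) * g (x \<bullet> - \<omega>))"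
  by (simp add: dual_radon_def sym_product_def)

lemma borel_measurable_sphere_area:
  fixes h :: "'a::euclidean_space \<Rightarrow> 'b::{real_normed_vector, second_countable_topology}"
  assumes "continuous_on (sphere 0 1) h"
  shows "h \<in> borel_measurable sphere_area"
  unfolding measurable_cong_sets[OF sets_sphere_area refl]
  by (rule borel_measurable_continuous_on_restrict[OF assms])

lemma integrable_sphere_area:
  fixes h :: "'a::euclidean_space \<Rightarrow> 'b::{banach, second_countable_topology}"
  assumes "continuous_on (sphere 0 1) h"
  shows "integrable sphere_area h"
proof -
  interpret finite_measure "sphere_area :: 'a measure" by (rule finite_measure_sphere_area)
  have "bounded (h ` sphere 0 1)"
    using assms by (intro compact_imp_bounded compact_continuous_image) auto
  then obtain B where "\<And>\<omega>. \<omega> \<in> sphere 0 1 \<Longrightarrow> norm (h \<omega>) \<le> B"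
    unfolding bounded_iff by blast
  then show ?thesis
    by (intro integrable_const_bound[of _ B] AE_I2 borel_measurable_sphere_area[OF assms])
      (simp add: space_sphere_area)
qed

context
  fixes g :: "real \<Rightarrow> complex" and \<zeta> :: "'a::euclidean_space \<Rightarrow> real"
  assumes g: "smooth g" and \<zeta>: "smooth \<zeta>"
begin

abbreviation plane_deriv :: "'a list \<Rightarrow> 'a \<Rightarrow> 'a \<Rightarrow> complex" where
  "plane_deriv bs \<omega> x \<equiv> iter_pderiv bs (\<lambda>x. g (x \<bullet> \<omega>)) x"

lemma continuous_on_plane_deriv_direction:
  "continuous_on S (\<lambda>\<omega>. plane_deriv bs \<omega> x)"
  "continuous_on S (\<lambda>\<omega>. plane_deriv bs (- \<omega>) x)"
  by (rule continuous_on_compose2[OF continuous_on_plane_wave_derivative[OF g, of UNIV],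
        of S "\<lambda>\<omega>. (\<omega>, x)", unfolded fst_conv snd_conv];
      auto intro!: continuous_intros)
    (rule continuous_on_compose2[OF continuous_on_plane_wave_derivative[OF g, of UNIV],
        of S "\<lambda>\<omega>. (- \<omega>, x)", unfolded fst_conv snd_conv];
      auto intro!: continuous_intros)

lemma continuous_on_weight: "continuous_on S \<zeta>" "continuous_on S (\<lambda>\<omega>. \<zeta> (- \<omega>))"
  using smooth_continuous_on[OF \<zeta>] smooth_continuous_on[OF smooth_compose[OF \<zeta> smooth_minus[OF smooth_id]]]
  by auto

lemma iter_pderiv_integrand:
  assumes "set bs \<subseteq> Basis"
  shows "iter_pderiv bs (\<lambda>x. of_real (\<zeta> \<omega>) * g (x \<bullet> \<omega>) + of_real (\<zeta> (- \<omega>)) * g (x \<bullet> - \<omega>)) =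
    (\<lambda>x. of_real (\<zeta> \<omega>) * plane_deriv bs \<omega> x + of_real (\<zeta> (- \<omega>)) * plane_deriv bs (- \<omega>) x)"
proof -
  have sm: "smooth (\<lambda>x. c * g (x \<bullet> \<omega>))" for c \<omega>
    using smooth_mult[OF smooth_const smooth_plane_wave[OF g]] .
  show ?thesis
    unfolding iter_pderiv_add[OF sm sm assms]
      iter_pderiv_linear_comp[OF bounded_linear_mult_right smooth_plane_wave[OF g] assms] ..
qed

text \<open>Differentiation under the integral sign; the integrand and its derivatives are jointly
  continuous, hence bounded on the sphere times a ball.\<close>

lemma dual_radon_sym_product_smooth:
  shows "smooth (dual_radon (sym_product \<zeta> g))"
    and "set bs \<subseteq> Basis \<Longrightarrow> iter_pderiv bs (dual_radon (sym_product \<zeta> g)) =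
      (\<lambda>x. LINT \<omega>|sphere_area. of_real (\<zeta> \<omega>) * plane_deriv bs \<omega> x +
        of_real (\<zeta> (- \<omega>)) * plane_deriv bs (- \<omega>) x)"
proof -
  interpret finite_measure "sphere_area :: 'a measure" by (rule finite_measure_sphere_area)
  let ?h = "\<lambda>\<omega> x. of_real (\<zeta> \<omega>) * g (x \<bullet> \<omega>) + of_real (\<zeta> (- \<omega>)) * g (x \<bullet> - \<omega>)"
  have eq: "dual_radon (sym_product \<zeta> g) = (\<lambda>x. LINT \<omega>|sphere_area. ?h \<omega> x)"
    by (rule ext) (rule dual_radon_sym_product)
  have sm: "smooth (?h \<omega>)" for \<omega>
    by (intro smooth_add smooth_mult smooth_const smooth_plane_wave[OF g])
  have meas: "(\<lambda>\<omega>. iter_pderiv bs (?h \<omega>) x) \<in> borel_measurable sphere_area" if "set bs \<subseteq> Basis" for bs x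
    unfolding iter_pderiv_integrand[OF that]
    by (intro borel_measurable_sphere_area continuous_intros continuous_on_plane_deriv_direction
        continuous_on_weight)
  have bound: "\<exists>B. \<forall>\<omega>\<in>space sphere_area. \<forall>x\<in>cball 0 R. norm (iter_pderiv bs (?h \<omega>) x) \<le> B"
    if bs: "set bs \<subseteq> Basis" for bs :: "'a list" and R
  proof -
    let ?K = "sphere 0 1 \<times> cball 0 R :: ('a \<times> 'a) set"
    let ?F = "\<lambda>z. of_real (\<zeta> (fst z)) * plane_deriv bs (fst z) (snd z) +
        of_real (\<zeta> (- fst z)) * plane_deriv bs (- fst z) (snd z)"
    have c1: "continuous_on ?K (\<lambda>z. plane_deriv bs (fst z) (snd z))"
      by (rule continuous_on_plane_wave_derivative[OF g])
    have c2: "continuous_on ?K (\<lambda>z. plane_deriv bs (- fst z) (snd z))"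
      by (rule continuous_on_compose2[OF continuous_on_plane_wave_derivative[OF g, of UNIV],
          of ?K "\<lambda>z. (- fst z, snd z)", unfolded fst_conv snd_conv])
        (auto intro!: continuous_intros)
    have c3: "continuous_on ?K (\<lambda>z. \<zeta> (fst z))" "continuous_on ?K (\<lambda>z. \<zeta> (- fst z))"
      by (rule continuous_on_compose2[OF continuous_on_weight(1)[of UNIV]]; auto intro!: continuous_intros)+
    have "bounded (?F ` ?K)"
      by (intro compact_imp_bounded compact_continuous_image compact_Times compact_sphere compact_cball
          continuous_intros c1 c2 c3)
    then obtain B where B: "\<And>z. z \<in> ?K \<Longrightarrow> norm (?F z) \<le> B"
      unfolding bounded_iff by blast
    have "norm (iter_pderiv bs (?h \<omega>) x) \<le> B" if "\<omega> \<in> space sphere_area" "x \<in> cball 0 R" for \<omega> x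
      unfolding iter_pderiv_integrand[OF bs] using B[of "(\<omega>, x)"] that by (simp add: space_sphere_area)
    then show ?thesis by blast
  qed
  show "smooth (dual_radon (sym_product \<zeta> g))"
    unfolding eq by (rule smooth_integral(1)[OF sm meas bound])
  show "iter_pderiv bs (dual_radon (sym_product \<zeta> g)) =
      (\<lambda>x. LINT \<omega>|sphere_area. of_real (\<zeta> \<omega>) * plane_deriv bs \<omega> x +
        of_real (\<zeta> (- \<omega>)) * plane_deriv bs (- \<omega>) x)" if "set bs \<subseteq> Basis"
    using smooth_integral(2)[OF sm meas bound that] unfolding eq iter_pderiv_integrand[OF that] .
qed

text \<open>Both halves of the even test function concentrate at the same plane wave.\<close>

lemma dual_radon_concentration:
  assumes nonneg: "\<And>\<omega>. 0 \<le> \<zeta> \<omega>"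
    and near: "\<And>\<omega>. \<omega> \<in> sphere 0 1 \<Longrightarrow> \<zeta> \<omega> \<noteq> 0 \<Longrightarrow> norm (plane_deriv bs \<omega> x - plane_deriv bs \<omega>0 x) \<le> e"
    and bs: "set bs \<subseteq> Basis"
    and c: "c = (LINT \<omega>|sphere_area. \<zeta> \<omega> + \<zeta> (- \<omega>))" "0 < c"
  shows "norm (iter_pderiv bs (dual_radon (sym_product \<zeta> g)) x / of_real c - plane_deriv bs \<omega>0 x) \<le> e"
proof -
  let ?W = "\<lambda>\<omega>. plane_deriv bs \<omega> x"
  let ?I = "\<lambda>\<omega>. of_real (\<zeta> \<omega>) * ?W \<omega> + of_real (\<zeta> (- \<omega>)) * ?W (- \<omega>)"
  let ?J = "\<lambda>\<omega>. of_real (\<zeta> \<omega> + \<zeta> (- \<omega>)) * ?W \<omega>0"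
  note cont = continuous_on_plane_deriv_direction continuous_on_weight
  have int: "integrable sphere_area ?I" "integrable sphere_area ?J"
    "integrable sphere_area (\<lambda>\<omega>. e * (\<zeta> \<omega> + \<zeta> (- \<omega>)))"
    by (intro integrable_sphere_area continuous_intros cont)+
  have J: "(LINT \<omega>|sphere_area. ?J \<omega>) = of_real c * ?W \<omega>0"
    by (simp only: integral_mult_left_zero integral_complex_of_real c(1))
  have "norm (iter_pderiv bs (dual_radon (sym_product \<zeta> g)) x - of_real c * ?W \<omega>0)
      = norm (LINT \<omega>|sphere_area. ?I \<omega> - ?J \<omega>)"
    unfolding dual_radon_sym_product_smooth(2)[OF bs] J[symmetric]
    by (simp only: Bochner_Integration.integral_diff[OF int(1,2)])
  also have "\<dots> \<le> (LINT \<omega>|sphere_area. e * (\<zeta> \<omega> + \<zeta> (- \<omega>)))"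
  proof (rule Bochner_Integration.integral_norm_bound_integral[OF Bochner_Integration.integrable_diff[OF int(1,2)] int(3)])
    fix \<omega> :: 'a assume "\<omega> \<in> space sphere_area"
    then have \<omega>: "\<omega> \<in> sphere 0 1" "- \<omega> \<in> sphere 0 1" by (auto simp: space_sphere_area)
    \<comment> \<open>Used for \<open>v = \<omega>\<close> and for \<open>v = - \<omega>\<close>:
      the reflected summand carries the weight \<open>\<zeta> (- \<omega>)\<close> and the plane
      wave in direction \<open>- \<omega>\<close>, which is again close to the one in direction
      \<open>\<omega>0\<close> wherever that weight is nonzero.\<close>
    have le: "norm (of_real (\<zeta> v) * (?W v - ?W \<omega>0)) \<le> e * \<zeta> v" if "v \<in> sphere 0 1" for v
      using near[OF that] nonneg[of v]
      by (cases "\<zeta> v = 0") (auto simp: norm_mult mult.commute intro!: mult_right_mono)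
    have "?I \<omega> - ?J \<omega> = of_real (\<zeta> \<omega>) * (?W \<omega> - ?W \<omega>0) + of_real (\<zeta> (- \<omega>)) * (?W (- \<omega>) - ?W \<omega>0)"
      by (simp add: algebra_simps)
    then show "norm (?I \<omega> - ?J \<omega>) \<le> e * (\<zeta> \<omega> + \<zeta> (- \<omega>))"
      using norm_triangle_mono[OF le[OF \<omega>(1)] le[OF \<omega>(2)]] by (simp add: distrib_left)
  qed
  also have "\<dots> = e * c" by (simp add: c(1))
  finally have le: "norm (iter_pderiv bs (dual_radon (sym_product \<zeta> g)) x - of_real c * ?W \<omega>0) \<le> e * c" .
  have "iter_pderiv bs (dual_radon (sym_product \<zeta> g)) x / of_real c - ?W \<omega>0 =
      (iter_pderiv bs (dual_radon (sym_product \<zeta> g)) x - of_real c * ?W \<omega>0) / of_real c"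
    using c(2) by (simp add: diff_divide_distrib)
  then have "norm (iter_pderiv bs (dual_radon (sym_product \<zeta> g)) x / of_real c - ?W \<omega>0) =
      norm (iter_pderiv bs (dual_radon (sym_product \<zeta> g)) x - of_real c * ?W \<omega>0) / c"
    using c(2) by (simp only: norm_divide norm_of_real abs_of_pos)
  then show ?thesis using le c(2) by (simp add: pos_divide_le_eq)
qed

end

section \<open>Slices of the Radon transform\<close>

lemma distribution_bound:
  assumes "distribution f" "compact K"
  obtains C N where "\<And>\<phi>. test_function \<phi> \<Longrightarrow> fun_support \<phi> \<subseteq> K \<Longrightarrow> norm (f \<phi>) \<le>
      C * (\<Sum>bs | set bs \<subseteq> Basis \<and> length bs \<le> N. SUP x. norm (iter_pderiv bs \<phi> x))"
  using assms unfolding distribution_def by meson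

lemma fun_support_mult_subset: "fun_support (\<lambda>x. \<phi> x * \<psi> x) \<subseteq> fun_support \<phi>"
  by (intro fun_support_subsetI closed_fun_support) (simp add: not_in_fun_support)

lemma in_uminus_image_iff: "z \<in> uminus ` B \<longleftrightarrow> - z \<in> B" for z :: "'a::group_add"
  by (auto simp: image_iff intro: bexI[of _ "- z"])

text \<open>The symmetrized product lives on a product of balls and on its reflection. The reflected
  half is in \<open>W\<close> because \<open>W\<close> is symmetric.\<close>

lemma sphere_line_support_sym_product:
  fixes \<omega>0 :: "'a::euclidean_space"
  assumes W: "hyperplane_open W" and sub: "sphere_line \<inter> cball \<omega>0 \<delta> \<times> cball p0 \<delta> \<subseteq> W"
    and \<zeta>: "\<And>\<omega>. \<delta> \<le> dist \<omega>0 \<omega> \<Longrightarrow> \<zeta> \<omega> = 0" and g: "fun_support g \<subseteq> cball p0 \<delta>"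
  shows "compact (sphere_line_support (sym_product \<zeta> g))" "sphere_line_support (sym_product \<zeta> g) \<subseteq> W"
proof -
  define B where "B = cball \<omega>0 \<delta> \<times> cball p0 \<delta>"
  define S where "S = (sphere_line :: ('a \<times> real) set) \<inter> (B \<union> uminus ` B)"
  let ?supp = "sphere_line_support (sym_product \<zeta> g)"
  have S: "z \<in> S \<longleftrightarrow> z \<in> sphere_line \<and> (z \<in> B \<or> - z \<in> B)" for z
    by (simp only: S_def Int_iff Un_iff in_uminus_image_iff)
  have cB: "compact B" unfolding B_def by (intro compact_Times compact_cball)
  have "closed (sphere_line :: ('a \<times> real) set)" by (intro closed_Times) auto
  then have cS: "compact S"
    unfolding S_def using cB
    by (intro closed_Int_compact compact_Un compact_continuous_image continuous_intros)
  have in_B: "z \<in> B" if z: "\<zeta> (fst z) \<noteq> 0" "g (snd z) \<noteq> 0" for z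
  proof -
    have "fst z \<in> cball \<omega>0 \<delta>" using \<zeta>[of "fst z"] z(1) by (cases "\<delta> \<le> dist \<omega>0 (fst z)") auto
    moreover have "snd z \<in> cball p0 \<delta>" using g not_in_fun_support[of "snd z" g] z(2) by blast
    ultimately show ?thesis unfolding B_def by (simp only: mem_Times_iff)
  qed
  have "z \<in> S" if z: "z \<in> sphere_line" "sym_product \<zeta> g z \<noteq> 0" for z
  proof -
    have "\<zeta> (fst z) \<noteq> 0 \<and> g (snd z) \<noteq> 0 \<or> \<zeta> (fst (- z)) \<noteq> 0 \<and> g (snd (- z)) \<noteq> 0"
      using z(2) unfolding sym_product_def by auto
    then show ?thesis using z(1) in_B[of z] in_B[of "- z"] unfolding S by argo
  qed
  then have "{z \<in> sphere_line. sym_product \<zeta> g z \<noteq> 0} \<subseteq> S" by blast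
  then have sub1: "?supp \<subseteq> S"
    unfolding sphere_line_support_def using cS by (intro closure_minimal compact_imp_closed)
  have "closed ?supp" by (simp add: sphere_line_support_def)
  then have "compact (S \<inter> ?supp)" by (rule compact_Int_closed[OF cS])
  moreover have "S \<inter> ?supp = ?supp" using sub1 by blast
  ultimately show "compact ?supp" by (simp only:)
  have sub': "z \<in> W" if "z \<in> sphere_line" "z \<in> B" for z
    by (rule subsetD[OF sub]) (use that in \<open>simp only: B_def Int_iff\<close>)
  have "z \<in> W" if "z \<in> S" for z
  proof (cases "z \<in> B")
    case True
    with that show ?thesis unfolding S by (intro sub') simp_all
  next
    case False
    then have z: "- z \<in> B" "z \<in> sphere_line" using that unfolding S by simp_all
    from z(2) have "- z \<in> sphere_line" by (cases z) auto
    then have "- z \<in> W" using z(1) by (rule sub')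
    moreover have "\<forall>z\<in>W. - z \<in> W" using W by (simp add: hyperplane_open_def)
    ultimately have "- (- z) \<in> W" by (rule bspec[rotated])
    then show ?thesis by simp
  qed
  with sub1 show "?supp \<subseteq> W" by blast
qed

text \<open>The hypothesis on \<open>R f\<close> is a distributional one in the direction as well; letting the directional
  factor of the test function concentrate at \<open>\<omega>0\<close> recovers the single slice.\<close>

lemma slice_vanish_local:
  fixes f :: "('a::euclidean_space \<Rightarrow> complex) \<Rightarrow> complex"
  assumes f: "distribution f" and \<eta>: "test_function \<eta>" and \<omega>0: "\<omega>0 \<in> sphere 0 1"
    and W: "hyperplane_open W" "(\<omega>0, p0) \<in> W"
    and null: "\<And>\<phi>. even_smooth \<phi> \<Longrightarrow> compact (sphere_line_support \<phi>) \<Longrightarrow>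
      sphere_line_support \<phi> \<subseteq> W \<Longrightarrow> f (\<lambda>x. \<eta> x * dual_radon \<phi> x) = 0"
  obtains \<delta> where "0 < \<delta>"
    "\<And>g. test_function g \<Longrightarrow> fun_support g \<subseteq> cball p0 \<delta> \<Longrightarrow> f (\<lambda>x. \<eta> x * g (x \<bullet> \<omega>0)) = 0"
proof -
  obtain T where T: "open T" "W = sphere_line \<inter> T"
    using W(1) unfolding hyperplane_open_def openin_open by blast
  have "(\<omega>0, p0) \<in> T" using W(2) unfolding T(2) by (rule IntD2)
  then obtain A B where AB: "open A" "open B" "(\<omega>0, p0) \<in> A \<times> B" "A \<times> B \<subseteq> T"
    by (rule open_prod_elim[OF T(1)])
  then have "\<omega>0 \<in> A" "p0 \<in> B" by simp_all
  obtain d1 where d1: "0 < d1" "cball \<omega>0 d1 \<subseteq> A"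
    using open_contains_cball_eq[OF AB(1)] \<open>\<omega>0 \<in> A\<close> by blast
  obtain d2 where d2: "0 < d2" "cball p0 d2 \<subseteq> B"
    using open_contains_cball_eq[OF AB(2)] \<open>p0 \<in> B\<close> by blast
  define \<delta> where "\<delta> = min d1 d2"
  have \<delta>: "0 < \<delta>" using d1 d2 by (simp add: \<delta>_def)
  have "cball \<omega>0 \<delta> \<times> cball p0 \<delta> \<subseteq> A \<times> B"
    using subset_cball[of \<delta> d1 \<omega>0] subset_cball[of \<delta> d2 p0]
    by (intro Sigma_mono order_trans[OF _ d1(2)] order_trans[OF _ d2(2)]) (auto simp: \<delta>_def)
  then have "cball \<omega>0 \<delta> \<times> cball p0 \<delta> \<subseteq> T" using AB(4) by (rule order_trans)
  then have sub: "sphere_line \<inter> cball \<omega>0 \<delta> \<times> cball p0 \<delta> \<subseteq> W"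
    unfolding T(2) by (intro Int_mono order_refl)
  define K where "K = fun_support \<eta>"
  have K: "compact K" using \<eta> by (simp add: K_def test_function_def)
  have sm\<eta>: "smooth \<eta>" using \<eta> by (simp add: test_function_def)
  obtain C N where CN: "\<And>\<phi>. test_function \<phi> \<Longrightarrow> fun_support \<phi> \<subseteq> K \<Longrightarrow> norm (f \<phi>) \<le>
      C * (\<Sum>bs | set bs \<subseteq> Basis \<and> length bs \<le> N. SUP x. norm (iter_pderiv bs \<phi> x))"
    using distribution_bound[OF f K] by blast
  \<comment> \<open>The directional supports shrink to \<open>\<omega>0\<close> but stay within
    \<open>\<delta>\<close>, so every test function remains admissible for \<open>W\<close>.\<close>
  define r where "r n = \<delta> / real (Suc n)" for n
  have r: "0 < r n" "r n \<le> \<delta>" for n using \<delta> by (simp_all add: r_def field_simps)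
  have r0: "r \<longlonglongrightarrow> 0"
    unfolding r_def using LIMSEQ_Suc[OF lim_const_over_n[of \<delta>]] by simp
  have "\<exists>\<zeta> :: 'a \<Rightarrow> real. smooth \<zeta> \<and> (\<forall>x. 0 \<le> \<zeta> x) \<and> (\<forall>x. dist \<omega>0 x \<le> r n / 2 \<longrightarrow> \<zeta> x = 1)
      \<and> (\<forall>x. r n \<le> dist \<omega>0 x \<longrightarrow> \<zeta> x = 0)" for n
  proof -
    obtain \<kappa> :: "'a \<Rightarrow> real" where "smooth \<kappa>" "\<And>x. 0 \<le> \<kappa> x" "\<And>x. \<kappa> x \<le> 1"
      "\<And>x. dist \<omega>0 x \<le> r n / 2 \<Longrightarrow> \<kappa> x = 1" "\<And>x. r n \<le> dist \<omega>0 x \<Longrightarrow> \<kappa> x = 0"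
      by (rule bump_exists[of "r n / 2" "r n" \<omega>0]) (use r(1)[of n] in auto)
    then show ?thesis by blast
  qed
  then obtain \<zeta> :: "nat \<Rightarrow> 'a \<Rightarrow> real" where \<zeta>: "\<And>n. smooth (\<zeta> n)" "\<And>n x. 0 \<le> \<zeta> n x"
    "\<And>n x. dist \<omega>0 x \<le> r n / 2 \<Longrightarrow> \<zeta> n x = 1" "\<And>n x. r n \<le> dist \<omega>0 x \<Longrightarrow> \<zeta> n x = 0"
    by metis
  \<comment> \<open>The total mass of the symmetrized weight; it is positive because the bump is
    \<open>1\<close> on a cap of positive area.\<close>
  define c where "c n = (LINT \<omega>|sphere_area. \<zeta> n \<omega> + \<zeta> n (- \<omega>))" for n
  have c: "0 < c n" for n
  proof -
    interpret finite_measure "sphere_area :: 'a measure" by (rule finite_measure_sphere_area)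
    let ?A = "sphere 0 1 \<inter> ball \<omega>0 (r n / 2)"
    have A: "?A \<in> sets sphere_area"
      unfolding sets_sphere_area by (auto simp: sets_restrict_space)
    have "0 < measure sphere_area ?A"
      using \<omega>0 r(1)[of n] by (intro sphere_area_ball_pos) auto
    also have "\<dots> = (LINT \<omega>|sphere_area. indicator ?A \<omega>)" using A by simp
    also have "\<dots> \<le> c n"
      unfolding c_def
    proof (rule Bochner_Integration.integral_mono)
      show "integrable sphere_area (indicator ?A :: 'a \<Rightarrow> real)"
        using A by (simp add: emeasure_eq_measure)
      show "integrable sphere_area (\<lambda>\<omega>. \<zeta> n \<omega> + \<zeta> n (- \<omega>))"
        by (intro integrable_sphere_area continuous_on_add smooth_continuous_on[OF \<zeta>(1)]
            smooth_continuous_on[OF smooth_compose[OF \<zeta>(1) smooth_minus[OF smooth_id]]])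
      show "indicator ?A \<omega> \<le> \<zeta> n \<omega> + \<zeta> n (- \<omega>)" for \<omega>
        using \<zeta>(2)[of n \<omega>] \<zeta>(2)[of n "- \<omega>"] \<zeta>(3)[of \<omega> n] by (auto simp: indicator_def)
    qed
    finally show ?thesis .
  qed
  show ?thesis
  proof (rule that[OF \<delta>])
    fix g :: "real \<Rightarrow> complex" assume g: "test_function g" "fun_support g \<subseteq> cball p0 \<delta>"
    then have smg: "smooth g" by (simp add: test_function_def)
    let ?R = "\<lambda>n. dual_radon (sym_product (\<zeta> n) g)"
    \<comment> \<open>The dual Radon part of \<open>H\<close> is annihilated after multiplication by
      \<open>\<eta>\<close>, so the pairing of \<open>f\<close> with \<open>\<eta> * H n\<close> is
      minus the slice for every \<open>n\<close>. It is therefore enough that \<open>H\<close> tends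
      to zero with its derivatives.\<close>
    define H where "H n x = ?R n x * of_real (1 / c n) - g (x \<bullet> \<omega>0)" for n x
    have smR: "smooth (?R n)" for n by (rule dual_radon_sym_product_smooth(1)[OF smg \<zeta>(1)])
    have smRc: "smooth (\<lambda>x. ?R n x * of_real (1 / c n))" for n
      by (intro smooth_mult smooth_const smR)
    have smH: "smooth (H n)" for n
      unfolding H_def[abs_def] by (intro smooth_diff smRc smooth_plane_wave smg)
    have R0: "f (\<lambda>x. \<eta> x * ?R n x) = 0" for n
    proof (rule null)
      show "even_smooth (sym_product (\<zeta> n) g)" by (rule even_smooth_sym_product[OF \<zeta>(1) smg])
      have "\<zeta> n \<omega> = 0" if "\<delta> \<le> dist \<omega>0 \<omega>" for \<omega>
        using that r(2)[of n] by (intro \<zeta>(4)) simp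
      then show "compact (sphere_line_support (sym_product (\<zeta> n) g))"
        "sphere_line_support (sym_product (\<zeta> n) g) \<subseteq> W"
        using sphere_line_support_sym_product[OF W(1) sub _ g(2)] by blast+
    qed
    have "cnull N K H"
      unfolding cnull_iff
    proof (intro allI impI)
      fix bs :: "'a list" assume "set bs \<subseteq> Basis \<and> length bs \<le> N"
      then have bs: "set bs \<subseteq> Basis" by blast
      let ?F = "\<lambda>z :: 'a \<times> 'a. iter_pderiv bs (\<lambda>x. g (x \<bullet> fst z)) (snd z)"
      have e1: "iter_pderiv bs (\<lambda>x. ?R n x * of_real (1 / c n)) =
          (\<lambda>x. iter_pderiv bs (?R n) x * of_real (1 / c n))" for n
        by (rule iter_pderiv_linear_comp[OF bounded_linear_mult_left smR bs])
      have e2: "iter_pderiv bs (H n) = (\<lambda>x. iter_pderiv bs (\<lambda>x. ?R n x * of_real (1 / c n)) x -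
          iter_pderiv bs (\<lambda>x. g (x \<bullet> \<omega>0)) x)" for n
        unfolding H_def[abs_def] by (rule iter_pderiv_diff[OF smRc smooth_plane_wave[OF smg] bs])
      have eq: "iter_pderiv bs (H n) x =
          iter_pderiv bs (?R n) x / of_real (c n) - iter_pderiv bs (\<lambda>x. g (x \<bullet> \<omega>0)) x" for n x
        unfolding e2 e1 by (simp only: of_real_divide of_real_1 times_divide_eq_right mult_1_right)
      show "uniform_limit K (\<lambda>n. iter_pderiv bs (H n)) (\<lambda>x. 0) sequentially"
      proof (rule uniform_limitI)
        fix e :: real assume e: "0 < e"
        have "uniformly_continuous_on (sphere 0 1 \<times> K) ?F"
          by (rule compact_uniformly_continuous[OF continuous_on_plane_wave_derivative[OF smg]
                compact_Times[OF compact_sphere K]])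
        then obtain d where d: "0 < d" "\<And>z z'. z \<in> sphere 0 1 \<times> K \<Longrightarrow> z' \<in> sphere 0 1 \<times> K \<Longrightarrow>
            dist z' z < d \<Longrightarrow> dist (?F z') (?F z) < e / 2"
          unfolding uniformly_continuous_on_def using half_gt_zero[OF e] by blast
        have "\<forall>\<^sub>F n in sequentially. r n < d" using r0 d(1) by (rule order_tendstoD)
        then show "\<forall>\<^sub>F n in sequentially. \<forall>x\<in>K. dist (iter_pderiv bs (H n) x) 0 < e"
        proof (rule eventually_mono)
          fix n assume n: "r n < d"
          have "norm (iter_pderiv bs (H n) x) \<le> e / 2" if x: "x \<in> K" for x
            unfolding eq
          proof (rule dual_radon_concentration[OF smg \<zeta>(1) \<zeta>(2) _ bs c_def c])
            fix \<omega> :: 'a assume \<omega>: "\<omega> \<in> sphere 0 1" "\<zeta> n \<omega> \<noteq> 0"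
            then have "dist \<omega> \<omega>0 < d" using \<zeta>(4)[of n \<omega>] n by (force simp: dist_commute)
            then show "norm (iter_pderiv bs (\<lambda>x. g (x \<bullet> \<omega>)) x - iter_pderiv bs (\<lambda>x. g (x \<bullet> \<omega>0)) x) \<le> e / 2"
              using d(2)[of "(\<omega>0, x)" "(\<omega>, x)"] \<omega>(1) \<omega>0 x by (simp add: dist_Pair_Pair dist_norm)
          qed
          then show "\<forall>x\<in>K. dist (iter_pderiv bs (H n) x) 0 < e" using e by force
        qed
      qed
    qed
    then have "cnull N K (\<lambda>n x. \<eta> x * H n x)"
      by (rule cnull_mult[OF K sm\<eta> smH])
    moreover have tH: "test_function (\<lambda>x. \<eta> x * H n x)" for n
      by (rule test_function_mult(1)[OF \<eta> smH])
    ultimately have "(\<lambda>n. f (\<lambda>x. \<eta> x * H n x)) \<longlonglongrightarrow> 0"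
      using CN by (intro distribution_tendsto_0[of K f C N]) (auto simp: K_def fun_support_mult_subset)
    moreover have "f (\<lambda>x. \<eta> x * H n x) = - f (\<lambda>x. \<eta> x * g (x \<bullet> \<omega>0))" for n
    proof -
      have t1: "test_function (\<lambda>x. \<eta> x * ?R n x)" by (rule test_function_mult(1)[OF \<eta> smR])
      have t2: "test_function (\<lambda>x. \<eta> x * g (x \<bullet> \<omega>0))"
        by (rule test_function_mult(1)[OF \<eta> smooth_plane_wave[OF smg]])
      have "f (\<lambda>x. \<eta> x * H n x) =
          f (\<lambda>x. of_real (1 / c n) * (\<eta> x * ?R n x) + (- 1) * (\<eta> x * g (x \<bullet> \<omega>0)))"
        by (rule arg_cong[where f = f]) (simp add: H_def algebra_simps)
      also have "\<dots> = f (\<lambda>x. of_real (1 / c n) * (\<eta> x * ?R n x)) + f (\<lambda>x. (- 1) * (\<eta> x * g (x \<bullet> \<omega>0)))"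
        by (intro distribution_add[OF f] test_function_mult(2) t1 t2 smooth_const)
      also have "\<dots> = - f (\<lambda>x. \<eta> x * g (x \<bullet> \<omega>0))"
        by (simp only: distribution_scale[OF f t1] distribution_scale[OF f t2] R0) simp
      finally show ?thesis .
    qed
    ultimately have "(\<lambda>n :: nat. - f (\<lambda>x. \<eta> x * g (x \<bullet> \<omega>0))) \<longlonglongrightarrow> 0" by simp
    then show "f (\<lambda>x. \<eta> x * g (x \<bullet> \<omega>0)) = 0"
      by (simp only: LIMSEQ_const_iff neg_equal_0_iff_equal)
  qed
qed

text \<open>On the support of \<open>\<eta>\<close> the values \<open>x \<bullet> \<omega>0\<close>
  stay in a bounded interval, so \<open>g\<close> may be cut off there and becomes a test function
  on the line. The slice functional vanishes near every point outside \<open>P\<close>, and the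
  support of the cut-off \<open>g\<close> avoids \<open>P\<close>.\<close>

lemma slice_vanish:
  fixes f :: "('a::euclidean_space \<Rightarrow> complex) \<Rightarrow> complex"
  assumes f: "distribution f" and \<eta>: "test_function \<eta>" and \<omega>0: "\<omega>0 \<in> sphere 0 1"
    and W: "\<And>p. p \<notin> P \<Longrightarrow> \<exists>W. hyperplane_open W \<and> (\<omega>0, p) \<in> W \<and>
      (\<forall>\<phi>. even_smooth \<phi> \<longrightarrow> compact (sphere_line_support \<phi>) \<longrightarrow>
      sphere_line_support \<phi> \<subseteq> W \<longrightarrow> f (\<lambda>x. \<eta> x * dual_radon \<phi> x) = 0)"
    and g: "smooth g" and V: "open V" "P \<subseteq> V" "\<And>p. p \<in> V \<Longrightarrow> g p = 0"
  shows "f (\<lambda>x. \<eta> x * g (x \<bullet> \<omega>0)) = 0"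
proof -
  have "bounded (fun_support \<eta>)" using \<eta> by (simp add: test_function_def compact_imp_bounded)
  then obtain R where R: "\<And>x. x \<in> fun_support \<eta> \<Longrightarrow> norm x \<le> R"
    unfolding bounded_iff by blast
  obtain \<theta> where \<theta>: "cutoff (cball (0::real) R) \<theta>" using cutoff_exists[of "cball (0::real) R"] by auto
  then have \<theta>1: "\<theta> p = 1" if "\<bar>p\<bar> \<le> R" for p
    using that unfolding cutoff_def by (auto simp: subset_iff)
  have t: "test_function (\<lambda>p. \<theta> p * g p)"
    using \<theta> g by (intro test_function_mult(1)) (auto simp: cutoff_def)
  have eq: "(\<lambda>x. \<eta> x * g (x \<bullet> \<omega>0)) = (\<lambda>x. \<eta> x * (\<theta> (x \<bullet> \<omega>0) * g (x \<bullet> \<omega>0)))"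
  proof
    fix x
    show "\<eta> x * g (x \<bullet> \<omega>0) = \<eta> x * (\<theta> (x \<bullet> \<omega>0) * g (x \<bullet> \<omega>0))"
    proof (cases "x \<in> fun_support \<eta>")
      case True
      then have "\<bar>x \<bullet> \<omega>0\<bar> \<le> R"
        using R[OF True] Cauchy_Schwarz_ineq2[of x \<omega>0] \<omega>0 by simp
      then show ?thesis using \<theta>1 by simp
    qed (simp add: not_in_fun_support)
  qed
  define u where "u h = f (\<lambda>x. \<eta> x * h (x \<bullet> \<omega>0))" for h :: "real \<Rightarrow> complex"
  have "u (\<lambda>p. \<theta> p * g p) = 0"
  proof (rule additive_vanish_of_local[OF _ t])
    fix h k :: "real \<Rightarrow> complex" assume "test_function h" "test_function k"
    then have "smooth h" "smooth k" by (auto simp: test_function_def)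
    then show "u (\<lambda>x. h x + k x) = u h + u k"
      unfolding u_def distrib_left
      by (intro distribution_add[OF f] test_function_mult(1)[OF \<eta>] smooth_plane_wave)
  next
    fix p assume p: "p \<in> fun_support (\<lambda>p. \<theta> p * g p)"
    have "fun_support (\<lambda>p. \<theta> p * g p) \<subseteq> - V"
      using V by (intro fun_support_subsetI) auto
    then have "p \<notin> P" using p V(2) by blast
    then obtain W where W': "hyperplane_open W" "(\<omega>0, p) \<in> W"
      "\<And>\<phi>. even_smooth \<phi> \<Longrightarrow> compact (sphere_line_support \<phi>) \<Longrightarrow>
        sphere_line_support \<phi> \<subseteq> W \<Longrightarrow> f (\<lambda>x. \<eta> x * dual_radon \<phi> x) = 0"
      using W by metis
    obtain \<delta> where \<delta>: "0 < \<delta>"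
      "\<And>g. test_function g \<Longrightarrow> fun_support g \<subseteq> cball p \<delta> \<Longrightarrow> f (\<lambda>x. \<eta> x * g (x \<bullet> \<omega>0)) = 0"
      by (rule slice_vanish_local[OF f \<eta> \<omega>0 W'(1,2) W'(3)]) (assumption+, rule that)
    show "\<exists>U. open U \<and> p \<in> U \<and> (\<forall>\<psi>. test_function \<psi> \<longrightarrow> fun_support \<psi> \<subseteq> U \<longrightarrow> u \<psi> = 0)"
    proof (intro exI[of _ "ball p \<delta>"] conjI allI impI)
      fix \<psi> assume "test_function \<psi>" "fun_support \<psi> \<subseteq> ball p \<delta>"
      then show "u \<psi> = 0"
        unfolding u_def using ball_subset_cball[of p \<delta>] by (intro \<delta>(2)) (auto intro: order_trans)
    qed (use \<delta>(1) in auto)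
  qed
  then show ?thesis unfolding u_def eq .
qed

text \<open>With \<open>\<epsilon> = 1 / (i + 1)\<close> the derivative of order
  \<open>j \<le> N\<close> of \<open>\<epsilon> ^ (N + 1) * A (s / \<epsilon>)\<close> carries the
  factor \<open>\<epsilon> ^ (N + 1 - j)\<close>, which is at most
  \<open>\<epsilon>\<close>.\<close>

lemma cnull_scaled_flat:
  fixes A :: "real \<Rightarrow> complex"
  assumes A: "test_function A"
  shows "cnull N UNIV (\<lambda>i s. of_real ((1 / real (Suc i)) ^ Suc N) * A (s * real (Suc i)))"
  unfolding cnull_iff
proof (intro allI impI)
  fix bs :: "real list" assume "set bs \<subseteq> Basis \<and> length bs \<le> N"
  then have bs: "set bs \<subseteq> Basis" and len: "length bs \<le> N" by auto
  have smA: "smooth A" using A by (simp add: test_function_def)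
  have "bounded (nderiv (length bs) A ` fun_support A)"
    using A by (intro compact_imp_bounded compact_continuous_image
        smooth_continuous_on[OF smooth_nderiv[OF smA]]) (simp add: test_function_def)
  then obtain B where "\<And>s. s \<in> fun_support A \<Longrightarrow> norm (nderiv (length bs) A s) \<le> B"
    unfolding bounded_iff by blast
  then have B: "norm (nderiv (length bs) A s) \<le> max B 0" for s
    unfolding nderiv_def by (cases "s \<in> fun_support A") (auto simp: iter_pderiv_outside_support le_max_iff_disj)
  have prod: "(\<Prod>b\<leftarrow>bs. b \<bullet> c) = c ^ length bs" for c
    using bs by (induction bs) auto
  have le: "norm (iter_pderiv bs (\<lambda>s. of_real ((1 / real (Suc i)) ^ Suc N) * A (s * real (Suc i))) s)
      \<le> max B 0 / real (Suc i)" for i s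
  proof -
    let ?c = "real (Suc i)"
    have "iter_pderiv bs (\<lambda>s. of_real ((1 / ?c) ^ Suc N) * A (s \<bullet> ?c)) =
        (\<lambda>s. of_real ((1 / ?c) ^ Suc N) * iter_pderiv bs (\<lambda>s. A (s \<bullet> ?c)) s)"
      by (rule iter_pderiv_linear_comp[OF bounded_linear_mult_right smooth_plane_wave[OF smA] bs])
    also have "\<dots> = (\<lambda>s. of_real ((1 / ?c) ^ Suc N) * (of_real (?c ^ length bs) *
        nderiv (length bs) A (s \<bullet> ?c)))"
      unfolding iter_pderiv_plane_wave[OF smA] prod ..
    finally have eq: "iter_pderiv bs (\<lambda>s. of_real ((1 / ?c) ^ Suc N) * A (s * ?c)) s =
        of_real ((1 / ?c) ^ Suc N * ?c ^ length bs) * nderiv (length bs) A (s * ?c)"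
      by (simp add: mult.assoc del: of_nat_Suc power_Suc)
    have "(1 / ?c) ^ Suc N * ?c ^ length bs \<le> (1 / ?c) ^ Suc N * ?c ^ N"
      using len by (intro mult_left_mono power_increasing) auto
    also have "\<dots> = 1 / ?c" by (simp add: power_divide del: of_nat_Suc)
    finally have "\<bar>(1 / ?c) ^ Suc N * ?c ^ length bs\<bar> \<le> 1 / ?c" by (simp del: of_nat_Suc power_Suc)
    then have "\<bar>(1 / ?c) ^ Suc N * ?c ^ length bs\<bar> * norm (nderiv (length bs) A (s * ?c)) \<le> 1 / ?c * max B 0"
      using B by (intro mult_mono) auto
    then show ?thesis unfolding eq norm_mult norm_of_real by simp
  qed
  show "uniform_limit UNIV (\<lambda>i. iter_pderiv bs (\<lambda>s. of_real ((1 / real (Suc i)) ^ Suc N) * A (s * real (Suc i))))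
      (\<lambda>s. 0) sequentially"
  proof (rule uniform_limitI)
    fix e :: real assume "0 < e"
    have "(\<lambda>i. max B 0 / real (Suc i)) \<longlonglongrightarrow> 0"
      using LIMSEQ_Suc[OF lim_const_over_n[of "max B 0"]] by simp
    then have "\<forall>\<^sub>F i in sequentially. max B 0 / real (Suc i) < e"
      using \<open>0 < e\<close> by (rule order_tendstoD)
    then show "\<forall>\<^sub>F i in sequentially. \<forall>s\<in>UNIV. dist (iter_pderiv bs
        (\<lambda>s. of_real ((1 / real (Suc i)) ^ Suc N) * A (s * real (Suc i))) s) 0 < e"
      by (rule eventually_mono) (use le in \<open>auto intro: le_less_trans\<close>)
  qed
qed

text \<open>Multiplying by the power \<open>N + 1\<close> of a function vanishing on the support kills a distribution
  of order \<open>N\<close> on the line.\<close>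

lemma slice_annihilated:
  fixes f :: "('a::euclidean_space \<Rightarrow> complex) \<Rightarrow> complex"
  assumes f: "distribution f" and \<eta>: "test_function \<eta>"
    and bound: "\<And>\<phi>. test_function \<phi> \<Longrightarrow> fun_support \<phi> \<subseteq> fun_support \<eta> \<Longrightarrow> norm (f \<phi>) \<le>
      C * (\<Sum>bs | set bs \<subseteq> Basis \<and> length bs \<le> N. SUP x. norm (iter_pderiv bs \<phi> x))"
    and van: "\<And>g V. smooth g \<Longrightarrow> open V \<Longrightarrow> {r, - r} \<subseteq> V \<Longrightarrow> (\<And>p. p \<in> V \<Longrightarrow> g p = 0) \<Longrightarrow>
      f (\<lambda>x. \<eta> x * g (x \<bullet> \<omega>)) = 0"
  shows "f (\<lambda>x. \<eta> x * of_real (((x \<bullet> \<omega>)\<^sup>2 - r\<^sup>2) ^ Suc N * (x \<bullet> \<omega>) ^ k)) = 0"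
proof -
  obtain \<kappa> :: "real \<Rightarrow> real" where \<kappa>: "smooth \<kappa>" "\<And>x. 0 \<le> \<kappa> x" "\<And>x. \<kappa> x \<le> 1"
    "\<And>x. dist 0 x \<le> 1 \<Longrightarrow> \<kappa> x = 1" "\<And>x. 2 \<le> dist 0 x \<Longrightarrow> \<kappa> x = 0"
    by (rule bump_exists[of 1 2 "0 :: real"]) (simp, simp, rule that)
  define A where "A s = complex_of_real (s ^ Suc N * \<kappa> s)" for s
  have smA: "smooth A"
    unfolding A_def[abs_def] by (intro smooth_of_real smooth_mult smooth_power smooth_id \<kappa>(1))
  have tA: "test_function A"
    using smA by (rule test_functionI[of _ "cball 0 2"]) (auto simp: A_def \<kappa>(5))
  \<comment> \<open>This is \<open>s ^ (N + 1)\<close> cut off to the range where \<open>s\<close>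
    is of size \<open>1 / (i + 1)\<close>; the prefactor cancels the rescaling of the power.\<close>
  define Ai where "Ai i s = of_real ((1 / real (Suc i)) ^ Suc N) * A (s * real (Suc i))" for i s
  have Ai: "Ai i s = of_real (s ^ Suc N * \<kappa> (s * real (Suc i)))" for i s
    by (simp add: Ai_def A_def power_mult_distrib power_divide field_simps del: of_nat_Suc)
  have smAi: "smooth (Ai i)" for i
    unfolding Ai_def[abs_def]
    by (rule smooth_mult[OF smooth_const
          smooth_plane_wave[OF smA, of "real (Suc i)", unfolded inner_real_def]])
  have nullA: "cnull N UNIV Ai"
    unfolding Ai_def[abs_def] by (rule cnull_scaled_flat[OF tA])
  have K: "compact (fun_support \<eta>)" and sm\<eta>: "smooth \<eta>" using \<eta> by (auto simp: test_function_def)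
  \<comment> \<open>A single argument that vanishes at both points \<open>r\<close> and
    \<open>- r\<close>, so that one cutoff handles them together.\<close>
  define h where "h x = (x \<bullet> \<omega>)\<^sup>2 - r\<^sup>2" for x
  have smi: "smooth (\<lambda>x. x \<bullet> \<omega>)" by (rule smooth_linear[OF bounded_linear_inner_left])
  have smh: "smooth h"
    unfolding h_def[abs_def] by (intro smooth_diff smooth_power smi smooth_const)
  let ?w = "\<lambda>x. \<eta> x * of_real ((x \<bullet> \<omega>) ^ k)"
  have tw: "test_function ?w"
    by (intro test_function_mult(1)[OF \<eta>] smooth_of_real smooth_power smi)
  then have smw: "smooth ?w" by (simp add: test_function_def)
  have smAh: "smooth (\<lambda>x. Ai i (h x))" for i by (rule smooth_compose[OF smAi smh])
  have "cnull N (fun_support \<eta>) (\<lambda>i x. ?w x * Ai i (h x))"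
    by (rule cnull_mult[OF K smw smAh cnull_compose[OF K smh smAi nullA]])
  moreover have tF: "test_function (\<lambda>x. ?w x * Ai i (h x))" for i
    by (rule test_function_mult(1)[OF tw smAh])
  moreover have "fun_support (\<lambda>x. ?w x * Ai i (h x)) \<subseteq> fun_support \<eta>" for i
    by (rule order_trans[OF fun_support_mult_subset fun_support_mult_subset])
  ultimately have "(\<lambda>i. f (\<lambda>x. ?w x * Ai i (h x))) \<longlonglongrightarrow> 0"
    using bound by (intro distribution_tendsto_0[of "fun_support \<eta>" f C N]) auto
  \<comment> \<open>The discarded part has the factor \<open>1 - \<kappa>\<close>, which vanishes
    near both points, so \<open>van\<close> removes it. Hence the value does not depend on
    \<open>i\<close> and equals its limit zero.\<close>
  moreover have "f (\<lambda>x. ?w x * Ai i (h x)) = f (\<lambda>x. \<eta> x * of_real (h x ^ Suc N * (x \<bullet> \<omega>) ^ k))" for i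
  proof -
    let ?g = "\<lambda>p. complex_of_real ((p\<^sup>2 - r\<^sup>2) ^ Suc N * (1 - \<kappa> ((p\<^sup>2 - r\<^sup>2) * real (Suc i))) * p ^ k)"
    have smq: "smooth (\<lambda>p :: real. (p\<^sup>2 - r\<^sup>2) * real (Suc i))"
      by (intro smooth_mult smooth_diff smooth_power smooth_id smooth_const)
    have smg: "smooth ?g"
      by (intro smooth_of_real smooth_mult smooth_diff smooth_power smooth_id smooth_const
          smooth_compose[OF \<kappa>(1) smq])
    have g0: "f (\<lambda>x. \<eta> x * ?g (x \<bullet> \<omega>)) = 0"
    proof (rule van[OF smg])
      show "open {p. \<bar>(p\<^sup>2 - r\<^sup>2) * real (Suc i)\<bar> < 1}"
        by (intro open_Collect_less continuous_intros)
      show "?g p = 0" if "p \<in> {p. \<bar>(p\<^sup>2 - r\<^sup>2) * real (Suc i)\<bar> < 1}" for p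
        using that \<kappa>(4)[of "(p\<^sup>2 - r\<^sup>2) * real (Suc i)"] by simp
    qed auto
    have tg: "test_function (\<lambda>x. \<eta> x * ?g (x \<bullet> \<omega>))"
      by (rule test_function_mult(1)[OF \<eta> smooth_plane_wave[OF smg]])
    have split: "a * b = b * (a * c) + a * (1 - c) * b" for a b c :: real
      by (simp add: algebra_simps)
    have "(\<lambda>x. \<eta> x * of_real (h x ^ Suc N * (x \<bullet> \<omega>) ^ k)) =
        (\<lambda>x. ?w x * Ai i (h x) + \<eta> x * ?g (x \<bullet> \<omega>))"
      unfolding Ai h_def
      by (rule ext) (subst split[where c = "\<kappa> (((x \<bullet> \<omega>)\<^sup>2 - r\<^sup>2) * real (Suc i))" for x],
          simp only: of_real_add of_real_mult distrib_left mult.assoc)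
    then show ?thesis using distribution_add[OF f tF tg] g0 by simp
  qed
  ultimately have "(\<lambda>i :: nat. f (\<lambda>x. \<eta> x * of_real (h x ^ Suc N * (x \<bullet> \<omega>) ^ k))) \<longlonglongrightarrow> 0" by simp
  then show ?thesis by (simp only: LIMSEQ_const_iff h_def)
qed

section \<open>Density of polynomials\<close>

lemma distribution_zero: "distribution f \<Longrightarrow> f (\<lambda>x. 0) = 0"
  using distribution_scale[of f "\<lambda>x. 0" 0] test_functionI[of "\<lambda>x. 0" "{}"] by (simp add: smooth_const)

lemma distribution_sum:
  fixes f :: "('a::euclidean_space \<Rightarrow> complex) \<Rightarrow> complex"
  assumes f: "distribution f" and "finite I" "\<And>i. i \<in> I \<Longrightarrow> test_function (\<phi> i)"
  shows "f (\<lambda>x. \<Sum>i\<in>I. c i * \<phi> i x) = (\<Sum>i\<in>I. c i * f (\<phi> i)) \<and> test_function (\<lambda>x. \<Sum>i\<in>I. c i * \<phi> i x)"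
  using assms(2,3)
proof (induction I)
  case empty
  show ?case
    using distribution_zero[OF f] test_functionI[of "\<lambda>x. 0" "{}"] by (simp add: smooth_const)
next
  case (insert i I)
  have t: "test_function (\<phi> i)" "test_function (\<lambda>x. c i * \<phi> i x)"
    using insert.prems by (auto intro: test_function_mult(2) smooth_const)
  have IH: "f (\<lambda>x. \<Sum>i\<in>I. c i * \<phi> i x) = (\<Sum>i\<in>I. c i * f (\<phi> i))"
    "test_function (\<lambda>x. \<Sum>i\<in>I. c i * \<phi> i x)"
    using insert by auto
  show ?case
    unfolding sum.insert[OF insert.hyps] distribution_add[OF f t(2) IH(2)] distribution_scale[OF f t(1)] IH(1)
    using test_function_add[OF t(2) IH(2)] by simp
qed

text \<open>The weight \<open>m\<close> is carried along for the induction on polynomials: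
  multiplying it by further polynomials must preserve the vanishing of all moments.\<close>

definition moment_null ::
  "(('a::euclidean_space \<Rightarrow> complex) \<Rightarrow> complex) \<Rightarrow> ('a \<Rightarrow> complex) \<Rightarrow> ('a \<Rightarrow> real) \<Rightarrow> bool" where
  "moment_null f \<eta> m \<longleftrightarrow> smooth m \<and>
     (\<forall>\<xi> k. f (\<lambda>x. \<eta> x * of_real ((x \<bullet> \<xi>) ^ k * m x)) = 0)"

lemma smooth_inner_left: "smooth (\<lambda>x. x \<bullet> \<xi>)"
  by (rule smooth_linear[OF bounded_linear_inner_left])

lemma moment_expansion:
  fixes f :: "('a::euclidean_space \<Rightarrow> complex) \<Rightarrow> complex"
  assumes f: "distribution f" and \<eta>: "test_function \<eta>" and m: "smooth m"
  shows "f (\<lambda>x. \<eta> x * of_real ((x \<bullet> (\<xi> + t *\<^sub>R \<zeta>)) ^ k * m x)) =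
    (\<Sum>j\<le>k. (of_nat (k choose j) * f (\<lambda>x. \<eta> x * of_real ((x \<bullet> \<zeta>) ^ j * (x \<bullet> \<xi>) ^ (k - j) * m x)))
      * of_real t ^ j)"
proof -
  let ?\<phi> = "\<lambda>j x. \<eta> x * of_real ((x \<bullet> \<zeta>) ^ j * (x \<bullet> \<xi>) ^ (k - j) * m x)"
  have t: "test_function (?\<phi> j)" for j
    by (intro test_function_mult(1)[OF \<eta>] smooth_of_real smooth_mult smooth_power smooth_inner_left m)
  have "(\<lambda>x. \<eta> x * of_real ((x \<bullet> (\<xi> + t *\<^sub>R \<zeta>)) ^ k * m x)) =
      (\<lambda>x. \<Sum>j\<le>k. (of_nat (k choose j) * of_real t ^ j) * ?\<phi> j x)"
  proof
    fix x
    have "(x \<bullet> (\<xi> + t *\<^sub>R \<zeta>)) ^ k = (t * (x \<bullet> \<zeta>) + x \<bullet> \<xi>) ^ k"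
      by (simp add: inner_add_right add.commute)
    also have "\<dots> = (\<Sum>j\<le>k. of_nat (k choose j) * (t * (x \<bullet> \<zeta>)) ^ j * (x \<bullet> \<xi>) ^ (k - j))"
      by (rule binomial_ring)
    finally have "\<eta> x * of_real ((x \<bullet> (\<xi> + t *\<^sub>R \<zeta>)) ^ k * m x) =
        (\<Sum>j\<le>k. \<eta> x * of_real (of_nat (k choose j) * (t * (x \<bullet> \<zeta>)) ^ j * (x \<bullet> \<xi>) ^ (k - j) * m x))"
      by (simp only: sum_distrib_right of_real_sum sum_distrib_left)
    also have "\<dots> = (\<Sum>j\<le>k. (of_nat (k choose j) * of_real t ^ j) * ?\<phi> j x)"
      by (intro sum.cong refl) (simp add: power_mult_distrib)
    finally show "\<eta> x * of_real ((x \<bullet> (\<xi> + t *\<^sub>R \<zeta>)) ^ k * m x) =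
        (\<Sum>j\<le>k. (of_nat (k choose j) * of_real t ^ j) * ?\<phi> j x)" .
  qed
  then have "f (\<lambda>x. \<eta> x * of_real ((x \<bullet> (\<xi> + t *\<^sub>R \<zeta>)) ^ k * m x)) =
      (\<Sum>j\<le>k. (of_nat (k choose j) * of_real t ^ j) * f (?\<phi> j))"
    using distribution_sum[OF f, of "{..k}" ?\<phi> "\<lambda>j. of_nat (k choose j) * of_real t ^ j"] t
    by (simp only: finite_atMost)
  then show ?thesis by (simp only: mult.assoc mult.commute[of "of_real t ^ _"])
qed

text \<open>Polarization: the moments of degree \<open>k + 1\<close> in the directions
  \<open>\<xi> + t b\<close> form a polynomial in \<open>t\<close> that vanishes for all real
  \<open>t\<close>. Its coefficient at \<open>t\<close> is \<open>k + 1\<close> times the moment of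
  degree \<open>k\<close> with weight \<open>(x \<bullet> b) * m x\<close>.\<close>

lemma moment_null_inner:
  fixes f :: "('a::euclidean_space \<Rightarrow> complex) \<Rightarrow> complex"
  assumes f: "distribution f" and \<eta>: "test_function \<eta>" and m: "moment_null f \<eta> m"
  shows "moment_null f \<eta> (\<lambda>x. (x \<bullet> b) * m x)"
proof -
  have sm: "smooth m" using m by (simp add: moment_null_def)
  have "f (\<lambda>x. \<eta> x * of_real ((x \<bullet> \<xi>) ^ k * ((x \<bullet> b) * m x))) = 0" for \<xi> k
  proof -
    define c where "c j = of_nat (Suc k choose j) *
      f (\<lambda>x. \<eta> x * of_real ((x \<bullet> b) ^ j * (x \<bullet> \<xi>) ^ (Suc k - j) * m x))" for j
    have zero: "(\<Sum>j\<le>Suc k. c j * of_real t ^ j) = 0" for t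
      using moment_expansion[OF f \<eta> sm, of \<xi> t b "Suc k"] m unfolding c_def moment_null_def by metis
    have "c 1 = 0"
    proof (rule ccontr)
      assume "c 1 \<noteq> 0"
      then have "finite {z. (\<Sum>j\<le>Suc k. c j * z ^ j) = 0}"
        unfolding polyfun_finite_roots by (intro exI[of _ 1]) simp
      moreover have "range complex_of_real \<subseteq> {z. (\<Sum>j\<le>Suc k. c j * z ^ j) = 0}"
        using zero by blast
      ultimately have "finite (range complex_of_real)" by (rule rev_finite_subset)
      then show False using finite_imageD[OF _ inj_of_real] infinite_UNIV_char_0 by blast
    qed
    then have "f (\<lambda>x. \<eta> x * of_real ((x \<bullet> b) ^ 1 * (x \<bullet> \<xi>) ^ (Suc k - 1) * m x)) = 0"
      by (simp add: c_def del: of_nat_Suc)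
    then show ?thesis by (simp add: mult_ac)
  qed
  then show ?thesis unfolding moment_null_def
    using smooth_mult[OF smooth_inner_left sm] by blast
qed

lemma moment_null_polynomial_mult:
  fixes f :: "('a::euclidean_space \<Rightarrow> complex) \<Rightarrow> complex"
  assumes f: "distribution f" and \<eta>: "test_function \<eta>" and p: "real_polynomial_function p"
  shows "moment_null f \<eta> m \<Longrightarrow> moment_null f \<eta> (\<lambda>x. p x * m x)"
  using p
proof (induction p arbitrary: m rule: real_polynomial_function.induct)
  case (linear L)
  have "L x = x \<bullet> adjoint L 1" for x
    using adjoint_works[OF bounded_linear.linear[OF linear.hyps], of x 1] by simp
  then show ?case using moment_null_inner[OF f \<eta> linear.prems, of "adjoint L 1"] by (simp only:)
next
  case (const c)
  have sm: "smooth m" using const by (simp add: moment_null_def)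
  have "f (\<lambda>x. \<eta> x * of_real ((x \<bullet> \<xi>) ^ k * (c * m x))) =
      of_real c * f (\<lambda>x. \<eta> x * of_real ((x \<bullet> \<xi>) ^ k * m x))" for \<xi> k
  proof -
    have "test_function (\<lambda>x. \<eta> x * of_real ((x \<bullet> \<xi>) ^ k * m x))"
      by (intro test_function_mult(1)[OF \<eta>] smooth_of_real smooth_mult smooth_power smooth_inner_left sm)
    from distribution_scale[OF f this, of "of_real c"] show ?thesis by (simp add: mult_ac)
  qed
  then show ?case using const smooth_mult[OF smooth_const sm] by (simp add: moment_null_def)
next
  case (add p q)
  have p: "moment_null f \<eta> (\<lambda>x. p x * m x)" and q: "moment_null f \<eta> (\<lambda>x. q x * m x)"
    using add by blast+
  then have sm: "smooth (\<lambda>x. p x * m x)" "smooth (\<lambda>x. q x * m x)" by (auto simp: moment_null_def)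
  have "f (\<lambda>x. \<eta> x * of_real ((x \<bullet> \<xi>) ^ k * ((p x + q x) * m x))) = 0" for \<xi> k
  proof -
    have t: "test_function (\<lambda>x. \<eta> x * of_real ((x \<bullet> \<xi>) ^ k * (p x * m x)))"
      "test_function (\<lambda>x. \<eta> x * of_real ((x \<bullet> \<xi>) ^ k * (q x * m x)))"
      by (intro test_function_mult(1)[OF \<eta>] smooth_of_real smooth_mult[OF smooth_power]
          smooth_inner_left sm)+
    have "f (\<lambda>x. \<eta> x * of_real ((x \<bullet> \<xi>) ^ k * ((p x + q x) * m x))) =
        f (\<lambda>x. \<eta> x * of_real ((x \<bullet> \<xi>) ^ k * (p x * m x)) + \<eta> x * of_real ((x \<bullet> \<xi>) ^ k * (q x * m x)))"
      by (simp add: algebra_simps)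
    then show ?thesis using distribution_add[OF f t] p q by (simp add: moment_null_def)
  qed
  then show ?case unfolding moment_null_def
    using smooth_add[OF sm] by (simp add: distrib_right)
next
  case (mult p q)
  then show ?case by (simp only: mult.assoc)
qed

text \<open>Finite sums of a polynomial in \<open>x\<close> times a continuous function of
  \<open>y\<close>. A polynomial in \<open>x - y\<close> has this form, so integrating it against a
  function of \<open>y\<close> leaves a polynomial in \<open>x\<close>.\<close>

inductive separable :: "('a::euclidean_space \<Rightarrow> 'a \<Rightarrow> real) \<Rightarrow> bool" where
  product: "real_polynomial_function a \<Longrightarrow> continuous_on UNIV b \<Longrightarrow> separable (\<lambda>x y. a x * b y)"
| sum: "separable G \<Longrightarrow> separable H \<Longrightarrow> separable (\<lambda>x y. G x y + H x y)"

lemma separable_mult: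
  assumes "separable G" "separable H"
  shows "separable (\<lambda>x y. G x y * H x y)"
  using assms(1)
proof induction
  case (product a b)
  from assms(2) show ?case
  proof induction
    case (product a' b')
    have "separable (\<lambda>x y. (a x * a' x) * (b y * b' y))"
      using product \<open>real_polynomial_function a\<close> \<open>continuous_on UNIV b\<close>
      by (intro separable.product real_polynomial_function.intros(4) continuous_on_mult)
    then show ?case by (simp add: mult_ac)
  next
    case (sum G H)
    then show ?case using separable.sum[OF sum.IH] by (simp add: distrib_left)
  qed
next
  case (sum G G')
  then show ?case using separable.sum[OF sum.IH] by (simp add: distrib_right)
qed

lemma separable_translate:
  assumes "real_polynomial_function p"
  shows "separable (\<lambda>x y. p (x - y))"
  using assms
proof induction
  case (linear L)
  then have "continuous_on UNIV (\<lambda>y. - L y)"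
    by (intro continuous_intros linear_continuous_on)
  then have "separable (\<lambda>x y. L x * 1 + 1 * (- L y))"
    by (intro separable.intros real_polynomial_function.intros linear continuous_on_const)
  then show ?case by (simp add: bounded_linear.linear[OF linear] linear_diff)
next
  case (const c)
  then show ?case
    using separable.product[OF real_polynomial_function.intros(2)[of c] continuous_on_const[of _ 1]] by simp
qed (auto intro: separable.sum separable_mult)

lemma integrable_test_function_mult:
  fixes \<phi> :: "'a::euclidean_space \<Rightarrow> complex"
  assumes \<phi>: "test_function \<phi>" and g: "continuous_on UNIV g"
  shows "integrable lborel (\<lambda>y. \<phi> y * g y)"
proof -
  have "integrable lborel (\<lambda>y. indicator (fun_support \<phi>) y *\<^sub>R (\<phi> y * g y))"
    using \<phi> by (intro borel_integrable_compact continuous_on_mult continuous_on_subset[OF g]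
        smooth_continuous_on[of \<phi>]) (auto simp: test_function_def)
  moreover have "indicator (fun_support \<phi>) y *\<^sub>R (\<phi> y * g y) = \<phi> y * g y" for y
    by (cases "y \<in> fun_support \<phi>") (simp_all add: not_in_fun_support)
  ultimately show ?thesis by simp
qed

lemma smooth_real_polynomial_function: "real_polynomial_function p \<Longrightarrow> smooth p"
  by (induction rule: real_polynomial_function.induct)
    (auto intro: smooth_linear smooth_const smooth_add smooth_mult)

text \<open>Each product contributes a polynomial in \<open>x\<close> times the constant obtained by
  integrating out \<open>y\<close>, and all polynomial moments vanish. Integrability and smoothness
  ride along in the induction because the sum step needs both.\<close>

lemma separable_integral_null:
  fixes f :: "('a::euclidean_space \<Rightarrow> complex) \<Rightarrow> complex"
  assumes f: "distribution f" and \<eta>: "test_function \<eta>" and null: "moment_null f \<eta> (\<lambda>x. 1)"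
    and \<phi>: "test_function \<phi>" and G: "separable G"
  shows "(\<forall>x. integrable lborel (\<lambda>y. \<phi> y * of_real (G x y))) \<and>
    smooth (\<lambda>x. LINT y|lborel. \<phi> y * of_real (G x y)) \<and>
    f (\<lambda>x. \<eta> x * (LINT y|lborel. \<phi> y * of_real (G x y))) = 0"
  using G
proof induction
  case (product a b)
  have "continuous_on UNIV (\<lambda>y. complex_of_real (b y))"
    using product by (intro continuous_intros)
  then have int: "integrable lborel (\<lambda>y. \<phi> y * of_real (b y))"
    by (rule integrable_test_function_mult[OF \<phi>])
  define I where "I = (LINT y|lborel. \<phi> y * of_real (b y))"
  have eq: "\<phi> y * of_real (a x * b y) = of_real (a x) * (\<phi> y * of_real (b y))" for x y
    by simp
  have I: "(LINT y|lborel. \<phi> y * of_real (a x * b y)) = of_real (a x) * I" for x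
    unfolding eq I_def by (rule integral_mult_right_zero)
  have sma: "smooth (\<lambda>x. complex_of_real (a x))"
    using product by (intro smooth_of_real smooth_real_polynomial_function)
  have t: "test_function (\<lambda>x. \<eta> x * of_real (a x))" by (rule test_function_mult(1)[OF \<eta> sma])
  have "moment_null f \<eta> (\<lambda>x. a x * 1)"
    by (rule moment_null_polynomial_mult[OF f \<eta> product(1) null])
  then have "f (\<lambda>x. \<eta> x * of_real ((x \<bullet> 0) ^ 0 * (a x * 1))) = 0"
    unfolding moment_null_def by blast
  then have "f (\<lambda>x. \<eta> x * of_real (a x)) = 0" by simp
  then have "f (\<lambda>x. I * (\<eta> x * of_real (a x))) = 0"
    using distribution_scale[OF f t] by simp
  then have "f (\<lambda>x. \<eta> x * (of_real (a x) * I)) = 0" by (simp add: mult_ac)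
  then show ?case
    unfolding I using int smooth_mult[OF sma smooth_const]
    by (simp add: eq del: of_real_mult)
next
  case (sum G H)
  let ?I = "\<lambda>G x. LINT y|lborel. \<phi> y * of_real (G x y)"
  have int: "integrable lborel (\<lambda>y. \<phi> y * of_real (G x y))" "integrable lborel (\<lambda>y. \<phi> y * of_real (H x y))" for x
    using sum.IH by blast+
  have sm: "smooth (?I G)" "smooth (?I H)" and z: "f (\<lambda>x. \<eta> x * ?I G x) = 0" "f (\<lambda>x. \<eta> x * ?I H x) = 0"
    using sum.IH by blast+
  have eq: "\<phi> y * of_real (G x y + H x y) = \<phi> y * of_real (G x y) + \<phi> y * of_real (H x y)" for x y
    by (simp add: distrib_left)
  have I: "(LINT y|lborel. \<phi> y * of_real (G x y + H x y)) = ?I G x + ?I H x" for x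
    unfolding eq by (rule Bochner_Integration.integral_add[OF int])
  have "f (\<lambda>x. \<eta> x * (?I G x + ?I H x)) = 0"
    unfolding distrib_left
    using distribution_add[OF f test_function_mult(1)[OF \<eta> sm(1)] test_function_mult(1)[OF \<eta> sm(2)]] z
    by simp
  then show ?case
    unfolding I using smooth_add[OF sm] Bochner_Integration.integrable_add[OF int]
    by (simp add: distrib_left)
qed

lemma test_function_derivative_bounded:
  fixes \<phi> :: "'a::euclidean_space \<Rightarrow> complex"
  assumes \<phi>: "test_function \<phi>" and bs: "set bs \<subseteq> Basis"
  obtains B where "0 \<le> B" "\<And>x. norm (iter_pderiv bs \<phi> x) \<le> B"
proof -
  have sm: "smooth (iter_pderiv bs \<phi>)" using \<phi> bs by (intro smooth_iter_pderiv) (simp_all add: test_function_def)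
  have "bounded (iter_pderiv bs \<phi> ` fun_support \<phi>)"
    using \<phi> by (intro compact_imp_bounded compact_continuous_image smooth_continuous_on[OF sm])
      (simp add: test_function_def)
  then obtain B where "\<And>x. x \<in> fun_support \<phi> \<Longrightarrow> norm (iter_pderiv bs \<phi> x) \<le> B"
    unfolding bounded_iff by blast
  then have "norm (iter_pderiv bs \<phi> x) \<le> max B 0" for x
    by (cases "x \<in> fun_support \<phi>") (auto simp: iter_pderiv_outside_support le_max_iff_disj)
  then show ?thesis by (intro that[of "max B 0"]) auto
qed

lemma iter_pderiv_translate:
  fixes \<phi> :: "'a::euclidean_space \<Rightarrow> complex"
  assumes "smooth \<phi>" "set bs \<subseteq> Basis"
  shows "iter_pderiv bs (\<lambda>x. \<phi> (x - z)) = (\<lambda>x. iter_pderiv bs \<phi> (x - z))"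
  using assms(2)
proof (induction bs)
  case (Cons b bs)
  have D: "((\<lambda>x. iter_pderiv bs \<phi> (x - z)) has_derivative
      frechet_derivative (iter_pderiv bs \<phi>) (at (x - z))) (at x)" for x
  proof -
    have "((\<lambda>x. x - z) has_derivative (\<lambda>h. h)) (at x)"
      by (auto intro!: derivative_eq_intros)
    from has_derivative_compose[OF this smooth_has_derivative[OF smooth_iter_pderiv[OF assms(1)]]]
    show ?thesis using Cons.prems by simp
  qed
  show ?case using Cons by (simp add: pd_eqI[OF D])
qed simp

text \<open>\<open>\<beta>\<close> is a normalized tent, one member of an approximate identity, and
  \<open>p\<close> its Stone-Weierstrass approximation on the ball. Positivity, small support and
  mass one belong to \<open>\<beta>\<close>; \<open>p\<close> is only uniformly close to it
  there.\<close>

lemma polynomial_kernel_exists: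
  fixes R e :: real
  defines "M \<equiv> restrict_space lborel (cball (0::'a::euclidean_space) (2 * R))"
  assumes "1 \<le> R" "0 < e" "e \<le> 1"
  shows "\<exists>p \<beta>. real_polynomial_function p \<and> continuous_on UNIV \<beta> \<and> (\<forall>z::'a. 0 \<le> \<beta> z) \<and>
    (\<forall>z. e \<le> norm z \<longrightarrow> \<beta> z = 0) \<and> (LINT z|M. \<beta> z) = 1 \<and>
    (\<forall>z\<in>cball 0 (2 * R). \<bar>\<beta> z - p z\<bar> < e)"
proof -
  define tent where "tent z = max 0 (1 - norm z / e)" for z :: 'a
  have cont: "continuous_on UNIV tent" unfolding tent_def by (intro continuous_intros) (use assms in auto)
  have int: "integrable lborel (\<lambda>z. indicator (cball 0 (2 * R)) z *\<^sub>R tent z)"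
    using cont by (intro borel_integrable_compact) (auto intro: continuous_on_subset)
  define c where "c = (LINT z|M. tent z)"
  have c: "c = (LINT z|lborel. indicator (cball 0 (2 * R)) z *\<^sub>R tent z)"
    unfolding c_def M_def by (rule integral_restrict_space) simp
  let ?B = "ball (0::'a) (e / 2)"
  \<comment> \<open>The tent is at least \<open>1 / 2\<close> on the ball of radius
    \<open>e / 2\<close>, which makes its mass \<open>c\<close> positive.\<close>
  have "0 < measure lborel ?B * (1 / 2)" using content_ball_pos[of "e / 2" "0::'a"] assms by simp
  also have "\<dots> = (LINT z|lborel. indicator ?B z *\<^sub>R (1 / 2 :: real))"
    using emeasure_lborel_ball_finite[of "0::'a" "e / 2"] by simp
  also have "\<dots> \<le> c"
    unfolding c
  proof (rule Bochner_Integration.integral_mono[OF _ int])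
    show "integrable lborel (\<lambda>z. indicator ?B z *\<^sub>R (1 / 2 :: real))"
      using emeasure_lborel_ball_finite[of "0::'a" "e / 2"] by simp
    fix z :: 'a
    have "1 / 2 \<le> tent z" if "norm z < e / 2" using that assms by (simp add: tent_def field_simps)
    moreover have "z \<in> cball 0 (2 * R)" if "norm z < e / 2" using that assms by simp
    moreover have "0 \<le> tent z" by (simp add: tent_def)
    ultimately show "indicator ?B z *\<^sub>R (1 / 2) \<le> indicator (cball 0 (2 * R)) z *\<^sub>R tent z"
      by (auto simp: indicator_def)
  qed
  finally have cpos: "0 < c" .
  define \<beta> where "\<beta> z = tent z / c" for z
  have cont\<beta>: "continuous_on S \<beta>" for S
    unfolding \<beta>_def using cont cpos by (intro continuous_intros) (auto intro: continuous_on_subset)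
  obtain p where p: "real_polynomial_function p" "\<And>z. z \<in> cball 0 (2 * R) \<Longrightarrow> \<bar>\<beta> z - p z\<bar> < e"
    using Stone_Weierstrass_real_polynomial_function[OF compact_cball cont\<beta> \<open>0 < e\<close>] by blast
  have "(LINT z|M. \<beta> z) = 1" unfolding \<beta>_def using cpos by (simp add: c_def[symmetric])
  moreover have "0 \<le> \<beta> z" for z using cpos by (simp add: \<beta>_def tent_def)
  moreover have "\<beta> z = 0" if "e \<le> norm z" for z using that assms by (simp add: \<beta>_def tent_def field_simps max_def)
  ultimately show ?thesis using p cont\<beta> by blast
qed

lemma integral_reflect_translate:
  fixes F :: "'a::euclidean_space \<Rightarrow> complex"
  assumes "F \<in> borel_measurable borel"
  shows "(LINT z|lborel. F (x - z)) = (LINT y|lborel. F y)"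
proof -
  have "lborel = distr lborel borel (\<lambda>z. x + (- 1) *\<^sub>R z)"
    using lborel_affine[of "-1" x] by (simp add: density_1)
  then have "(LINT y|lborel. F y) = (LINT y|distr lborel borel (\<lambda>z. x + (- 1) *\<^sub>R z). F y)" by simp
  also have "\<dots> = (LINT z|lborel. F (x + (- 1) *\<^sub>R z))"
    by (rule integral_distr) (use assms in auto)
  finally show ?thesis by simp
qed

text \<open>\<open>S i\<close> is the convolution of \<open>\<phi>\<close> with a truncated polynomial \<open>p i\<close> close to an approximate identity:
  derivatives fall on \<open>\<phi>\<close>, while on the support of \<open>\<eta>\<close> the truncation is invisible and \<open>S i\<close> is a
  polynomial.\<close>

theorem moments_determine:
  fixes f :: "('a::euclidean_space \<Rightarrow> complex) \<Rightarrow> complex"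
  assumes f: "distribution f" and \<eta>: "test_function \<eta>" and \<phi>: "test_function \<phi>"
    and null: "\<And>\<xi> k. f (\<lambda>x. \<eta> x * of_real ((x \<bullet> \<xi>) ^ k)) = 0"
  shows "f (\<lambda>x. \<eta> x * \<phi> x) = 0"
proof -
  have mn: "moment_null f \<eta> (\<lambda>x. 1)"
    using null by (simp add: moment_null_def smooth_const)
  define K where "K = fun_support \<eta>"
  have K: "compact K" and sm\<eta>: "smooth \<eta>" using \<eta> by (auto simp: K_def test_function_def)
  have sm\<phi>: "smooth \<phi>" and c\<phi>: "compact (fun_support \<phi>)" using \<phi> by (auto simp: test_function_def)
  obtain C N where CN: "\<And>\<phi>. test_function \<phi> \<Longrightarrow> fun_support \<phi> \<subseteq> K \<Longrightarrow> norm (f \<phi>) \<le>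
      C * (\<Sum>bs | set bs \<subseteq> Basis \<and> length bs \<le> N. SUP x. norm (iter_pderiv bs \<phi> x))"
    using distribution_bound[OF f K] by blast
  have "bounded (K \<union> fun_support \<phi>)" using K c\<phi> by (simp add: compact_imp_bounded)
  then obtain R0 where R0: "\<And>x. x \<in> K \<union> fun_support \<phi> \<Longrightarrow> norm x \<le> R0"
    unfolding bounded_iff by blast
  \<comment> \<open>\<open>R\<close> bounds both supports, so differences of their points lie in the
    ball of radius \<open>2 * R\<close>, where \<open>p\<close> is controlled. The lower bound
    \<open>1\<close> leaves room for kernels of width at most \<open>1\<close>.\<close>
  define R where "R = max 1 R0"
  have R: "1 \<le> R" "\<And>x. x \<in> K \<Longrightarrow> norm x \<le> R" "\<And>x. x \<in> fun_support \<phi> \<Longrightarrow> norm x \<le> R"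
    using R0 by (force simp: R_def)+
  define M where "M = restrict_space lborel (cball (0::'a) (2 * R))"
  have spM: "space M = cball 0 (2 * R)" by (simp add: M_def space_restrict_space)
  interpret M: finite_measure M
  proof (rule finite_measureI)
    have "emeasure M (space M) = emeasure lborel (cball (0::'a) (2 * R))"
      unfolding spM unfolding M_def by (rule emeasure_restrict_space) auto
    then show "emeasure M (space M) \<noteq> \<infinity>"
      using emeasure_lborel_cball_finite[of "0::'a" "2 * R"] by simp
  qed
  have measM: "h \<in> borel_measurable M" if "continuous_on UNIV h" for h :: "'a \<Rightarrow> 'b::topological_space"
    unfolding M_def by (rule measurable_restrict_space1) (use that borel_measurable_continuous_onI in auto)
  have intM: "integrable M h" if "continuous_on UNIV h" for h :: "'a \<Rightarrow> 'b::{banach, second_countable_topology}"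
  proof -
    have "bounded (h ` cball 0 (2 * R))"
      using that by (intro compact_imp_bounded compact_continuous_image) (auto intro: continuous_on_subset)
    then obtain B where "\<And>z. z \<in> cball 0 (2 * R) \<Longrightarrow> norm (h z) \<le> B" unfolding bounded_iff by blast
    then show ?thesis
      by (intro M.integrable_const_bound[of _ B] AE_I2 measM[OF that]) (simp add: spM)
  qed
  have "\<exists>p \<beta>. real_polynomial_function p \<and> continuous_on UNIV \<beta> \<and> (\<forall>z::'a. 0 \<le> \<beta> z) \<and>
    (\<forall>z. 1 / real (Suc i) \<le> norm z \<longrightarrow> \<beta> z = 0) \<and> (LINT z|M. \<beta> z) = 1 \<and>
    (\<forall>z\<in>cball 0 (2 * R). \<bar>\<beta> z - p z\<bar> < 1 / real (Suc i))" for i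
    unfolding M_def using R(1) by (intro polynomial_kernel_exists) auto
  then obtain p \<beta> where p: "\<And>i. real_polynomial_function (p i)" and \<beta>: "\<And>i. continuous_on UNIV (\<beta> i)"
    "\<And>i z. 0 \<le> \<beta> i z" "\<And>i z. 1 / real (Suc i) \<le> norm z \<Longrightarrow> \<beta> i z = 0" "\<And>i. (LINT z|M. \<beta> i z) = 1"
    and p\<beta>: "\<And>i z. z \<in> cball 0 (2 * R) \<Longrightarrow> \<bar>\<beta> i z - p i z\<bar> < 1 / real (Suc i)"
    by metis
  have contp: "continuous_on S (p i)" for S i
    by (rule smooth_continuous_on[OF smooth_real_polynomial_function[OF p]])
  have contt: "continuous_on UNIV (\<lambda>z. iter_pderiv bs \<phi> (x - z))" if "set bs \<subseteq> Basis" for bs x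
    by (rule continuous_on_compose2[OF smooth_continuous_on[OF smooth_iter_pderiv[OF sm\<phi> that], of UNIV]])
      (auto intro!: continuous_intros)
  define g where "g i z x = complex_of_real (p i z) * \<phi> (x - z)" for i z x
  define S where "S i x = (LINT z|M. g i z x)" for i x
  have smt: "smooth (\<lambda>x. \<phi> (x - z))" for z
    by (rule smooth_compose[OF sm\<phi> smooth_diff[OF smooth_id smooth_const]])
  have smg: "smooth (g i z)" for i z
    unfolding g_def[abs_def] by (rule smooth_mult[OF smooth_const smt])
  have dg: "iter_pderiv bs (g i z) = (\<lambda>x. of_real (p i z) * iter_pderiv bs \<phi> (x - z))"
    if "set bs \<subseteq> Basis" for bs i z
    unfolding g_def[abs_def] iter_pderiv_linear_comp[OF bounded_linear_mult_right smt that]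
      iter_pderiv_translate[OF sm\<phi> that] ..
  have measg: "(\<lambda>z. iter_pderiv bs (g i z) x) \<in> borel_measurable M" if "set bs \<subseteq> Basis" for bs i x
    unfolding dg[OF that] by (intro measM continuous_on_mult continuous_on_of_real contp contt[OF that])
  have boundg: "\<exists>B. \<forall>z\<in>space M. \<forall>x\<in>cball 0 r. norm (iter_pderiv bs (g i z) x) \<le> B"
    if bs: "set bs \<subseteq> Basis" for bs i r
  proof -
    obtain B where B: "0 \<le> B" "\<And>x. norm (iter_pderiv bs \<phi> x) \<le> B"
      using test_function_derivative_bounded[OF \<phi> bs] by blast
    have "bounded (p i ` cball 0 (2 * R))"
      by (intro compact_imp_bounded compact_continuous_image contp compact_cball)
    then obtain P where P: "\<And>z. z \<in> cball 0 (2 * R) \<Longrightarrow> norm (p i z) \<le> P" unfolding bounded_iff by blast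
    have "norm (iter_pderiv bs (g i z) x) \<le> P * B" if "z \<in> space M" for z x
      unfolding dg[OF bs] norm_mult norm_of_real
      using P[of z] that B by (intro mult_mono) (auto simp: spM)
    then show ?thesis by blast
  qed
  have smS: "smooth (S i)" for i
    unfolding S_def[abs_def] by (rule M.smooth_integral(1)[OF smg measg boundg])
  have dS: "iter_pderiv bs (S i) = (\<lambda>x. LINT z|M. of_real (p i z) * iter_pderiv bs \<phi> (x - z))"
    if "set bs \<subseteq> Basis" for bs i
  proof -
    have "iter_pderiv bs (S i) = (\<lambda>x. LINT z|M. iter_pderiv bs (g i z) x)"
      unfolding S_def[abs_def] by (rule M.smooth_integral(2)[OF smg measg boundg that])
    then show ?thesis by (simp only: dg[OF that])
  qed
  have S_poly: "S i x = (LINT y|lborel. \<phi> y * of_real (p i (x - y)))" if nx: "norm x \<le> R" for i x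
  proof -
    have "S i x = (LINT z|lborel. indicator (cball 0 (2 * R)) z *\<^sub>R g i z x)"
      unfolding S_def M_def by (rule integral_restrict_space) simp
    also have "\<dots> = (LINT z|lborel. \<phi> (x - z) * of_real (p i (x - (x - z))))"
    proof (rule arg_cong[where f = "integral\<^sup>L lborel"], rule ext)
      fix z
      show "indicator (cball 0 (2 * R)) z *\<^sub>R g i z x = \<phi> (x - z) * of_real (p i (x - (x - z)))"
      proof (cases "x - z \<in> fun_support \<phi>")
        case True
        then have "norm z \<le> 2 * R" using R(3)[OF True] nx norm_triangle_ineq4[of x "x - z"] by simp
        then show ?thesis by (simp add: g_def)
      qed (simp add: g_def not_in_fun_support)
    qed
    also have "\<dots> = (LINT y|lborel. \<phi> y * of_real (p i (x - y)))"
    proof (rule integral_reflect_translate)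
      have "continuous_on UNIV (\<lambda>y. p i (x - y))"
        by (rule continuous_on_compose2[OF contp[of UNIV]]) (auto intro!: continuous_intros)
      then show "(\<lambda>y. \<phi> y * of_real (p i (x - y))) \<in> borel_measurable borel"
        by (intro borel_measurable_continuous_onI continuous_on_mult continuous_on_of_real
            smooth_continuous_on[OF sm\<phi>])
    qed
    finally show ?thesis .
  qed
  have f0: "f (\<lambda>x. \<eta> x * S i x) = 0" for i
  proof -
    have "(\<lambda>x. \<eta> x * S i x) = (\<lambda>x. \<eta> x * (LINT y|lborel. \<phi> y * of_real (p i (x - y))))"
    proof
      fix x show "\<eta> x * S i x = \<eta> x * (LINT y|lborel. \<phi> y * of_real (p i (x - y)))"
        by (cases "x \<in> K") (simp_all add: S_poly[OF R(2)] K_def not_in_fun_support)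
    qed
    then show ?thesis
      using separable_integral_null[OF f \<eta> mn \<phi> separable_translate[OF p[of i]]] by simp
  qed
  have "cnull N K (\<lambda>i x. S i x - \<phi> x)"
    unfolding cnull_iff
  proof (intro allI impI)
    fix bs :: "'a list" assume "set bs \<subseteq> Basis \<and> length bs \<le> N"
    then have bs: "set bs \<subseteq> Basis" by blast
    let ?\<psi> = "iter_pderiv bs \<phi>"
    obtain B where B: "0 \<le> B" "\<And>x. norm (?\<psi> x) \<le> B"
      using test_function_derivative_bounded[OF \<phi> bs] by blast
    have cont\<psi>: "continuous_on T ?\<psi>" for T by (rule smooth_continuous_on[OF smooth_iter_pderiv[OF sm\<phi> bs]])
    show "uniform_limit K (\<lambda>i. iter_pderiv bs (\<lambda>x. S i x - \<phi> x)) (\<lambda>x. 0) sequentially"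
    proof (rule uniform_limitI)
      fix e :: real assume e: "0 < e"
      \<comment> \<open>\<open>\<beta> i\<close> vanishes on vectors of norm at least
        \<open>1\<close>, so the relevant translates of points of \<open>K\<close> stay in this
        larger ball.\<close>
      have "uniformly_continuous_on (cball 0 (R + 1)) ?\<psi>"
        by (rule compact_uniformly_continuous[OF cont\<psi> compact_cball])
      then obtain d where d: "0 < d" "\<And>x y. x \<in> cball 0 (R + 1) \<Longrightarrow> y \<in> cball 0 (R + 1) \<Longrightarrow>
          dist y x < d \<Longrightarrow> dist (?\<psi> y) (?\<psi> x) < e / 2"
        unfolding uniformly_continuous_on_def using half_gt_zero[OF e] by blast
      have lim1: "(\<lambda>i. 1 / real (Suc i)) \<longlonglongrightarrow> 0" by (rule LIMSEQ_Suc[OF lim_1_over_n])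
      then have "(\<lambda>i. 1 / real (Suc i) * (B * measure M (space M))) \<longlonglongrightarrow> 0 * (B * measure M (space M))"
        by (intro tendsto_mult tendsto_const)
      then have "(\<lambda>i. 1 / real (Suc i) * (B * measure M (space M))) \<longlonglongrightarrow> 0" by simp
      then have "\<forall>\<^sub>F i in sequentially. 1 / real (Suc i) * (B * measure M (space M)) < e / 2"
        using half_gt_zero[OF e] by (rule order_tendstoD)
      moreover have "\<forall>\<^sub>F i in sequentially. 1 / real (Suc i) < d"
        using lim1 d(1) by (rule order_tendstoD)
      ultimately show "\<forall>\<^sub>F i in sequentially. \<forall>x\<in>K. dist (iter_pderiv bs (\<lambda>x. S i x - \<phi> x) x) 0 < e"
      proof eventually_elim
        case (elim i)
        show ?case
        proof
          fix x assume x: "x \<in> K"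
          let ?\<epsilon> = "1 / real (Suc i)"
          have int: "integrable M (\<lambda>z. of_real (p i z) * ?\<psi> (x - z))"
            by (intro intM continuous_on_mult continuous_on_of_real contp contt[OF bs])
          have int\<beta>: "integrable M (\<lambda>z. of_real (\<beta> i z) * ?\<psi> x)"
            by (intro intM continuous_on_mult continuous_on_of_real \<beta>(1) continuous_on_const)
          have mass: "(LINT z|M. of_real (\<beta> i z) * ?\<psi> x) = ?\<psi> x"
            by (simp add: \<beta>(4))
          have "iter_pderiv bs (\<lambda>x. S i x - \<phi> x) x = iter_pderiv bs (S i) x - ?\<psi> x"
            by (rule fun_cong[OF iter_pderiv_diff[OF smS sm\<phi> bs]])
          also have "\<dots> = (LINT z|M. of_real (p i z) * ?\<psi> (x - z) - of_real (\<beta> i z) * ?\<psi> x)"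
            unfolding Bochner_Integration.integral_diff[OF int int\<beta>] mass dS[OF bs] ..
          \<comment> \<open>Two errors: replacing \<open>p\<close> by \<open>\<beta>\<close> costs
            at most \<open>?\<epsilon> * B\<close> pointwise, and moving \<open>x - z\<close> to
            \<open>x\<close> costs at most \<open>e / 2\<close> times \<open>\<beta>\<close>, whose
            total mass is one.\<close>
          also have "norm \<dots> \<le> (LINT z|M. ?\<epsilon> * B + \<beta> i z * (e / 2))"
          proof (rule Bochner_Integration.integral_norm_bound_integral[OF
                Bochner_Integration.integrable_diff[OF int int\<beta>]])
            show "integrable M (\<lambda>z. ?\<epsilon> * B + \<beta> i z * (e / 2))"
              by (intro intM continuous_on_add continuous_on_mult continuous_on_const \<beta>(1))
            fix z assume "z \<in> space M"
            then have z: "z \<in> cball 0 (2 * R)" by (simp add: spM)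
            have "norm (of_real (p i z - \<beta> i z) * ?\<psi> (x - z)) \<le> ?\<epsilon> * B"
              unfolding norm_mult norm_of_real using p\<beta>[OF z, of i] B
              by (intro mult_mono) (auto simp: abs_minus_commute)
            moreover have "norm (of_real (\<beta> i z) * (?\<psi> (x - z) - ?\<psi> x)) \<le> \<beta> i z * (e / 2)"
            proof (cases "norm z < ?\<epsilon>")
              case True
              have "?\<epsilon> \<le> 1" by simp
              then have "norm z \<le> 1" using True by linarith
              then have "x \<in> cball 0 (R + 1)" "x - z \<in> cball 0 (R + 1)"
                using R(2)[OF x] norm_triangle_ineq4[of x z] by auto
              then have "dist (?\<psi> (x - z)) (?\<psi> x) < e / 2"
                using True elim(2) by (intro d(2)) (auto simp: dist_norm)
              then have "norm (?\<psi> (x - z) - ?\<psi> x) \<le> e / 2" by (simp add: dist_norm)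
              then show ?thesis
                using \<beta>(2)[of i z] by (simp only: norm_mult norm_of_real abs_of_nonneg mult_left_mono)
            next
              case False
              then show ?thesis using \<beta>(3)[of i z] by simp
            qed
            moreover have "of_real (p i z) * ?\<psi> (x - z) - of_real (\<beta> i z) * ?\<psi> x =
                of_real (p i z - \<beta> i z) * ?\<psi> (x - z) + of_real (\<beta> i z) * (?\<psi> (x - z) - ?\<psi> x)"
              by (simp add: algebra_simps)
            ultimately show "norm (of_real (p i z) * ?\<psi> (x - z) - of_real (\<beta> i z) * ?\<psi> x)
                \<le> ?\<epsilon> * B + \<beta> i z * (e / 2)"
              using norm_triangle_mono by metis
          qed
          also have "\<dots> = ?\<epsilon> * (B * measure M (space M)) + e / 2"
            using intM[OF \<beta>(1)[of i]] by (simp add: \<beta>(4))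
          also have "\<dots> < e" using elim(1) by linarith
          finally show "dist (iter_pderiv bs (\<lambda>x. S i x - \<phi> x) x) 0 < e" by simp
        qed
      qed
    qed
  qed
  then have "cnull N K (\<lambda>i x. \<eta> x * (S i x - \<phi> x))"
    by (rule cnull_mult[OF K sm\<eta> smooth_diff[OF smS sm\<phi>]])
  moreover have "test_function (\<lambda>x. \<eta> x * (S i x - \<phi> x))" for i
    by (rule test_function_mult(1)[OF \<eta> smooth_diff[OF smS sm\<phi>]])
  ultimately have "(\<lambda>i. f (\<lambda>x. \<eta> x * (S i x - \<phi> x))) \<longlonglongrightarrow> 0"
    using CN by (intro distribution_tendsto_0[of K f C N]) (auto simp: K_def fun_support_mult_subset)
  moreover have "f (\<lambda>x. \<eta> x * (S i x - \<phi> x)) = - f (\<lambda>x. \<eta> x * \<phi> x)" for i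
  proof -
    have t: "test_function (\<lambda>x. \<eta> x * S i x)" "test_function (\<lambda>x. \<eta> x * \<phi> x)"
      by (rule test_function_mult(1)[OF \<eta> smS], rule test_function_mult(1)[OF \<eta> sm\<phi>])
    have "f (\<lambda>x. \<eta> x * (S i x - \<phi> x)) = f (\<lambda>x. \<eta> x * S i x + (- 1) * (\<eta> x * \<phi> x))"
      by (rule arg_cong[where f = f]) (simp add: algebra_simps)
    also have "\<dots> = f (\<lambda>x. \<eta> x * S i x) + f (\<lambda>x. (- 1) * (\<eta> x * \<phi> x))"
      by (intro distribution_add[OF f] test_function_mult(2) t smooth_const)
    also have "\<dots> = - f (\<lambda>x. \<eta> x * \<phi> x)"
      by (simp only: distribution_scale[OF f t(2)] f0) simp
    finally show ?thesis .
  qed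
  ultimately have "(\<lambda>i :: nat. - f (\<lambda>x. \<eta> x * \<phi> x)) \<longlonglongrightarrow> 0" by simp
  then show ?thesis by (simp only: LIMSEQ_const_iff neg_equal_0_iff_equal)
qed

section \<open>Moments and the main theorem\<close>

text \<open>Raising the exponent by two shifts the sequence, so a polynomial factor in
  \<open>(x \<bullet> \<xi>)^2\<close> acts on the moments of fixed parity through
  \<open>act\<close>.\<close>

lemma act_even_moments:
  fixes f :: "('a::euclidean_space \<Rightarrow> complex) \<Rightarrow> complex"
  assumes f: "distribution f" and \<eta>: "test_function \<eta>"
  shows "test_function (\<lambda>x. \<eta> x * (poly c (of_real ((x \<bullet> \<xi>)\<^sup>2)) * of_real ((x \<bullet> \<xi>) ^ (2 * k + a)))) \<and>
    f (\<lambda>x. \<eta> x * (poly c (of_real ((x \<bullet> \<xi>)\<^sup>2)) * of_real ((x \<bullet> \<xi>) ^ (2 * k + a)))) =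
      act c (\<lambda>j. f (\<lambda>x. \<eta> x * of_real ((x \<bullet> \<xi>) ^ (2 * j + a)))) k"
proof (induction c arbitrary: k)
  case 0
  show ?case
    using distribution_zero[OF f] test_functionI[of "\<lambda>x. 0" "{}"] by (simp add: smooth_const)
next
  case (pCons b c)
  let ?w = "\<lambda>k x. \<eta> x * of_real ((x \<bullet> \<xi>) ^ (2 * k + a))"
  let ?p = "\<lambda>k x. \<eta> x * (poly c (of_real ((x \<bullet> \<xi>)\<^sup>2)) * of_real ((x \<bullet> \<xi>) ^ (2 * k + a)))"
  have tw: "test_function (?w k)"
    by (rule test_function_mult(1)[OF \<eta> smooth_of_real[OF smooth_power[OF smooth_inner_left]]])
  have tbw: "test_function (\<lambda>x. b * ?w k x)"
    by (rule test_function_mult(2)[OF tw smooth_const])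
  have tp: "test_function (?p (Suc k))"
    and fp: "f (?p (Suc k)) = act c (\<lambda>j. f (?w j)) (Suc k)"
    using pCons.IH[of "Suc k"] by blast+
  have eq: "(\<lambda>x. \<eta> x * (poly (pCons b c) (of_real ((x \<bullet> \<xi>)\<^sup>2)) * of_real ((x \<bullet> \<xi>) ^ (2 * k + a)))) =
      (\<lambda>x. b * ?w k x + ?p (Suc k) x)"
    by (rule ext) (simp add: algebra_simps power2_eq_square)
  show ?case
    unfolding eq act_pCons distribution_add[OF f tbw tp] distribution_scale[OF f tw] fp
    using test_function_add[OF tbw tp] by simp
qed

lemma poly_linear_factor_power: "poly ([:- r, 1:] ^ n) z = (z - r) ^ n" for r :: complex
  by (simp add: poly_power)

text \<open>As \<open>\<rho>\<close> is homogeneous, the annihilated expression is homogeneous in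
  \<open>\<xi>\<close>, which carries the vanishing from unit vectors to all nonzero ones. At
  \<open>\<xi> = 0\<close> the factor with exponent \<open>N + 1\<close> is zero.\<close>

lemma even_moment_recurrence:
  fixes f :: "('a::euclidean_space \<Rightarrow> complex) \<Rightarrow> complex"
  assumes f: "distribution f" and \<eta>: "test_function \<eta>"
    and unit: "\<And>\<omega> k. \<omega> \<in> sphere 0 1 \<Longrightarrow>
      f (\<lambda>x. \<eta> x * of_real (((x \<bullet> \<omega>)\<^sup>2 - (\<rho> \<omega>)\<^sup>2) ^ Suc N * (x \<bullet> \<omega>) ^ k)) = 0"
    and hom: "\<And>t \<xi>. 0 < t \<Longrightarrow> \<rho> (t *\<^sub>R \<xi>) = t * \<rho> \<xi>" and zero: "\<rho> 0 = 0"
  shows "act ([:- of_real ((\<rho> \<xi>)\<^sup>2), 1:] ^ Suc N) (\<lambda>j. f (\<lambda>x. \<eta> x * of_real ((x \<bullet> \<xi>) ^ (2 * j + a)))) = (\<lambda>k. 0)"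
proof
  fix k
  have fact: "f (\<lambda>x. \<eta> x * of_real (((x \<bullet> \<xi>)\<^sup>2 - (\<rho> \<xi>)\<^sup>2) ^ Suc N * (x \<bullet> \<xi>) ^ (2 * k + a))) = 0"
  proof (cases "\<xi> = 0")
    case True
    then show ?thesis using distribution_zero[OF f] zero by simp
  next
    case False
    define t where "t = norm \<xi>"
    define \<omega> where "\<omega> = (1 / t) *\<^sub>R \<xi>"
    have t: "0 < t" and \<xi>: "\<xi> = t *\<^sub>R \<omega>" and \<omega>: "\<omega> \<in> sphere 0 1"
      using False by (simp_all add: t_def \<omega>_def)
    let ?F = "\<lambda>x. \<eta> x * of_real (((x \<bullet> \<omega>)\<^sup>2 - (\<rho> \<omega>)\<^sup>2) ^ Suc N * (x \<bullet> \<omega>) ^ (2 * k + a))"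
    let ?c = "(t\<^sup>2) ^ Suc N * t ^ (2 * k + a)"
    have tF: "test_function ?F"
      by (intro test_function_mult(1)[OF \<eta>] smooth_of_real smooth_mult smooth_power smooth_diff
          smooth_inner_left smooth_const)
    have "((x \<bullet> \<xi>)\<^sup>2 - (\<rho> \<xi>)\<^sup>2) ^ Suc N * (x \<bullet> \<xi>) ^ (2 * k + a) =
        ?c * (((x \<bullet> \<omega>)\<^sup>2 - (\<rho> \<omega>)\<^sup>2) ^ Suc N * (x \<bullet> \<omega>) ^ (2 * k + a))" for x
    proof -
      have "(x \<bullet> \<xi>)\<^sup>2 - (\<rho> \<xi>)\<^sup>2 = t\<^sup>2 * ((x \<bullet> \<omega>)\<^sup>2 - (\<rho> \<omega>)\<^sup>2)"
        unfolding \<xi> hom[OF t] by (simp add: power_mult_distrib right_diff_distrib)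
      moreover have "(x \<bullet> \<xi>) ^ (2 * k + a) = t ^ (2 * k + a) * (x \<bullet> \<omega>) ^ (2 * k + a)"
        unfolding \<xi> by (simp add: power_mult_distrib)
      ultimately show ?thesis by (simp only: power_mult_distrib mult_ac)
    qed
    then have "(\<lambda>x. \<eta> x * of_real (((x \<bullet> \<xi>)\<^sup>2 - (\<rho> \<xi>)\<^sup>2) ^ Suc N * (x \<bullet> \<xi>) ^ (2 * k + a))) =
        (\<lambda>x. of_real ?c * ?F x)"
      by (simp only: of_real_mult mult_ac)
    then show ?thesis
      using distribution_scale[OF f tF, of "of_real ?c"] unit[OF \<omega>] by simp
  qed
  have "(\<lambda>x. \<eta> x * (poly ([:- of_real ((\<rho> \<xi>)\<^sup>2), 1:] ^ Suc N) (of_real ((x \<bullet> \<xi>)\<^sup>2)) *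
      of_real ((x \<bullet> \<xi>) ^ (2 * k + a)))) =
      (\<lambda>x. \<eta> x * of_real (((x \<bullet> \<xi>)\<^sup>2 - (\<rho> \<xi>)\<^sup>2) ^ Suc N * (x \<bullet> \<xi>) ^ (2 * k + a)))"
    unfolding poly_linear_factor_power by (simp only: of_real_mult of_real_power of_real_diff)
  then show "act ([:- of_real ((\<rho> \<xi>)\<^sup>2), 1:] ^ Suc N)
      (\<lambda>j. f (\<lambda>x. \<eta> x * of_real ((x \<bullet> \<xi>) ^ (2 * j + a)))) k = 0"
    using act_even_moments[OF f \<eta>, of "[:- of_real ((\<rho> \<xi>)\<^sup>2), 1:] ^ Suc N" \<xi> k a] fact by simp
qed

lemma moment_on_line_polynomial:
  fixes f :: "('a::euclidean_space \<Rightarrow> complex) \<Rightarrow> complex"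
  assumes f: "distribution f" and \<eta>: "test_function \<eta>"
  obtains P where "\<And>k t. f (\<lambda>x. \<eta> x * of_real ((x \<bullet> (\<xi> + t *\<^sub>R \<zeta>)) ^ k)) = poly (P k) (of_real t)"
proof -
  define c where "c k j = of_nat (k choose j) * f (\<lambda>x. \<eta> x * of_real ((x \<bullet> \<zeta>) ^ j * (x \<bullet> \<xi>) ^ (k - j)))" for k j
  have "f (\<lambda>x. \<eta> x * of_real ((x \<bullet> (\<xi> + t *\<^sub>R \<zeta>)) ^ k)) = poly (\<Sum>j\<le>k. monom (c k j) j) (of_real t)" for k t
    using moment_expansion[OF f \<eta> smooth_const[of 1], of \<xi> t \<zeta> k]
    by (simp add: poly_sum poly_monom c_def)
  then show ?thesis by (rule that)
qed

lemma sphere_line_null_neighbourhood: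
  fixes D :: "'a::euclidean_space set"
  assumes D: "D \<noteq> {}" "bounded D" "uminus ` D = D"
    and supp: "hyperplane_dist_support u \<subseteq> supporting_planes D"
    and \<omega>: "\<omega> \<in> sphere 0 1" and p: "p \<notin> {support_function D \<omega>, - support_function D \<omega>}"
  shows "\<exists>W. hyperplane_open W \<and> (\<omega>, p) \<in> W \<and> (\<forall>\<phi>. even_smooth \<phi> \<longrightarrow>
    compact (sphere_line_support \<phi>) \<longrightarrow> sphere_line_support \<phi> \<subseteq> W \<longrightarrow> u \<phi> = 0)"
proof -
  have "hyperplane (\<omega>, p) \<notin> supporting_planes D"
    using supporting_plane_imp[OF D, of \<omega> p] p by blast
  then have "hyperplane (\<omega>, p) \<notin> hyperplane_dist_support u" using supp by blast
  moreover have "(\<omega>, p) \<in> sphere_line" using \<omega> by simp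
  ultimately show ?thesis unfolding hyperplane_dist_support_def by blast
qed

lemma zero_in_symmetric_convex:
  assumes "convex D" "uminus ` D = D" "D \<noteq> {}"
  shows "0 \<in> D"
proof -
  obtain x where x: "x \<in> D" using assms(3) by blast
  then have "- x \<in> D" using assms(2) by blast
  with x have "(1 / 2) *\<^sub>R x + (1 / 2) *\<^sub>R (- x) \<in> D" by (intro convexD[OF assms(1)]) auto
  then show ?thesis by simp
qed

text \<open>Moments of either parity of \<open>f\<close> in direction \<open>\<xi>\<close> satisfy a recurrence whose only characteristic
  root is the square of the support function; so that square is a polynomial on every line through a
  point where some moment does not vanish, and such points are dense.\<close>

lemma support_function_square_on_line:
  fixes D :: "'a::euclidean_space set"
  assumes D: "D \<noteq> {}" "bounded D"
    and f: "distribution f" and \<eta>: "test_function \<eta>"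
    and rec: "\<And>\<xi> a. act ([:- of_real ((support_function D \<xi>)\<^sup>2), 1:] ^ M)
      (\<lambda>j. f (\<lambda>x. \<eta> x * of_real ((x \<bullet> \<xi>) ^ (2 * j + a)))) = (\<lambda>k. 0)"
    and nz: "f (\<lambda>x. \<eta> x * of_real ((x \<bullet> \<xi>1) ^ k1)) \<noteq> 0"
  shows "(support_function D (x + t *\<^sub>R y))\<^sup>2 = (support_function D x)\<^sup>2
      + t * (((support_function D (x + y))\<^sup>2 - (support_function D (x - y))\<^sup>2) / 2)
      + t\<^sup>2 * (support_function D y)\<^sup>2"
proof -
  let ?\<rho> = "support_function D"
  let ?P = "\<lambda>k \<xi>. f (\<lambda>x. \<eta> x * of_real ((x \<bullet> \<xi>) ^ k))"
  define q where "q \<xi> = (?\<rho> \<xi>)\<^sup>2" for \<xi>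
  have contq: "continuous_on S q" for S
    unfolding q_def by (intro continuous_intros continuous_on_support_function[OF D])
  have homq: "q (c *\<^sub>R \<xi>) = c\<^sup>2 * q \<xi>" if "0 < c" for c \<xi>
    unfolding q_def support_function_scaleR[OF D that] by (rule power_mult_distrib)
  obtain R where R: "0 \<le> R" "\<And>\<xi> \<zeta>. \<bar>?\<rho> \<xi> - ?\<rho> \<zeta>\<bar> \<le> R * norm (\<xi> - \<zeta>)"
    using support_function_lipschitz[OF D] by blast
  have growth: "\<bar>q \<xi>\<bar> \<le> R\<^sup>2 * (norm \<xi>)\<^sup>2" for \<xi>
  proof -
    have "\<bar>?\<rho> \<xi>\<bar> \<le> R * norm \<xi>" using R(2)[of \<xi> 0] support_function_0[OF D] by simp
    then have "\<bar>?\<rho> \<xi>\<bar>\<^sup>2 \<le> (R * norm \<xi>)\<^sup>2" by (intro power_mono) auto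
    then show ?thesis by (simp add: q_def power_mult_distrib)
  qed
  have line: "q (\<xi> + t *\<^sub>R y) = q \<xi> + t * ((q (\<xi> + y) - q (\<xi> - y)) / 2) + t\<^sup>2 * q y"
    if good: "?P k1 \<xi> \<noteq> 0" for \<xi>
  proof -
    obtain P where P: "\<And>k t. ?P k (\<xi> + t *\<^sub>R y) = poly (P k) (of_real t)"
      using moment_on_line_polynomial[OF f \<eta>, of \<xi> y] by blast
    \<comment> \<open>The parity of a nonvanishing moment, so that the chosen subsequence is not
      identically zero.\<close>
    define a where "a = k1 mod 2"
    define s where "s j = P (2 * j + a)" for j
    \<comment> \<open>The algebra runs over complex polynomials; \<open>r\<close> is consulted only
      at real parameters, which \<open>Re\<close> recovers.\<close>
    define r where "r z = complex_of_real (q (\<xi> + Re z *\<^sub>R y))" for z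
    have "poly (s (k1 div 2)) 0 = ?P k1 \<xi>"
      using P[where k = k1 and t = 0] by (simp add: s_def a_def)
    then have snz: "s (k1 div 2) \<noteq> 0" using good by auto
    have inf: "infinite (range complex_of_real)"
      using finite_imageD[OF _ inj_of_real] infinite_UNIV_char_0 by blast
    have recz: "act ([:- r z, 1:] ^ M) (\<lambda>j. poly (s j) z) = (\<lambda>k. 0)"
      if zr: "z \<in> range complex_of_real" for z
    proof -
      obtain t where z: "z = of_real t" using zr by blast
      have "(\<lambda>j. poly (s j) z) = (\<lambda>j. ?P (2 * j + a) (\<xi> + t *\<^sub>R y))"
        unfolding s_def P z ..
      then show ?thesis
        using rec[of "\<xi> + t *\<^sub>R y" a] by (simp only: r_def z Re_complex_of_real q_def)
    qed
    obtain b where b: "finite {z \<in> range complex_of_real. r z \<noteq> poly b z}"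
      by (rule characteristic_root_polynomial[where T = "range complex_of_real" and r = r and s = s
            and M = M, OF inf _ snz]) (rule recz, assumption, rule that)
    have "finite (complex_of_real -` {z \<in> range complex_of_real. r z \<noteq> poly b z})"
      using b inj_of_real by (rule finite_vimageI)
    moreover have "complex_of_real -` {z \<in> range complex_of_real. r z \<noteq> poly b z} =
        {t. complex_of_real (q (\<xi> + t *\<^sub>R y)) \<noteq> poly b (of_real t)}"
      by (auto simp: r_def)
    ultimately have fin: "finite {t. complex_of_real (q (\<xi> + t *\<^sub>R y)) \<noteq> poly b (of_real t)}" by simp
    show ?thesis
      by (rule quadratic_on_line[OF contq homq growth fin])
  qed
  \<comment> \<open>Towards \<open>\<xi>1\<close> the moment is a nonzero polynomial in the
    parameter, so all but finitely many of the points \<open>x + (1 / (n + 1)) (\<xi>1 - x)\<close>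
    are good base points.\<close>
  obtain Q where Q: "\<And>k t. ?P k (x + t *\<^sub>R (\<xi>1 - x)) = poly (Q k) (of_real t)"
    using moment_on_line_polynomial[OF f \<eta>, of x "\<xi>1 - x"] by blast
  have "poly (Q k1) 1 \<noteq> 0" using Q[where k = k1 and t = 1] nz by simp
  then have "Q k1 \<noteq> 0" by auto
  then have "finite {z. poly (Q k1) z = 0}" by (rule poly_roots_finite)
  moreover have "inj (\<lambda>n. complex_of_real (1 / real (Suc n)))"
    by (rule injI) simp
  ultimately have "finite ((\<lambda>n. complex_of_real (1 / real (Suc n))) -` {z. poly (Q k1) z = 0})"
    by (rule finite_vimageI)
  then have "\<forall>\<^sub>F n in sequentially. poly (Q k1) (of_real (1 / real (Suc n))) \<noteq> 0"
    unfolding cofinite_eq_sequentially[symmetric] eventually_cofinite by (simp add: vimage_def)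
  then have ev: "\<forall>\<^sub>F n in sequentially. ?P k1 (x + (1 / real (Suc n)) *\<^sub>R (\<xi>1 - x)) \<noteq> 0"
    by (simp only: Q)
  \<comment> \<open>The defect of the identity as a function of the base point alone. It is
    continuous and vanishes along good base points that tend to \<open>x\<close>.\<close>
  define F where "F \<xi> = q (\<xi> + t *\<^sub>R y) - (q \<xi> + t * ((q (\<xi> + y) - q (\<xi> - y)) / 2) + t\<^sup>2 * q y)" for \<xi>
  have "continuous_on UNIV F"
    unfolding F_def by (intro continuous_intros continuous_on_compose2[OF contq[of UNIV]]) auto
  moreover have "(\<lambda>n. x + (1 / real (Suc n)) *\<^sub>R (\<xi>1 - x)) \<longlonglongrightarrow> x + 0 *\<^sub>R (\<xi>1 - x)"
    by (intro tendsto_intros LIMSEQ_Suc[OF lim_1_over_n])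
  ultimately have "(\<lambda>n. F (x + (1 / real (Suc n)) *\<^sub>R (\<xi>1 - x))) \<longlonglongrightarrow> F (x + 0 *\<^sub>R (\<xi>1 - x))"
    by (rule continuous_on_tendsto_compose) auto
  moreover have "\<forall>\<^sub>F n in sequentially. F (x + (1 / real (Suc n)) *\<^sub>R (\<xi>1 - x)) = 0"
    using ev by (rule eventually_mono) (simp add: F_def line)
  then have "(\<lambda>n. F (x + (1 / real (Suc n)) *\<^sub>R (\<xi>1 - x))) \<longlonglongrightarrow> 0"
    by (rule tendsto_eventually)
  ultimately have "F (x + 0 *\<^sub>R (\<xi>1 - x)) = 0" by (rule LIMSEQ_unique)
  then show ?thesis by (simp add: F_def q_def)
qed

theorem theorem1:
  fixes D :: "(real ^ 'n) set"
  assumes "CARD('n) \<ge> 2"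
    and "open D" and "convex D" and "bounded D" and "uminus ` D = D"
    and "\<exists>f :: (real ^ 'n \<Rightarrow> complex) \<Rightarrow> complex.
           distribution f \<and> dist_nonzero f \<and> dist_support f \<subseteq> closure D \<and>
           hyperplane_dist_support (radon f) \<subseteq> supporting_planes D"
  shows "ellipsoid (frontier D)"
proof -
  obtain f :: "(real ^ 'n \<Rightarrow> complex) \<Rightarrow> complex" where f: "distribution f" "dist_nonzero f"
    "dist_support f \<subseteq> closure D" "hyperplane_dist_support (radon f) \<subseteq> supporting_planes D"
    using assms(6) by blast
  obtain \<phi>0 where \<phi>0: "test_function \<phi>0" "f \<phi>0 \<noteq> 0" using f(2) unfolding dist_nonzero_def by blast
  \<comment> \<open>An empty \<open>D\<close> would leave \<open>f\<close> an empty support, and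
    hence make it zero.\<close>
  have ne: "D \<noteq> {}"
  proof
    assume "D = {}"
    then have "dist_support f = {}" using f(3) by simp
    then show False using vanish_off_dist_support[OF f(1) \<phi>0(1)] \<phi>0(2) by simp
  qed
  \<comment> \<open>The very choice made in \<open>dist_pairing\<close>, so that
    \<open>radon f\<close> unfolds to a pairing with this cutoff.\<close>
  define \<eta> where "\<eta> = (SOME \<eta>. cutoff (dist_support f) \<eta>)"
  have "bounded (dist_support f)"
    by (rule bounded_subset[OF bounded_closure[OF assms(4)] f(3)])
  then have cut: "cutoff (dist_support f) \<eta>"
    unfolding \<eta>_def by (rule someI_ex[OF cutoff_exists])
  then have \<eta>: "test_function \<eta>" by (simp add: cutoff_def)
  have radon: "radon f \<phi> = f (\<lambda>x. \<eta> x * dual_radon \<phi> x)" for \<phi>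
    unfolding radon_def dist_pairing_def \<eta>_def ..
  have "f (\<lambda>x. \<eta> x * \<phi>0 x) \<noteq> 0"
    using cutoff_mult_eq[OF f(1) \<phi>0(1) cut] \<phi>0(2) by simp
  then obtain \<xi>1 k1 where nz: "f (\<lambda>x. \<eta> x * of_real ((x \<bullet> \<xi>1) ^ k1)) \<noteq> 0"
    using moments_determine[OF f(1) \<eta> \<phi>0(1)] by blast
  have "compact (fun_support \<eta>)" using \<eta> by (simp add: test_function_def)
  \<comment> \<open>The order \<open>N\<close> is fixed before any direction is chosen, and so it
    serves all slices.\<close>
  then obtain C N where CN: "\<And>\<phi>. test_function \<phi> \<Longrightarrow> fun_support \<phi> \<subseteq> fun_support \<eta> \<Longrightarrow>
      norm (f \<phi>) \<le> C * (\<Sum>bs | set bs \<subseteq> Basis \<and> length bs \<le> N. SUP x. norm (iter_pderiv bs \<phi> x))"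
    using distribution_bound[OF f(1)] by blast
  have unit: "f (\<lambda>x. \<eta> x * of_real (((x \<bullet> \<omega>)\<^sup>2 - (support_function D \<omega>)\<^sup>2) ^ Suc N * (x \<bullet> \<omega>) ^ k)) = 0"
    if \<omega>: "\<omega> \<in> sphere 0 1" for \<omega> k
  proof (rule slice_annihilated[OF f(1) \<eta> CN])
    fix g :: "real \<Rightarrow> complex" and V
    assume g: "smooth g" "open V" "{support_function D \<omega>, - support_function D \<omega>} \<subseteq> V"
      "\<And>p. p \<in> V \<Longrightarrow> g p = 0"
    show "f (\<lambda>x. \<eta> x * g (x \<bullet> \<omega>)) = 0"
    proof (rule slice_vanish[OF f(1) \<eta> \<omega> _ g])
      fix p assume "p \<notin> {support_function D \<omega>, - support_function D \<omega>}"
      then show "\<exists>W. hyperplane_open W \<and> (\<omega>, p) \<in> W \<and> (\<forall>\<phi>. even_smooth \<phi> \<longrightarrow>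
          compact (sphere_line_support \<phi>) \<longrightarrow> sphere_line_support \<phi> \<subseteq> W \<longrightarrow>
          f (\<lambda>x. \<eta> x * dual_radon \<phi> x) = 0)"
        unfolding radon[symmetric]
        by (rule sphere_line_null_neighbourhood[OF ne assms(4,5) f(4) \<omega>])
    qed
  qed
  have rec: "act ([:- of_real ((support_function D \<xi>)\<^sup>2), 1:] ^ Suc N)
      (\<lambda>j. f (\<lambda>x. \<eta> x * of_real ((x \<bullet> \<xi>) ^ (2 * j + a)))) = (\<lambda>k. 0)" for \<xi> a
    by (rule even_moment_recurrence[where \<rho> = "support_function D", OF f(1) \<eta> unit
          support_function_scaleR[OF ne assms(4)]
          support_function_0[OF ne assms(4)]])
  show ?thesis
  proof (rule ellipsoid_frontier[OF assms(2-5) zero_in_symmetric_convex[OF assms(3,5) ne]])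
    show "(support_function D (x + t *\<^sub>R y))\<^sup>2 = (support_function D x)\<^sup>2
      + t * (((support_function D (x + y))\<^sup>2 - (support_function D (x - y))\<^sup>2) / 2)
      + t\<^sup>2 * (support_function D y)\<^sup>2" for x y t
      by (rule support_function_square_on_line[OF ne assms(4) f(1) \<eta> rec nz])
  qed
qed

end
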